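(* Let $d\ge1$ and consider the continued fraction (CF) algorithm on the product algebra $\mathbb R^d$ with coordinate-wise Gauss map $T$ on $[0,1)^d$, $T(x)=1/x-\lfloor 1/x\rfloor$ (all operations coordinate-wise). Then: (a) A point $x=(x_i)\in\mathbb R^d$ has a finite expansion if and only if each $x_i$ is rational and furthermore the number of CF digits for each $x_i$ is the same. (b) A point $x=(x_i)\in\mathbb R^d$ has an infinite expansion if and only if $x$ is completely irrational, i.e. each coordinate $x_i$ of $x$ is irrational. In particular, almost every point has an infinite expansion. (c) A point $x\in\mathbb R^d$ has an eventually-repeating expansion if and only if it is a root of a non-degenerate quadratic equation $ax^2+bx+c=0$ with coefficients in the product algebra $\mathbb Z^d$. (d) For a completely irrational point $x$ (in $[0,1)^d$, with digits $a_1,a_2,\dots$), one has $x=1/(a_1+1/(a_2+\cdots))$, in the sense of convergence in the Euclidean topology. (e) The generalized Gauss map $T$ leaves invariant the probability measure $$\frac{1}{(\log 2)^d}\,\frac{1}{(1+x_1)\cdots(1+x_d)}\,dx_1\cdots dx_d .$$ (f) The CF mapping $T$ is exact, mixing of all orders, and ergodic (with respect to the measure in (e)).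
   Context: The product algebra $\mathbb R^d$ has coordinate-wise addition and multiplication; $\mathbb Z^d\subset\mathbb R^d$ is a subring. Let $\mathcal N\subset\mathbb R^d$ be the set of non-invertible elements, i.e. points with at least one zero coordinate. For $x\notin\mathcal N$, $1/x=(1/x_1,\dots,1/x_d)$, and $\lfloor x\rfloor=(\lfloor x_1\rfloor,\dots,\lfloor x_d\rfloor)$. The map $T$ is defined on $[0,1)^d\setminus\mathcal N$; in each coordinate it is the classical Gauss map $t\mapsto 1/t-\lfloor 1/t\rfloor$. Digits: for $x\in[0,1)^d$, the digits are $a_i=\lfloor 1/T^{i-1}(x)\rfloor\in\mathbb Z^d$, $i=1,2,\dots$, defined as long as $T^{i-1}(x)\notin\mathcal N$; the digit sequence stops if $T^n(x)\in\mathcal N$ for some $n$. For a general $x\in\mathbb R^d$ one uses the digits of $x-\lfloor x\rfloor\in[0,1)^d$. The expansion is infinite if $T^n(x)\notin\mathcal N$ for all $n$. In (a), a finite expansion means that $x$ is represented by a finite continued fraction $1/(a_1+1/(a_2+\cdots+1/a_n))$ formed from its digits, that is, $T^n(x)=0$ for some $n$ with $T^k(x)\notin\mathcal N$ for $k<n$. The expansion is eventually-repeating if the digit sequence is eventually periodic. The CF digits of a single real number are those of the regular continued fraction, i.e. the case $d=1$. Convergence in (d) means $x=\lim_{n\to\infty}1/(a_1+1/(a_2+\cdots+1/a_n))$. In (c), the quadratic equation $ax^2+bx+c=0$ over $\mathbb Z^d$ is the collection of equations $a_ix_i^2+b_ix_i+c_i=0$, $i=1,\dots,d$. The source does not give a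 formal definition of "non-degenerate"; the word is used in the same sense as in its formulation of the classical Lagrange theorem, that eventually-repeating regular CF representations of real numbers correspond to roots of non-degenerate quadratic polynomials over $\mathbb Z$, and (c) is that theorem applied in each coordinate. A measure-preserving system $(X,\mu,T)$ on a probability space is ergodic if $T^{-1}A=A$ implies $\mu(A)=0$ or $\mu(X\setminus A)=0$. It is exact if $\mu(A)>0$ implies $\lim_{n\to\infty}\mu(T^nA)=1$; equivalently, every set in $\bigcap_{n>0}T^{-n}\mathcal M$ is null or co-null, where $\mathcal M$ is the $\sigma$-algebra of measurable sets. *)

theory Defs
  imports
    "HOL-Analysis.Analysis"
    "HOL-Probability.Probability"
    "HOL-Computational_Algebra.Polynomial_Factorial"
begin

section \<open>The product algebra\<close>

text \<open>
  The ring structure of \<^typ>\<open>real ^ 'n\<close> provided by the library is already the coordinate-wise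
  one; only inversion, rounding and the inclusion of the integral points are missing.
\<close>

definition noninvertible :: "(real ^ 'n) set" where
  "noninvertible = {x. \<exists>i. x $ i = 0}"

text \<open>Only meaningful outside \<^const>\<open>noninvertible\<close>.\<close>

definition vrecip :: "real ^ 'n \<Rightarrow> real ^ 'n" where
  "vrecip x = (\<chi> i. 1 / x $ i)"

definition vfloor :: "real ^ 'n \<Rightarrow> int ^ 'n" where
  "vfloor x = (\<chi> i. \<lfloor>x $ i\<rfloor>)"

definition of_int_vec :: "int ^ 'n \<Rightarrow> real ^ 'n" where
  "of_int_vec a = (\<chi> i. of_int (a $ i))"

definition unit_box :: "(real ^ 'n) set" where
  "unit_box = {x. \<forall>i. 0 \<le> x $ i \<and> x $ i < 1}"

definition completely_irrational :: "real ^ 'n \<Rightarrow> bool" where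
  "completely_irrational x \<longleftrightarrow> (\<forall>i. x $ i \<notin> \<rat>)"


section \<open>The continued fraction algorithm\<close>

text \<open>
  The Gauss map is a partial map with domain \<open>gauss_dom\<close>; every notion below guards its iterates
  so that the value of the HOL function outside that domain is never used.
\<close>

definition gauss_dom :: "(real ^ 'n) set" where
  "gauss_dom = unit_box - noninvertible"

definition gauss_map :: "real ^ 'n \<Rightarrow> real ^ 'n" where
  "gauss_map x = vrecip x - of_int_vec (vfloor (vrecip x))"

definition vfrac :: "real ^ 'n \<Rightarrow> real ^ 'n" where
  "vfrac x = x - of_int_vec (vfloor x)"

definition cf_orbit :: "real ^ 'n \<Rightarrow> nat \<Rightarrow> real ^ 'n" where
  "cf_orbit x k = (gauss_map ^^ k) (vfrac x)"

text \<open>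
  Digits are indexed from 0: \<open>cf_digit x k\<close> is the digit usually written \<open>a\<^sub>k\<^sub>+\<^sub>1\<close>. It is a digit of
  \<open>x\<close> only if \<open>digit_defined x k\<close>, i.e. if the algorithm has not stopped before.
\<close>

definition digit_defined :: "real ^ 'n \<Rightarrow> nat \<Rightarrow> bool" where
  "digit_defined x k \<longleftrightarrow> (\<forall>j\<le>k. cf_orbit x j \<notin> noninvertible)"

definition cf_digit :: "real ^ 'n \<Rightarrow> nat \<Rightarrow> int ^ 'n" where
  "cf_digit x k = vfloor (vrecip (cf_orbit x k))"

definition num_digits :: "real ^ 'n \<Rightarrow> enat" where
  "num_digits x =
     (if finite {k. digit_defined x k} then enat (card {k. digit_defined x k}) else \<infinity>)"

text \<open>\<open>cf_value [a\<^sub>1, \<dots>, a\<^sub>n]\<close> is the finite continued fraction \<open>1/(a\<^sub>1 + 1/(a\<^sub>2 + \<cdots> + 1/a\<^sub>n))\<close>.\<close>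

fun cf_value :: "(int ^ 'n) list \<Rightarrow> real ^ 'n" where
  "cf_value [] = 0"
| "cf_value (a # as) = vrecip (of_int_vec a + cf_value as)"

definition cf_convergent :: "real ^ 'n \<Rightarrow> nat \<Rightarrow> real ^ 'n" where
  "cf_convergent x n = cf_value (map (cf_digit x) [0..<n])"

text \<open>
  That this says that \<open>x\<close> equals the finite continued fraction formed from its digits is
  \<open>finite_expansion_iff_represented\<close> below.
\<close>

definition finite_expansion :: "real ^ 'n \<Rightarrow> bool" where
  "finite_expansion x \<longleftrightarrow> (\<exists>n. (\<forall>k<n. digit_defined x k) \<and> cf_orbit x n = 0)"

definition infinite_expansion :: "real ^ 'n \<Rightarrow> bool" where
  "infinite_expansion x \<longleftrightarrow> (\<forall>n. cf_orbit x n \<notin> noninvertible)"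

definition eventually_repeating :: "real ^ 'n \<Rightarrow> bool" where
  "eventually_repeating x \<longleftrightarrow>
     infinite_expansion x \<and> (\<exists>N. \<exists>p>0. \<forall>k\<ge>N. cf_digit x (k + p) = cf_digit x k)"

text \<open>
  Non-degeneracy is the hypothesis of Lagrange's theorem, required in each coordinate: the
  polynomial really has degree 2 and does not split into linear factors over the rationals. (A
  nonzero discriminant would not do: it admits rational roots, whose expansions are finite.)
\<close>

definition nondegenerate_quadratic :: "int ^ 'n \<Rightarrow> int ^ 'n \<Rightarrow> int ^ 'n \<Rightarrow> bool" where
  "nondegenerate_quadratic a b c \<longleftrightarrow>
     (\<forall>i. a $ i \<noteq> 0 \<and>
          irreducible [:of_int (c $ i), of_int (b $ i), of_int (a $ i) :: rat:])"

lemma vrecip_inject: "vrecip x = vrecip y \<longleftrightarrow> x = y"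
  by (auto simp: vrecip_def vec_eq_iff)

lemma vrecip_vrecip: "vrecip (vrecip x) = x"
  by (simp add: vrecip_def vec_eq_iff)

lemma cf_value_orbit_iff:
  "y = cf_value (map (\<lambda>k. vfloor (vrecip ((gauss_map ^^ k) y))) [0..<n])
     \<longleftrightarrow> (gauss_map ^^ n) y = 0"
proof (induction n arbitrary: y)
  case 0
  show ?case by simp
next
  case (Suc n)
  let ?ds = "\<lambda>y n. map (\<lambda>k. vfloor (vrecip ((gauss_map ^^ k) y))) [0..<n]"
  have "?ds y (Suc n) = vfloor (vrecip y) # ?ds (gauss_map y) n"
    by (simp add: upt_rec[of 0] map_Suc_upt[symmetric] funpow_Suc_right
        del: upt_Suc funpow.simps)
  then have "y = cf_value (?ds y (Suc n)) \<longleftrightarrow>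
      vrecip (vrecip y) = vrecip (of_int_vec (vfloor (vrecip y)) + cf_value (?ds (gauss_map y) n))"
    by (simp only: cf_value.simps vrecip_vrecip)
  also have "\<dots> \<longleftrightarrow> gauss_map y = cf_value (?ds (gauss_map y) n)"
    unfolding vrecip_inject gauss_map_def[of y] by (simp add: diff_eq_eq add.commute)
  also have "\<dots> \<longleftrightarrow> (gauss_map ^^ n) (gauss_map y) = 0"
    by (rule Suc.IH)
  finally show ?case
    by (simp add: funpow_Suc_right del: funpow.simps)
qed

lemma finite_expansion_iff_represented:
  "finite_expansion x \<longleftrightarrow>
     (\<exists>n. (\<forall>k<n. digit_defined x k) \<and> x = of_int_vec (vfloor x) + cf_convergent x n)"
proof -
  have "x = of_int_vec (vfloor x) + cf_convergent x n \<longleftrightarrow> cf_orbit x n = 0" for n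
    using cf_value_orbit_iff[of "vfrac x" n]
    by (auto simp: cf_convergent_def cf_digit_def[abs_def] cf_orbit_def vfrac_def algebra_simps)
  then show ?thesis
    by (simp add: finite_expansion_def)
qed


section \<open>Partially defined dynamical systems\<close>

text \<open>
  A map \<open>T\<close> is considered on a domain \<open>D\<close> inside the space of \<open>M\<close>. Preimages and images under
  \<open>T\<^sup>n\<close> only involve points at which \<open>T\<^sup>n\<close> is defined; for \<open>D = space M\<close> all notions reduce to the
  usual ones.
\<close>

definition iter_preimage :: "'a set \<Rightarrow> ('a \<Rightarrow> 'a) \<Rightarrow> nat \<Rightarrow> 'a set \<Rightarrow> 'a set" where
  "iter_preimage D T n A = {x. (\<forall>k<n. (T ^^ k) x \<in> D) \<and> (T ^^ n) x \<in> A}"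

definition iter_image :: "'a set \<Rightarrow> ('a \<Rightarrow> 'a) \<Rightarrow> nat \<Rightarrow> 'a set \<Rightarrow> 'a set" where
  "iter_image D T n A = (T ^^ n) ` {x \<in> A. \<forall>k<n. (T ^^ k) x \<in> D}"

text \<open>Taking \<open>A = space M\<close> below shows that \<open>D\<close> has full measure.\<close>

definition leaves_invariant :: "'a set \<Rightarrow> ('a \<Rightarrow> 'a) \<Rightarrow> 'a measure \<Rightarrow> bool" where
  "leaves_invariant D T M \<longleftrightarrow>
     D \<in> sets M \<and> T ` D \<subseteq> space M \<and>
     (\<forall>A\<in>sets M. iter_preimage D T 1 A \<in> sets M \<and>
                   emeasure M (iter_preimage D T 1 A) = emeasure M A)"

definition ergodic :: "'a set \<Rightarrow> ('a \<Rightarrow> 'a) \<Rightarrow> 'a measure \<Rightarrow> bool" where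
  "ergodic D T M \<longleftrightarrow>
     (\<forall>A\<in>sets M. iter_preimage D T 1 A = A \<longrightarrow>
        measure M A = 0 \<or> measure M (space M - A) = 0)"

text \<open>
  For all \<open>A\<^sub>0, \<dots>, A\<^sub>k\<close>, the measure of \<open>A\<^sub>0 \<inter> T\<^sup>-\<^sup>n\<^sup>1 A\<^sub>1 \<inter> \<dots> \<inter> T\<^sup>-\<^sup>n\<^sup>k A\<^sub>k\<close> tends to the product of the
  measures as all the gaps \<open>n\<^sub>1, n\<^sub>2 - n\<^sub>1, \<dots>\<close> tend to infinity.
\<close>

definition mixing_of_all_orders :: "'a set \<Rightarrow> ('a \<Rightarrow> 'a) \<Rightarrow> 'a measure \<Rightarrow> bool" where
  "mixing_of_all_orders D T M \<longleftrightarrow>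
     (\<forall>k. \<forall>A :: nat \<Rightarrow> 'a set. (\<forall>i\<le>k. A i \<in> sets M) \<longrightarrow>
        (\<forall>\<epsilon>>0. \<exists>K. \<forall>n :: nat \<Rightarrow> nat. n 0 = 0 \<and> (\<forall>i<k. n i + K \<le> n (Suc i)) \<longrightarrow>
           \<bar>measure M (\<Inter>i\<le>k. iter_preimage D T (n i) (A i)) - (\<Prod>i\<le>k. measure M (A i))\<bar> < \<epsilon>))"

text \<open>
  The measure of a non-measurable set is 0 in the library, so the limit also asserts that the
  images are eventually measurable.
\<close>

definition exact :: "'a set \<Rightarrow> ('a \<Rightarrow> 'a) \<Rightarrow> 'a measure \<Rightarrow> bool" where
  "exact D T M \<longleftrightarrow>
     (\<forall>A\<in>sets M. measure M A > 0 \<longrightarrow> (\<lambda>n. measure M (iter_image D T n A)) \<longlonglongrightarrow> 1)"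

definition gauss_measure :: "(real ^ 'n) measure" where
  "gauss_measure =
     density (restrict_space lborel unit_box)
       (\<lambda>x. ennreal (1 / (ln 2) ^ CARD('n) * (1 / (\<Prod>i\<in>UNIV. 1 + x $ i))))"

end

(*
The coordinates do not interact, so (a)-(d) are facts about the one-dimensional Gauss map: it acts on
rationals as the Euclidean algorithm, two consecutive inverse branches contract by 1/4, and the integer
quadratics satisfied by the orbit of a quadratic irrational have bounded coefficients.

For (f), let P be the transfer operator. Cylinders shrink to points and the iterate mapping a cylinder
onto the box has bounded distortion, so for every measurable A and all large k the density P^k 1_A is,
up to a small error, at least c mu(A) for a constant c > 0 that does not depend on A. Applied to the
positive and the negative part of a function f with integral 0, this cancels a fixed proportion of
both, so some P^k shrinks the L^1 norm of f by a factor 1 - c/2. Iterating, P^n f tends to 0 in L^1, i.e.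
mu(A Int T^-n B) - mu(A) mu(B) tends to 0 uniformly in B. Taking for B the later sets of a mixing
configuration, the complement of T^n A, or an invariant set A itself gives mixing of all orders,
exactness and ergodicity.
*)

theory Submission
  imports Defs
begin

section \<open>The one-dimensional Gauss map\<close>

text \<open>A single inverse branch need not contract: 1/(1 + t) has slope -1 at 0. The composition
  of two does, because its denominator a (b + s) + 1 is at least 2; hence the exponents
  \<open>div 2\<close>. On a cylinder the inverse of the iterate is linear fractional with
  denominator u + v y, where 0 <= v <= u, and determinant 1 or -1, so its Jacobian is constant up to
  a factor 4 per coordinate. The density of the Gauss measure lies between 1/(2 ln 2) and 1/ln 2 per
  coordinate. Passing to Lebesgue measure for the cylinder and for the target set, and back for
  their intersection, gives c = ((1/(2 ln 2)) / (4 (1/ln 2)^2))^d = (ln 2 / 8)^d. A measurable set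
  is only approximately a union of cylinders, of a rank that depends on the set. Hence the lower
  bound carries an error, and the argument yields no fixed power of P that contracts every f: the
  exponent is chosen for each function, and exponents add up. Later times are covered by replacing B
  with a preimage. The Gauss map is partial while its HOL function is total. The ergodic theory is
  done for the total function; the partial notions agree with it off a null set.\<close>

definition gauss1 :: "real \<Rightarrow> real" where
  "gauss1 t = 1 / t - of_int \<lfloor>1 / t\<rfloor>"

lemma gauss1_eq_frac: "gauss1 t = frac (1 / t)"
  by (simp add: gauss1_def frac_def)

lemma gauss1_range: "0 \<le> gauss1 t" "gauss1 t < 1"
  by (simp_all add: gauss1_eq_frac frac_ge_0 frac_lt_1)

lemma gauss1_orbit_range:
  assumes "0 \<le> t" "t < 1"
  shows "0 \<le> (gauss1 ^^ k) t" "(gauss1 ^^ k) t < 1"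
  using assms by (cases k; simp add: gauss1_range)+

lemma gauss_map_nth: "gauss_map x $ i = gauss1 (x $ i)"
  by (simp add: gauss_map_def vrecip_def of_int_vec_def vfloor_def gauss1_def)

lemma gauss_map_funpow_nth: "(gauss_map ^^ k) x $ i = (gauss1 ^^ k) (x $ i)"
  by (induction k) (simp_all add: gauss_map_nth)

lemma vfrac_nth: "vfrac x $ i = frac (x $ i)"
  by (simp add: vfrac_def of_int_vec_def vfloor_def frac_def)

lemma cf_orbit_nth: "cf_orbit x k $ i = (gauss1 ^^ k) (frac (x $ i))"
  by (simp add: cf_orbit_def gauss_map_funpow_nth vfrac_nth)

lemma cf_digit_nth: "cf_digit x k $ i = \<lfloor>1 / (gauss1 ^^ k) (frac (x $ i))\<rfloor>"
  by (simp add: cf_digit_def vfloor_def vrecip_def cf_orbit_nth)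

lemma cf_orbit_in_noninvertible_iff:
  "cf_orbit x k \<in> noninvertible \<longleftrightarrow> (\<exists>i. (gauss1 ^^ k) (frac (x $ i)) = 0)"
  by (simp add: noninvertible_def cf_orbit_nth)

section \<open>Termination of orbits and rationality\<close>

lemma gauss1_0 [simp]: "gauss1 0 = 0"
  by (simp add: gauss1_def)

lemma gauss1_orbit_stays_0: "(gauss1 ^^ k) t = 0 \<Longrightarrow> k \<le> l \<Longrightarrow> (gauss1 ^^ l) t = 0"
  by (induction l rule: nat_induct) (auto simp: le_Suc_eq)

text \<open>The convention \<open>1 / 0 = 0\<close> makes 0 a fixed point of \<open>gauss1\<close>,
  so a coordinate that has reached 0 stays there and the condition on all earlier iterates collapses
  to the last one.\<close>

lemma digit_defined_iff:
  "digit_defined x k \<longleftrightarrow> (\<forall>i. (gauss1 ^^ k) (frac (x $ i)) \<noteq> 0)"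
  unfolding digit_defined_def cf_orbit_in_noninvertible_iff
  using gauss1_orbit_stays_0 by blast

lemma floor_recip_ge_1:
  assumes "0 < t" "t < (1::real)"
  shows "1 \<le> \<lfloor>1 / t\<rfloor>"
  using assms by (simp add: le_floor_iff)

lemma recip_floor_add_gauss1: "t \<noteq> 0 \<Longrightarrow> t = 1 / (of_int \<lfloor>1 / t\<rfloor> + gauss1 t)"
  by (simp add: gauss1_def)

lemma recip_in_Rats_iff [simp]: "1 / x \<in> \<rat> \<longleftrightarrow> (x::real) \<in> \<rat>"
proof
  assume "1 / x \<in> \<rat>"
  then have "1 / (1 / x) \<in> \<rat>" by (rule Rats_divide[OF Rats_1])
  then show "x \<in> \<rat>" by simp
qed (rule Rats_divide[OF Rats_1])

lemma gauss1_in_Rats_iff [simp]: "gauss1 t \<in> \<rat> \<longleftrightarrow> t \<in> \<rat>"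
  by (simp add: gauss1_eq_frac)

lemma gauss1_orbit_in_Rats_iff [simp]: "(gauss1 ^^ k) t \<in> \<rat> \<longleftrightarrow> t \<in> \<rat>"
  by (induction k) simp_all

text \<open>On \<open>p / q\<close> the Gauss map is one step of the Euclidean algorithm.\<close>

lemma gauss1_of_nat_quotient: "gauss1 (real p / real q) = real (q mod p) / real p"
proof (cases "p = 0")
  case False
  have "\<lfloor>real q / real p\<rfloor> = int (q div p)"
    by (simp add: floor_divide_of_nat_eq)
  moreover have "real q = real p * real (q div p) + real (q mod p)"
    by (metis mult_div_mod_eq of_nat_add of_nat_mult)
  ultimately show ?thesis
    using False by (simp add: gauss1_def field_simps)
qed simp

text \<open>Descent on the numerator: the next fraction has the remainder \<open>q mod p\<close>
  above and \<open>p\<close> below. The denominator stays arbitrary because every step replaces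
  it.\<close>

lemma gauss1_orbit_quotient_terminates:
  "\<exists>k. (gauss1 ^^ k) (real p / real q) = 0"
proof (induction p arbitrary: q rule: less_induct)
  case (less p)
  show ?case
  proof (cases "p = 0")
    case True
    then have "(gauss1 ^^ 0) (real p / real q) = 0" by simp
    then show ?thesis by blast
  next
    case False
    then have "q mod p < p" by simp
    from less.IH[OF this, of p] obtain k where "(gauss1 ^^ k) (real (q mod p) / real p) = 0"
      by blast
    then have "(gauss1 ^^ Suc k) (real p / real q) = 0"
      by (simp add: funpow_Suc_right gauss1_of_nat_quotient del: funpow.simps)
    then show ?thesis by blast
  qed
qed

text \<open>An iterate is rational exactly when the starting point is, so an irrational orbit can
  never reach 0.\<close>

lemma gauss1_orbit_terminates_iff:
  assumes "0 \<le> t"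
  shows "(\<exists>k. (gauss1 ^^ k) t = 0) \<longleftrightarrow> t \<in> \<rat>"
proof
  assume "\<exists>k. (gauss1 ^^ k) t = 0"
  then obtain k where "(gauss1 ^^ k) t = 0" ..
  then have "(gauss1 ^^ k) t \<in> \<rat>" by simp
  then show "t \<in> \<rat>" by simp
next
  assume "t \<in> \<rat>"
  then obtain m n where "\<bar>t\<bar> = real m / real n" by (rule Rats_abs_nat_div_natE)
  then show "\<exists>k. (gauss1 ^^ k) t = 0"
    using gauss1_orbit_quotient_terminates[of m n] assms by simp
qed

lemma infinite_expansion_iff: "infinite_expansion x \<longleftrightarrow> completely_irrational x"
  unfolding infinite_expansion_def cf_orbit_in_noninvertible_iff completely_irrational_def
  using gauss1_orbit_terminates_iff[of "frac _"] by (auto simp: frac_ge_0)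

section \<open>The number of digits and finite expansions\<close>

lemma num_digits_vec_eq:
  assumes "t \<in> \<rat>"
  shows "num_digits (vec t :: real ^ 1) = enat (LEAST k. (gauss1 ^^ k) (frac t) = 0)"
proof -
  define n where "n = (LEAST k. (gauss1 ^^ k) (frac t) = 0)"
  have "\<exists>k. (gauss1 ^^ k) (frac t) = 0"
    using gauss1_orbit_terminates_iff[of "frac t"] assms by simp
  then have "(gauss1 ^^ n) (frac t) = 0"
    unfolding n_def by (rule LeastI_ex)
  moreover have "(gauss1 ^^ k) (frac t) \<noteq> 0" if "k < n" for k
    using not_less_Least that unfolding n_def by blast
  ultimately have "{k. digit_defined (vec t :: real ^ 1) k} = {..<n}"
    unfolding digit_defined_iff by (auto simp: gauss1_orbit_stays_0) (meson gauss1_orbit_stays_0 not_less)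
  then show ?thesis
    by (simp add: num_digits_def n_def)
qed

text \<open>All coordinates must reach 0 at the same time, since before that time the orbit may not
  touch the noninvertible set. This is why the lengths have to agree.\<close>

lemma finite_expansion_iff:
  fixes x :: "real ^ 'n"
  shows "finite_expansion x \<longleftrightarrow>
        (\<forall>i. x $ i \<in> \<rat>) \<and>
        (\<forall>i j. num_digits (vec (x $ i) :: real ^ 1) = num_digits (vec (x $ j) :: real ^ 1))"
proof -
  define len where "len i = (LEAST k. (gauss1 ^^ k) (frac (x $ i)) = 0)" for i
  have fin: "finite_expansion x \<longleftrightarrow>
      (\<exists>n. (\<forall>k<n. \<forall>i. (gauss1 ^^ k) (frac (x $ i)) \<noteq> 0) \<and> (\<forall>i. (gauss1 ^^ n) (frac (x $ i)) = 0))"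
    by (simp add: finite_expansion_def digit_defined_iff vec_eq_iff cf_orbit_nth)
  show ?thesis
  proof safe
    assume "finite_expansion x"
    then obtain n where n: "\<And>k i. k < n \<Longrightarrow> (gauss1 ^^ k) (frac (x $ i)) \<noteq> 0"
      "\<And>i. (gauss1 ^^ n) (frac (x $ i)) = 0"
      unfolding fin by blast
    show rat: "x $ i \<in> \<rat>" for i
      using gauss1_orbit_terminates_iff[of "frac (x $ i)"] n(2)[of i] by (auto simp: frac_ge_0)
    have "len i = n" for i
      unfolding len_def by (rule Least_equality) (use n not_less in blast)+
    then show "num_digits (vec (x $ i) :: real ^ 1) = num_digits (vec (x $ j) :: real ^ 1)" for i j
      unfolding num_digits_vec_eq[OF rat] len_def by metis
  next
    assume rat: "\<forall>i. x $ i \<in> \<rat>"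
      and eq: "\<forall>i j. num_digits (vec (x $ i) :: real ^ 1) = num_digits (vec (x $ j) :: real ^ 1)"
    \<comment> \<open>Index types are nonempty; the length at \<open>i0\<close> serves as the common
      time.\<close>
    obtain i0 :: 'n where True by blast
    have len: "len i = len i0" for i
      using eq rat by (simp add: num_digits_vec_eq len_def)
    have "\<exists>k. (gauss1 ^^ k) (frac (x $ i)) = 0" for i
      using gauss1_orbit_terminates_iff[of "frac (x $ i)"] rat by simp
    then have "(gauss1 ^^ len i) (frac (x $ i)) = 0" for i
      unfolding len_def by (rule LeastI_ex)
    moreover have "(gauss1 ^^ k) (frac (x $ i)) \<noteq> 0" if "k < len i" for k i
      using not_less_Least that unfolding len_def by blast
    ultimately show "finite_expansion x"
      unfolding fin by (metis len)
  qed
qed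

section \<open>Inverse branches and convergence\<close>

text \<open>The composition of the inverse branches with digits \<open>as\<close>, with a free tail
  \<open>t\<close>: the tail 0 gives the finite continued fraction, and the tail T^n x recovers x
  from its first n digits.\<close>

definition cf_branch :: "int list \<Rightarrow> real \<Rightarrow> real" where
  "cf_branch as t = foldr (\<lambda>a s. 1 / (of_int a + s)) as t"

lemma cf_branch_simps [simp]:
  "cf_branch [] t = t"
  "cf_branch (a # as) t = 1 / (of_int a + cf_branch as t)"
  by (simp_all add: cf_branch_def)

lemma cf_branch_range:
  assumes "\<forall>a\<in>set as. 1 \<le> a" "0 \<le> t" "t \<le> 1"
  shows "0 \<le> cf_branch as t \<and> cf_branch as t \<le> 1"
  using assms
proof (induction as)
  case (Cons a as)
  then have "1 \<le> real_of_int a + cf_branch as t"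
    by force
  then show ?case by simp
qed simp

text \<open>The induction goes in steps of two, because a single branch is only guaranteed not to
  expand. Two branches compose to (b + s) / (a (b + s) + 1), a map of determinant 1, so a difference
  is divided by the product of two denominators that are at least 2.\<close>

lemma cf_branch_contraction:
  assumes "\<forall>a\<in>set as. 1 \<le> a" "0 \<le> s" "s \<le> 1" "0 \<le> t" "t \<le> 1"
  shows "\<bar>cf_branch as s - cf_branch as t\<bar> \<le> (1 / 4) ^ (length as div 2) * \<bar>s - t\<bar>"
  using assms(1)
proof (induction as rule: induct_list012)
  case (2 a)
  then have "1 \<le> real_of_int a" by simp
  then have 1: "1 \<le> real_of_int a + s" "1 \<le> real_of_int a + t"
    using assms by auto
  have "1 / (real_of_int a + s) - 1 / (real_of_int a + t)
      = (t - s) / ((real_of_int a + s) * (real_of_int a + t))"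
    using diff_frac_eq[of "real_of_int a + s" "real_of_int a + t" 1 1] 1 by simp
  also have "\<bar>\<dots>\<bar> = \<bar>s - t\<bar> / ((real_of_int a + s) * (real_of_int a + t))"
    using 1 by (simp add: abs_divide abs_mult)
  also have "\<dots> \<le> \<bar>s - t\<bar> / 1"
    using 1 mult_mono[OF 1] by (intro divide_left_mono) auto
  finally show ?case by simp
next
  case (3 a b as)
  define p where "p = cf_branch as s"
  define q where "q = cf_branch as t"
  have pq: "0 \<le> p" "0 \<le> q"
    using cf_branch_range[of as] assms 3 by (auto simp: p_def q_def)
  have ab: "1 \<le> real_of_int a" "1 \<le> real_of_int b"
    using 3 by auto
  have bp: "1 \<le> real_of_int b + p" "1 \<le> real_of_int b + q"
    using pq ab by auto
  have A: "2 \<le> real_of_int a * (real_of_int b + p) + 1" "2 \<le> real_of_int a * (real_of_int b + q) + 1"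
    using mult_mono[OF ab(1) bp(1)] mult_mono[OF ab(1) bp(2)] ab by auto
  have inner: "1 / (real_of_int a + 1 / (real_of_int b + r)) = (real_of_int b + r) / (real_of_int a * (real_of_int b + r) + 1)"
    if "1 \<le> real_of_int b + r" for r
    using that by (simp add: divide_simps)
  have "cf_branch (a # b # as) s - cf_branch (a # b # as) t
      = (p - q) / ((real_of_int a * (real_of_int b + p) + 1) * (real_of_int a * (real_of_int b + q) + 1))"
  proof -
    have "(real_of_int b + p) * (real_of_int a * (real_of_int b + q) + 1)
        - (real_of_int b + q) * (real_of_int a * (real_of_int b + p) + 1) = p - q"
      by algebra
    moreover have "real_of_int a * (real_of_int b + p) + 1 \<noteq> 0"
      "real_of_int a * (real_of_int b + q) + 1 \<noteq> 0"
      using A by auto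
    ultimately have "(real_of_int b + p) / (real_of_int a * (real_of_int b + p) + 1)
        - (real_of_int b + q) / (real_of_int a * (real_of_int b + q) + 1)
      = (p - q) / ((real_of_int a * (real_of_int b + p) + 1) * (real_of_int a * (real_of_int b + q) + 1))"
      using diff_frac_eq[of "real_of_int a * (real_of_int b + p) + 1"
          "real_of_int a * (real_of_int b + q) + 1" "real_of_int b + p" "real_of_int b + q"]
      by metis
    then show ?thesis
      by (simp only: cf_branch_simps inner[OF bp(1)] inner[OF bp(2)] p_def[symmetric] q_def[symmetric])
  qed
  also have "\<bar>\<dots>\<bar> = \<bar>p - q\<bar> / ((real_of_int a * (real_of_int b + p) + 1) * (real_of_int a * (real_of_int b + q) + 1))"
    using A by (simp add: abs_divide abs_mult)
  also have "\<dots> \<le> \<bar>p - q\<bar> / (2 * 2)"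
    by (intro divide_left_mono mult_mono mult_pos_pos) (use A in linarith)+
  also have "\<dots> \<le> (1 / 4) ^ (length as div 2) * \<bar>s - t\<bar> / 4"
    using 3 by (simp add: p_def q_def)
  finally show ?case by simp
qed auto

lemma cf_branch_contraction_le:
  assumes "\<forall>a\<in>set as. 1 \<le> a" "0 \<le> s" "s \<le> 1" "0 \<le> t" "t \<le> 1"
  shows "\<bar>cf_branch as s - cf_branch as t\<bar> \<le> (1 / 4) ^ (length as div 2)"
proof -
  have "(1 / 4) ^ (length as div 2) * \<bar>s - t\<bar> \<le> (1 / 4 :: real) ^ (length as div 2) * 1"
    by (intro mult_left_mono) (use assms in auto)
  with cf_branch_contraction[OF assms] show ?thesis
    by (simp only: mult_1_right)
qed

section \<open>Digit strings, injectivity and convergence\<close>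

definition digits1 :: "real \<Rightarrow> nat \<Rightarrow> int list" where
  "digits1 t n = map (\<lambda>k. \<lfloor>1 / (gauss1 ^^ k) t\<rfloor>) [0..<n]"

lemma length_digits1 [simp]: "length (digits1 t n) = n"
  by (simp add: digits1_def)

lemma digits1_Suc: "digits1 t (Suc n) = \<lfloor>1 / t\<rfloor> # digits1 (gauss1 t) n"
  unfolding digits1_def
  by (simp add: upt_rec[of 0] map_Suc_upt[symmetric] funpow_Suc_right del: upt_Suc funpow.simps)

lemma irrational_orbit_pos:
  assumes "0 \<le> t" "t \<notin> \<rat>"
  shows "0 < (gauss1 ^^ k) t"
proof -
  have "0 \<le> (gauss1 ^^ k) t"
    using assms gauss1_range by (cases k) auto
  moreover have "(gauss1 ^^ k) t \<noteq> 0"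
    using assms gauss1_orbit_terminates_iff by blast
  ultimately show ?thesis by simp
qed

lemma digits1_ge_1:
  assumes "0 \<le> t" "t < 1" "t \<notin> \<rat>"
  shows "\<forall>a\<in>set (digits1 t n). 1 \<le> a"
  using floor_recip_ge_1[OF irrational_orbit_pos[OF assms(1,3)] gauss1_orbit_range(2)[OF assms(1,2)]]
  by (auto simp: digits1_def simp del: le_floor_iff one_le_floor)

lemma cf_branch_digits1:
  assumes "0 \<le> t" "t \<notin> \<rat>"
  shows "cf_branch (digits1 t n) ((gauss1 ^^ n) t) = t"
  using assms
proof (induction n arbitrary: t)
  case 0
  show ?case by (simp add: digits1_def)
next
  case (Suc n)
  then have "t \<noteq> 0" by auto
  moreover have "cf_branch (digits1 (gauss1 t) n) ((gauss1 ^^ n) (gauss1 t)) = gauss1 t"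
    using Suc.prems by (intro Suc.IH) (auto simp: gauss1_range)
  ultimately show ?case
    using recip_floor_add_gauss1[of t, symmetric]
    by (simp add: digits1_Suc funpow_Suc_right del: funpow.simps)
qed

text \<open>Both points lie in the image of one and the same branch, whose diameter tends to 0 as
  more digits are used.\<close>

lemma digits1_inject:
  assumes s: "0 \<le> s" "s < 1" "s \<notin> \<rat>" and t: "0 \<le> t" "t < 1" "t \<notin> \<rat>"
    and "\<And>n. digits1 s n = digits1 t n"
  shows "s = t"
proof -
  have "(\<lambda>n. (1 / 4 :: real) ^ n) \<longlonglongrightarrow> 0"
    by (rule LIMSEQ_power_zero) simp
  moreover have "\<bar>s - t\<bar> \<le> (1 / 4) ^ n" for n
  proof -
    have "\<bar>cf_branch (digits1 s (2 * n)) ((gauss1 ^^ (2 * n)) s)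
        - cf_branch (digits1 s (2 * n)) ((gauss1 ^^ (2 * n)) t)\<bar> \<le> (1 / 4) ^ n"
      using cf_branch_contraction_le[OF digits1_ge_1[OF s, of "2 * n"]]
        gauss1_orbit_range[OF s(1,2)] gauss1_orbit_range[OF t(1,2)] by (simp add: less_imp_le)
    moreover have "cf_branch (digits1 s (2 * n)) ((gauss1 ^^ (2 * n)) t) = t"
      using assms(7) cf_branch_digits1[OF t(1,3)] by simp
    ultimately show ?thesis
      using s by (simp add: cf_branch_digits1)
  qed
  ultimately have "\<bar>s - t\<bar> \<le> 0"
    by (intro LIMSEQ_le_const) auto
  then show ?thesis by simp
qed

lemma cf_value_nth: "cf_value as $ i = cf_branch (map (\<lambda>a. a $ i) as) 0"
  by (induction as) (simp_all add: vrecip_def of_int_vec_def)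

lemma cf_convergent_nth: "cf_convergent x n $ i = cf_branch (digits1 (frac (x $ i)) n) 0"
  by (simp add: cf_convergent_def cf_value_nth digits1_def cf_digit_nth comp_def)

text \<open>In each coordinate the convergent and x are the same branch, evaluated at the tails 0
  and T^n x.\<close>

lemma cf_convergent_tendsto:
  assumes "x \<in> unit_box" "completely_irrational x"
  shows "cf_convergent x \<longlonglongrightarrow> x"
proof (rule vec_tendstoI)
  fix i
  have x: "0 \<le> x $ i" "x $ i < 1" "x $ i \<notin> \<rat>"
    using assms by (auto simp: unit_box_def completely_irrational_def)
  then have fr: "frac (x $ i) = x $ i"
    by (simp add: frac_eq)
  have "norm (cf_convergent x n $ i - x $ i) \<le> (1 / 2) ^ n * 2" for n
  proof -
    have "\<bar>cf_convergent x n $ i - x $ i\<bar> =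
        \<bar>cf_branch (digits1 (x $ i) n) 0 - cf_branch (digits1 (x $ i) n) ((gauss1 ^^ n) (x $ i))\<bar>"
      using x by (simp add: cf_convergent_nth fr cf_branch_digits1)
    also have "\<dots> \<le> (1 / 4) ^ (n div 2)"
      using cf_branch_contraction_le[OF digits1_ge_1[OF x, of n]] gauss1_orbit_range[OF x(1,2)]
      by (simp add: less_imp_le)
    \<comment> \<open>The factor 2 pays for the rounding of \<open>n div 2\<close> at odd n and
      leaves a plain geometric bound.\<close>
    also have "\<dots> = (1 / 2) ^ (2 * (n div 2))"
      unfolding power_mult by (simp add: power2_eq_square)
    also have "\<dots> \<le> (1 / 2) ^ n * 2"
    proof -
      have "n \<le> Suc (2 * (n div 2))" by presburger
      then have "(1 / 2 :: real) ^ Suc (2 * (n div 2)) \<le> (1 / 2) ^ n"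
        by (rule power_decreasing) auto
      then show ?thesis by simp
    qed
    finally have "\<bar>cf_convergent x n $ i - x $ i\<bar> \<le> (1 / 2) ^ n * 2" .
    then show ?thesis by simp
  qed
  then have bound: "\<forall>\<^sub>F n in sequentially. norm (cf_convergent x n $ i - x $ i) \<le> (1 / 2) ^ n * 2"
    by simp
  have lim: "(\<lambda>n. (1 / 2 :: real) ^ n * 2) \<longlonglongrightarrow> 0"
    by (intro tendsto_mult_left_zero LIMSEQ_power_zero) simp
  have "(\<lambda>n. cf_convergent x n $ i - x $ i) \<longlonglongrightarrow> 0"
    by (rule Lim_null_comparison[OF bound lim])
  then show "(\<lambda>n. cf_convergent x n $ i) \<longlonglongrightarrow> x $ i"
    by (simp add: LIM_zero_iff)
qed

text \<open>The exceptional points lie on the countably many hyperplanes x_i = q with q rational,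
  each of which is a null set.\<close>

lemma AE_completely_irrational: "AE x :: real ^ 'n in lborel. completely_irrational x"
proof -
  have "{x :: real ^ 'n. x $ i = q} \<in> null_sets lborel" for i q
  proof -
    have "{x :: real ^ 'n. x $ i = q} \<in> null_sets lebesgue"
      using negligible_hyperplane[of "axis i 1 :: real ^ 'n" q]
      by (simp add: negligible_iff_null_sets inner_axis' axis_eq_0_iff)
    moreover have "closed {x :: real ^ 'n. x $ i = q}"
      by (intro closed_Collect_eq continuous_intros)
    ultimately show ?thesis
      by (auto simp: null_sets_def)
  qed
  then have "AE x :: real ^ 'n in lborel. x $ i \<noteq> q" for i q
    by (intro AE_I'[of "{x. x $ i = q}"]) auto
  then have "AE x :: real ^ 'n in lborel. \<forall>q\<in>\<rat>. x $ i \<noteq> q" for i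
    by (subst AE_ball_countable) (auto simp: countable_rat)
  then have "AE x :: real ^ 'n in lborel. \<forall>i. \<forall>q\<in>\<rat>. x $ i \<noteq> q"
    by (subst AE_all_countable) auto
  then show ?thesis
    by eventually_elim (auto simp: completely_irrational_def)
qed

section \<open>Quadratic irrationals\<close>

text \<open>Only the trivial equation is excluded. This weak form passes through substitutions
  without tracking degrees; for irrational \<open>t\<close> it is equivalent to the nondegenerate
  form by \<open>quad_root_iff_nondegenerate\<close>.\<close>

definition quad_root :: "real \<Rightarrow> bool" where
  "quad_root t \<longleftrightarrow> (\<exists>a b c :: int. \<not> (a = 0 \<and> b = 0 \<and> c = 0) \<and>
     of_int a * t\<^sup>2 + of_int b * t + of_int c = 0)"

section \<open>Integer quadratics under the inverse branches\<close>

lemma quad_root_add_int: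
  assumes "quad_root y"
  shows "quad_root (of_int k + y)"
proof -
  obtain a b c :: int where nz: "\<not> (a = 0 \<and> b = 0 \<and> c = 0)"
    and root: "of_int a * y\<^sup>2 + of_int b * y + of_int c = 0"
    using assms unfolding quad_root_def by blast
  have "of_int a * (of_int k + y)\<^sup>2 + of_int (b - 2 * a * k) * (of_int k + y)
      + of_int (a * k\<^sup>2 - b * k + c) = of_int a * y\<^sup>2 + of_int b * y + (of_int c :: real)"
    by (simp add: power2_eq_square algebra_simps)
  moreover have "\<not> (a = 0 \<and> b - 2 * a * k = 0 \<and> a * k\<^sup>2 - b * k + c = 0)"
    using nz by auto
  ultimately show ?thesis
    unfolding quad_root_def using root by metis
qed

text \<open>After the shift by \<open>k\<close>, taking the reciprocal reverses the order of the
  coefficients.\<close>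

lemma quad_root_recip_add:
  assumes "quad_root y" "of_int k + y \<noteq> 0"
  shows "quad_root (1 / (of_int k + y))"
proof -
  obtain a b c :: int where nz: "\<not> (a = 0 \<and> b = 0 \<and> c = 0)"
    and root: "of_int a * (of_int k + y)\<^sup>2 + of_int b * (of_int k + y) + of_int c = 0"
    using quad_root_add_int[OF assms(1)] unfolding quad_root_def by blast
  let ?w = "of_int k + y"
  have "of_int c * (1 / ?w)\<^sup>2 + of_int b * (1 / ?w) + of_int a
      = (of_int a * ?w\<^sup>2 + of_int b * ?w + of_int c) / ?w\<^sup>2"
    using assms(2) by (simp add: power2_eq_square add_divide_distrib)
  then show ?thesis
    unfolding quad_root_def using root nz by (metis div_0)
qed

lemma quad_root_of_gauss1_orbit:
  assumes "0 \<le> t" "t \<notin> \<rat>" "quad_root ((gauss1 ^^ n) t)"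
  shows "quad_root t"
  using assms
proof (induction n arbitrary: t)
  case (Suc n)
  have "quad_root (gauss1 t)"
  proof (rule Suc.IH)
    show "quad_root ((gauss1 ^^ n) (gauss1 t))"
      using Suc.prems(3) by (simp add: funpow_swap1)
  qed (use Suc.prems gauss1_range in auto)
  moreover have "t \<noteq> 0" using Suc.prems by auto
  moreover have "of_int \<lfloor>1 / t\<rfloor> + gauss1 t \<noteq> 0"
    using \<open>t \<noteq> 0\<close> by (simp add: gauss1_def)
  ultimately show ?case
    using quad_root_recip_add[of "gauss1 t" "\<lfloor>1 / t\<rfloor>"] recip_floor_add_gauss1[of t] by metis
qed simp

text \<open>The integers are the entries of the product of the matrices with rows (0, 1) and (1, a).
  Prepending a digit turns (A, B, C, D) into (C, D, a C + A, a D + B). The bounds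
  \<open>1 <= D\<close> and \<open>1 <= A + C\<close> are carried along so that denominators stay
  positive and C becomes positive as soon as there is a digit.\<close>

lemma cf_branch_moebius:
  assumes "\<forall>a\<in>set as. 1 \<le> a"
  shows "\<exists>A B C D :: int. 0 \<le> A \<and> 0 \<le> B \<and> 0 \<le> C \<and> 1 \<le> D \<and> 1 \<le> A + C \<and> (as \<noteq> [] \<longrightarrow> 1 \<le> C) \<and>
    (\<forall>t\<ge>0. cf_branch as t = (of_int A * t + of_int B) / (of_int C * t + of_int D))"
  using assms
proof (induction as)
  case Nil
  show ?case
    by (rule exI[of _ 1], rule exI[of _ 0], rule exI[of _ 0], rule exI[of _ 1]) auto
next
  case (Cons a as)
  then obtain A B C D :: int where *: "0 \<le> A" "0 \<le> B" "0 \<le> C" "1 \<le> D" "1 \<le> A + C"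
    and eq: "\<And>t. 0 \<le> t \<Longrightarrow> cf_branch as t = (of_int A * t + of_int B) / (of_int C * t + of_int D)"
    by auto
  have a: "1 \<le> a" using Cons.prems by simp
  have aC: "C \<le> a * C" "D \<le> a * D"
    using mult_right_mono[OF a, of C] mult_right_mono[OF a, of D] * by auto
  have "cf_branch (a # as) t = (of_int C * t + of_int D) / (of_int (a * C + A) * t + of_int (a * D + B))"
    if "0 \<le> t" for t
  proof -
    have "0 < real_of_int C * t + of_int D"
      using * that by (intro add_nonneg_pos mult_nonneg_nonneg) auto
    then have "of_int a + (of_int A * t + of_int B) / (of_int C * t + of_int D)
        = (of_int (a * C + A) * t + of_int (a * D + B)) / (real_of_int C * t + of_int D)"
      by (simp add: add_divide_eq_iff algebra_simps)
    then show ?thesis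
      using that by (simp add: eq)
  qed
  moreover have "0 \<le> D" "1 \<le> a * D + B" "1 \<le> a * C + A" "0 \<le> a * C + A" "1 \<le> C + (a * C + A)"
    using * aC by linarith+
  ultimately show ?case
    using *(3) by blast
qed

text \<open>Clearing the denominator in the fixed point equation of a linear fractional map gives C
  y^2 + (D - A) y - B = 0. A nonempty digit list makes C nonzero, so this is not the trivial
  equation.\<close>

lemma quad_root_of_cf_branch_fixpoint:
  assumes "\<forall>a\<in>set as. 1 \<le> a" "as \<noteq> []" "0 \<le> y" "cf_branch as y = y"
  shows "quad_root y"
proof -
  obtain A B C D :: int where *: "0 \<le> C" "1 \<le> D" "1 \<le> C"
    and "cf_branch as y = (of_int A * y + of_int B) / (of_int C * y + of_int D)"
    using cf_branch_moebius[OF assms(1)] assms(2,3) by blast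
  then have eq: "y = (of_int A * y + of_int B) / (of_int C * y + of_int D)"
    using assms(4) by simp
  have "0 < real_of_int C * y + of_int D"
    using * assms(3) by (intro add_nonneg_pos mult_nonneg_nonneg) auto
  then have "y * (of_int C * y + of_int D) = of_int A * y + of_int B"
    using eq by (simp add: eq_divide_eq)
  then have "of_int C * y\<^sup>2 + of_int (D - A) * y + of_int (- B) = 0"
    by (simp add: power2_eq_square algebra_simps)
  then show ?thesis
    unfolding quad_root_def using * by (metis not_one_le_zero)
qed

section \<open>Periodic digits force a quadratic equation\<close>

lemma digits1_funpow: "digits1 ((gauss1 ^^ m) t) n = map (\<lambda>k. \<lfloor>1 / (gauss1 ^^ (k + m)) t\<rfloor>) [0..<n]"
  by (simp add: digits1_def funpow_add)

text \<open>If the digits repeat from N on, the orbit points at times N and N + p have the same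
  digits and hence coincide. That point is fixed by the branch of its first p digits, and its
  quadratic is carried back to \<open>t\<close>.\<close>

lemma quad_root_of_periodic_digits:
  assumes t: "0 \<le> t" "t < 1" "t \<notin> \<rat>" and "0 < p"
    and per: "\<And>k. N \<le> k \<Longrightarrow> \<lfloor>1 / (gauss1 ^^ (k + p)) t\<rfloor> = \<lfloor>1 / (gauss1 ^^ k) t\<rfloor>"
  shows "quad_root t"
proof -
  let ?y = "(gauss1 ^^ N) t" and ?z = "(gauss1 ^^ (N + p)) t"
  have "digits1 ?y n = digits1 ?z n" for n
    unfolding digits1_funpow using per[of "_ + N"] by (simp add: add.assoc)
  then have yz: "?y = ?z"
    by (intro digits1_inject) (use t gauss1_orbit_range in auto)
  have y: "0 \<le> ?y" "?y < 1" "?y \<notin> \<rat>"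
    using t gauss1_orbit_range by auto
  have "cf_branch (digits1 ?y p) ((gauss1 ^^ p) ?y) = ?y"
    using y by (intro cf_branch_digits1)
  moreover have "(gauss1 ^^ p) ?y = ?y"
    using yz by (simp add: add.commute[of N] funpow_add)
  moreover have "digits1 ?y p \<noteq> []"
    using \<open>0 < p\<close> length_digits1[of ?y p] by force
  ultimately have "quad_root ?y"
    using quad_root_of_cf_branch_fixpoint[OF digits1_ge_1[OF y]] y(1) by metis
  then show ?thesis
    using quad_root_of_gauss1_orbit t by blast
qed

text \<open>
  With \<open>\<phi>\<close> the \<open>n\<close>-th inverse branch through \<open>t\<close>, the quadratic satisfied by the \<open>n\<close>-th orbit
  point is \<open>F s = (u + v s)\<^sup>2 f (\<phi> s)\<close>, and \<open>\<bar>\<phi> s - \<phi> r\<bar> = \<bar>s - r\<bar> / ((u + v s) (u + v r))\<close>; so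
  the Lipschitz bound for \<open>f\<close> on \<open>[0, 1]\<close> survives in the form below, without mentioning \<open>\<phi>\<close>.
\<close>

lemma gauss1_orbit_quadratic:
  fixes a b c :: int
  defines "L \<equiv> 2 * \<bar>real_of_int a\<bar> + \<bar>real_of_int b\<bar>"
  assumes t: "0 \<le> t" "t < 1" "t \<notin> \<rat>" and nz: "\<not> (a = 0 \<and> b = 0 \<and> c = 0)"
    and root: "of_int a * t\<^sup>2 + of_int b * t + of_int c = 0"
  shows "\<exists>(A::int) (B::int) (C::int) (u::real) (v::real). \<not> (A = 0 \<and> B = 0 \<and> C = 0) \<and>
    0 < u \<and> 0 \<le> v \<and> v \<le> u \<and>
    of_int A * ((gauss1 ^^ n) t)\<^sup>2 + of_int B * (gauss1 ^^ n) t + of_int C = 0 \<and>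
    (\<forall>s r. 0 \<le> s \<and> s \<le> 1 \<and> 0 \<le> r \<and> r \<le> 1 \<longrightarrow>
      \<bar>(of_int A * s\<^sup>2 + of_int B * s + of_int C) / (u + v * s)\<^sup>2
        - (of_int A * r\<^sup>2 + of_int B * r + of_int C) / (u + v * r)\<^sup>2\<bar>
      \<le> L * \<bar>s - r\<bar> / ((u + v * s) * (u + v * r)))"
proof (induction n)
  \<comment> \<open>The branch is the identity here, so u = 1 and v = 0, and \<open>L\<close> is a
    Lipschitz constant of the given quadratic on the unit interval.\<close>
  case 0
  have "\<bar>(of_int a * s\<^sup>2 + of_int b * s + of_int c) - (of_int a * r\<^sup>2 + of_int b * r + of_int c)\<bar>
      \<le> L * \<bar>s - r\<bar>" if "0 \<le> s" "s \<le> 1" "0 \<le> r" "r \<le> 1" for s r :: real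
  proof -
    have "(of_int a * s\<^sup>2 + of_int b * s + of_int c) - (of_int a * r\<^sup>2 + of_int b * r + of_int c)
        = (of_int a * (s + r) + of_int b) * (s - r)"
      by (simp add: power2_eq_square algebra_simps)
    moreover have "\<bar>of_int a * (s + r) + of_int b\<bar> \<le> L"
    proof -
      have "\<bar>of_int a * (s + r)\<bar> \<le> \<bar>real_of_int a\<bar> * 2"
        unfolding abs_mult using that by (intro mult_left_mono) auto
      then show ?thesis unfolding L_def by linarith
    qed
    ultimately show ?thesis
      by (simp add: abs_mult mult_right_mono)
  qed
  then show ?case
    using nz root
    by (rule_tac exI[of _ a], rule_tac exI[of _ b], rule_tac exI[of _ c],
        rule_tac exI[of _ 1], rule_tac exI[of _ 0]) simp
next
  case (Suc n)
  then obtain A B C :: int and u v :: real where nz: "\<not> (A = 0 \<and> B = 0 \<and> C = 0)"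
    and uv: "0 < u" "0 \<le> v" "v \<le> u"
    and rt: "of_int A * ((gauss1 ^^ n) t)\<^sup>2 + of_int B * (gauss1 ^^ n) t + of_int C = 0"
    and lip: "\<And>s r. 0 \<le> s \<Longrightarrow> s \<le> 1 \<Longrightarrow> 0 \<le> r \<Longrightarrow> r \<le> 1 \<Longrightarrow>
      \<bar>(of_int A * s\<^sup>2 + of_int B * s + of_int C) / (u + v * s)\<^sup>2
        - (of_int A * r\<^sup>2 + of_int B * r + of_int C) / (u + v * r)\<^sup>2\<bar>
      \<le> L * \<bar>s - r\<bar> / ((u + v * s) * (u + v * r))"
    by blast
  define x where "x = (gauss1 ^^ n) t"
  define y where "y = gauss1 x"
  define k where "k = \<lfloor>1 / x\<rfloor>"
  have x: "0 < x" "x < 1"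
    unfolding x_def using irrational_orbit_pos gauss1_orbit_range t by blast+
  have k: "1 \<le> k" unfolding k_def using x by (rule floor_recip_ge_1)
  have xy: "x = 1 / (of_int k + y)"
    unfolding k_def y_def using x by (intro recip_floor_add_gauss1) simp
  have y: "0 \<le> y" by (simp add: y_def gauss1_range)
  \<comment> \<open>These coefficients result from the substitution s -> 1/(k + s) and
    multiplication by (k + s)^2. In the same way the denominator u + v s turns into (u k + v) + u s,
    so the pair (u, v) becomes (u k + v, u).\<close>
  define A' B' C' where "A' = C" and "B' = 2 * k * C + B" and "C' = C * k\<^sup>2 + B * k + A"
  have F': "of_int A' * s\<^sup>2 + of_int B' * s + of_int C' =
      (of_int k + s)\<^sup>2 * (of_int A * (1 / (of_int k + s))\<^sup>2 + of_int B * (1 / (of_int k + s)) + of_int C)"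
    if "0 \<le> s" for s :: real
  proof -
    have "of_int k + s \<noteq> 0" using that k by auto
    then show ?thesis
      by (simp add: A'_def B'_def C'_def power2_eq_square divide_simps) (simp add: algebra_simps)
  qed
  have W: "u * of_int k + v + u * s = (of_int k + s) * (u + v * (1 / (of_int k + s)))"
    if "0 \<le> s" for s :: real
  proof -
    have "of_int k + s \<noteq> 0" using that k by auto
    then show ?thesis by (simp add: divide_simps) (simp add: algebra_simps)
  qed
  have Q: "(of_int A' * s\<^sup>2 + of_int B' * s + of_int C') / (u * of_int k + v + u * s)\<^sup>2
     = (of_int A * (1 / (of_int k + s))\<^sup>2 + of_int B * (1 / (of_int k + s)) + of_int C)
         / (u + v * (1 / (of_int k + s)))\<^sup>2" if "0 \<le> s" for s :: real
  proof -
    have "(of_int k + s)\<^sup>2 \<noteq> 0" using that k by auto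
    then show ?thesis
      unfolding F'[OF that] W[OF that] power_mult_distrib by simp
  qed
  have "\<bar>(of_int A' * s\<^sup>2 + of_int B' * s + of_int C') / (u * of_int k + v + u * s)\<^sup>2
        - (of_int A' * r\<^sup>2 + of_int B' * r + of_int C') / (u * of_int k + v + u * r)\<^sup>2\<bar>
      \<le> L * \<bar>s - r\<bar> / ((u * of_int k + v + u * s) * (u * of_int k + v + u * r))"
    if sr: "0 \<le> s" "s \<le> 1" "0 \<le> r" "r \<le> 1" for s r :: real
  proof -
    let ?s = "1 / (of_int k + s)" and ?r = "1 / (of_int k + r)"
    have pos: "1 \<le> of_int k + s" "1 \<le> of_int k + r" using sr k by auto
    have "?s - ?r = ((of_int k + r) - (of_int k + s)) / ((of_int k + s) * (of_int k + r))"
      using diff_frac_eq[of "of_int k + s" "of_int k + r" 1 1] pos by simp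
    then have d: "\<bar>?s - ?r\<bar> = \<bar>s - r\<bar> / ((of_int k + s) * (of_int k + r))"
      using pos by (simp add: abs_divide abs_mult)
    have "L * \<bar>?s - ?r\<bar> / ((u + v * ?s) * (u + v * ?r))
        = L * \<bar>s - r\<bar> / (((of_int k + s) * (u + v * ?s)) * ((of_int k + r) * (u + v * ?r)))"
    proof -
      have "L * (D / (K * R)) / (U * V) = L * D / ((K * U) * (R * V))" for D K R U V :: real
        by (simp add: mult_ac)
      then show ?thesis unfolding d .
    qed
    also have "\<dots> = L * \<bar>s - r\<bar> / ((u * of_int k + v + u * s) * (u * of_int k + v + u * r))"
      by (simp only: W[OF sr(1)] W[OF sr(3)])
    finally have e: "L * \<bar>?s - ?r\<bar> / ((u + v * ?s) * (u + v * ?r)) =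
      L * \<bar>s - r\<bar> / ((u * of_int k + v + u * s) * (u * of_int k + v + u * r))" .
    have "0 \<le> ?s" "?s \<le> 1" "0 \<le> ?r" "?r \<le> 1"
      using pos by auto
    from lip[OF this] show ?thesis
      unfolding Q[OF sr(1)] Q[OF sr(3)] e .
  qed
  moreover have "of_int A' * y\<^sup>2 + of_int B' * y + of_int C' = 0"
    unfolding F'[OF y] xy[symmetric] using rt by (simp flip: x_def)
  moreover have "\<not> (A' = 0 \<and> B' = 0 \<and> C' = 0)"
    using nz by (auto simp: A'_def B'_def C'_def)
  moreover have "0 < u * of_int k + v"
    using uv k by (intro add_pos_nonneg mult_pos_pos) auto
  moreover have "u \<le> u * of_int k + v"
  proof -
    have "u * 1 \<le> u * of_int k" using uv k by (intro mult_left_mono) auto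
    then show ?thesis using uv by linarith
  qed
  moreover have "(gauss1 ^^ Suc n) t = y"
    unfolding y_def x_def by simp
  ultimately show ?case
    using uv(1) less_imp_le[OF uv(1)] by metis
qed

text \<open>Every orbit point is a root of a nontrivial integer quadratic whose coefficients are
  bounded by 20 L, whatever n is. There are finitely many such quadratics, each with finitely many
  roots.\<close>

lemma finite_gauss1_orbit_of_quad_root:
  assumes t: "0 \<le> t" "t < 1" "t \<notin> \<rat>" and "quad_root t"
  shows "finite (range (\<lambda>n. (gauss1 ^^ n) t))"
proof -
  obtain a b c :: int where nz: "\<not> (a = 0 \<and> b = 0 \<and> c = 0)"
    and root: "of_int a * t\<^sup>2 + of_int b * t + of_int c = 0"
    using assms unfolding quad_root_def by blast
  define L where "L = 2 * \<bar>real_of_int a\<bar> + \<bar>real_of_int b\<bar>"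
  \<comment> \<open>The quadratic F of an orbit point is bounded by 2 L at 0, 1/2 and 1.
    Interpolation, A = 2 F(0) - 4 F(1/2) + 2 F(1) and B = -3 F(0) + 4 F(1/2) - F(1), bounds the
    coefficients by 16 L; 20 is a convenient larger constant.\<close>
  define M where "M = \<lceil>20 * L\<rceil>"
  define S where "S = {(A, B, C). (A, B, C) \<in> {-M..M} \<times> {-M..M} \<times> {-M..M} \<and> \<not> (A = 0 \<and> B = 0 \<and> C = 0)}"
  have "finite S"
    by (rule finite_subset[of _ "{-M..M} \<times> {-M..M} \<times> {-M..M}"]) (auto simp: S_def)
  moreover have "finite {x :: real. of_int A * x\<^sup>2 + of_int B * x + of_int C = 0}"
    if "(A, B, C) \<in> S" for A B C
  proof -
    have "finite {x. poly [:real_of_int C, of_int B, of_int A:] x = 0}"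
      by (rule poly_roots_finite) (use that in \<open>auto simp: S_def\<close>)
    then show ?thesis
      by (simp add: power2_eq_square algebra_simps)
  qed
  ultimately have "finite (\<Union>(A, B, C)\<in>S. {x :: real. of_int A * x\<^sup>2 + of_int B * x + of_int C = 0})"
    by auto
  moreover have "(gauss1 ^^ n) t \<in> (\<Union>(A, B, C)\<in>S. {x. of_int A * x\<^sup>2 + of_int B * x + of_int C = 0})" for n
  proof -
    define x where "x = (gauss1 ^^ n) t"
    have x: "0 \<le> x" "x \<le> 1"
      unfolding x_def using gauss1_orbit_range[OF t(1,2), of n] by auto
    obtain A B C :: int and u v :: real where nz: "\<not> (A = 0 \<and> B = 0 \<and> C = 0)"
      and uv: "0 < u" "0 \<le> v" "v \<le> u"
      and rt: "of_int A * x\<^sup>2 + of_int B * x + of_int C = 0"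
      and lip: "\<And>s r. 0 \<le> s \<Longrightarrow> s \<le> 1 \<Longrightarrow> 0 \<le> r \<Longrightarrow> r \<le> 1 \<Longrightarrow>
        \<bar>(of_int A * s\<^sup>2 + of_int B * s + of_int C) / (u + v * s)\<^sup>2
          - (of_int A * r\<^sup>2 + of_int B * r + of_int C) / (u + v * r)\<^sup>2\<bar>
        \<le> L * \<bar>s - r\<bar> / ((u + v * s) * (u + v * r))"
      using gauss1_orbit_quadratic[OF t nz root, of n] unfolding x_def L_def by blast
    \<comment> \<open>The orbit point x is a root, so the Lipschitz bound with r = x controls the
      value at s itself. The remaining ratio (u + v s) / u is at most 2 because v <= u.\<close>
    have F: "\<bar>of_int A * s\<^sup>2 + of_int B * s + of_int C\<bar> \<le> 2 * L" if s: "0 \<le> s" "s \<le> 1" for s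
    proof -
      have L0: "0 \<le> L" by (simp add: L_def)
      have "v * s \<le> u" using uv s mult_mono[of v u s 1] by simp
      then have us: "u + v * s \<le> 2 * u" "0 < u + v * s"
        using uv s by (auto intro: add_pos_nonneg)
      have ux: "u \<le> u + v * x" using uv x by simp
      have "\<bar>of_int A * s\<^sup>2 + of_int B * s + of_int C\<bar> / (u + v * s)\<^sup>2
          \<le> L * \<bar>s - x\<bar> / ((u + v * s) * (u + v * x))"
        using lip[OF s x] by (simp add: rt abs_divide)
      also have "\<dots> \<le> L * 1 / ((u + v * s) * u)"
        using us ux uv L0 s x by (intro frac_le mult_left_mono mult_pos_pos mult_nonneg_nonneg) auto
      finally have "\<bar>of_int A * s\<^sup>2 + of_int B * s + of_int C\<bar> \<le> L / ((u + v * s) * u) * (u + v * s)\<^sup>2"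
        using us by (simp add: pos_divide_le_eq)
      also have "\<dots> = L * ((u + v * s) / u)"
        using us by (simp add: power2_eq_square)
      also have "\<dots> \<le> L * 2"
        using us uv L0 by (intro mult_left_mono) (auto simp: pos_divide_le_eq)
      finally show ?thesis by simp
    qed
    have "\<bar>real_of_int C\<bar> \<le> 2 * L" "\<bar>real_of_int A + of_int B + of_int C\<bar> \<le> 2 * L"
      "\<bar>real_of_int A / 4 + of_int B / 2 + of_int C\<bar> \<le> 2 * L"
      using F[of 0] F[of 1] F[of "1/2"] by (simp_all add: power2_eq_square)
    then have "\<bar>real_of_int A\<bar> \<le> 20 * L" "\<bar>real_of_int B\<bar> \<le> 20 * L" "\<bar>real_of_int C\<bar> \<le> 20 * L"
      by linarith+
    then have "\<bar>A\<bar> \<le> M" "\<bar>B\<bar> \<le> M" "\<bar>C\<bar> \<le> M"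
      unfolding M_def by linarith+
    then have "(A, B, C) \<in> S"
      using nz by (auto simp: S_def)
    then show ?thesis
      using rt unfolding x_def by blast
  qed
  ultimately show ?thesis
    by (meson finite_subset image_subsetI)
qed

section \<open>Periodic orbits and a common period for all coordinates\<close>

lemma gauss1_orbit_periodic_of_quad_root:
  assumes t: "0 \<le> t" "t < 1" "t \<notin> \<rat>" and "quad_root t"
  obtains N p where "0 < p" "\<And>k. N \<le> k \<Longrightarrow> (gauss1 ^^ (k + p)) t = (gauss1 ^^ k) t"
proof -
  have "\<not> inj (\<lambda>n. (gauss1 ^^ n) t)"
    using finite_gauss1_orbit_of_quad_root[OF assms] finite_imageD infinite_UNIV_nat by blast
  then obtain m n where mn: "m < n" "(gauss1 ^^ m) t = (gauss1 ^^ n) t"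
    by (metis injI linorder_neqE_nat)
  have per: "(gauss1 ^^ (k + (n - m))) t = (gauss1 ^^ k) t" if "m \<le> k" for k
  proof -
    have "(gauss1 ^^ ((k - m) + n)) t = (gauss1 ^^ ((k - m) + m)) t"
      unfolding funpow_add comp_apply mn(2) ..
    moreover have "(k - m) + n = k + (n - m)" "(k - m) + m = k"
      using that mn(1) by auto
    ultimately show ?thesis by metis
  qed
  show ?thesis
  proof (rule that)
    show "0 < n - m" using mn(1) by simp
  qed (rule per)
qed

text \<open>Each coordinate has its own preperiod and period. The index type is finite, so the sum
  of the preperiods and the product of the periods serve all coordinates at once.\<close>

lemma eventually_periodic_of_quad_root:
  fixes t :: "'i :: finite \<Rightarrow> real"
  assumes t: "\<And>i. 0 \<le> t i \<and> t i < 1 \<and> t i \<notin> \<rat>" and "\<And>i. quad_root (t i)"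
  shows "\<exists>N. \<exists>p>0. \<forall>k\<ge>N. \<forall>i. (gauss1 ^^ (k + p)) (t i) = (gauss1 ^^ k) (t i)"
proof -
  have "\<forall>i. \<exists>N p. 0 < p \<and> (\<forall>k\<ge>N. (gauss1 ^^ (k + p)) (t i) = (gauss1 ^^ k) (t i))"
    using gauss1_orbit_periodic_of_quad_root assms by metis
  then obtain N p where p: "\<And>i. 0 < p i"
    and per: "\<And>i k. N i \<le> k \<Longrightarrow> (gauss1 ^^ (k + p i)) (t i) = (gauss1 ^^ k) (t i)"
    by metis
  have mult: "(gauss1 ^^ (k + m * p i)) (t i) = (gauss1 ^^ k) (t i)" if "N i \<le> k" for i k m
  proof (induction m)
    case (Suc m)
    have "(gauss1 ^^ (k + Suc m * p i)) (t i) = (gauss1 ^^ ((k + m * p i) + p i)) (t i)"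
      by (simp add: algebra_simps)
    also have "\<dots> = (gauss1 ^^ k) (t i)"
      using Suc that per[of i "k + m * p i"] by simp
    finally show ?case .
  qed simp
  have "(gauss1 ^^ (k + prod p UNIV)) (t i) = (gauss1 ^^ k) (t i)" if "sum N UNIV \<le> k" for k i
  proof -
    have "N i \<le> sum N UNIV" by (intro member_le_sum) auto
    then have "N i \<le> k" using that by simp
    moreover have "p i dvd prod p UNIV" by (intro dvd_prodI) auto
    then obtain m where "prod p UNIV = m * p i" by (metis dvd_def mult.commute)
    ultimately show ?thesis using mult by simp
  qed
  moreover have "0 < prod p UNIV" using p by (simp add: prod_pos)
  ultimately show ?thesis by blast
qed

text \<open>For irrational \<open>t\<close> the numbers 1 and t are linearly independent over the
  rationals; this is \<open>lin\<close>. A vanishing leading coefficient would therefore force the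
  trivial equation, and in a factorization into two linear polynomials one factor would vanish at
  t.\<close>

lemma quad_root_iff_nondegenerate:
  assumes "t \<notin> \<rat>"
  shows "quad_root t \<longleftrightarrow> (\<exists>a b c :: int. a \<noteq> 0 \<and>
    irreducible [:of_int c, of_int b, of_int a :: rat:] \<and>
    of_int a * t\<^sup>2 + of_int b * t + of_int c = 0)"
proof safe
  assume "quad_root t"
  then obtain a b c :: int where nz: "\<not> (a = 0 \<and> b = 0 \<and> c = 0)"
    and root: "of_int a * t\<^sup>2 + of_int b * t + of_int c = 0"
    unfolding quad_root_def by blast
  have lin: "s = 0 \<and> r = 0" if "of_rat s * t + of_rat r = 0" for s r
  proof (rule ccontr)
    assume "\<not> (s = 0 \<and> r = 0)"
    then have "s \<noteq> 0" using that by auto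
    then have "t = of_rat (- r / s)"
      using that by (simp add: of_rat_divide of_rat_minus field_simps add_eq_0_iff)
    then show False using assms by simp
  qed
  have a: "a \<noteq> 0"
    using lin[of "of_int b" "of_int c"] nz root by auto
  let ?p = "[:of_int c, of_int b, of_int a :: rat:]"
  have deg: "degree ?p = 2" using a by simp
  have "irreducible ?p"
  proof (rule irreducibleI)
    show "?p \<noteq> 0" using a by simp
    show "\<not> is_unit ?p" using deg by (metis is_unit_iff_degree degree_0 zero_neq_numeral)
    fix f g assume fg: "?p = f * g"
    then have "f \<noteq> 0" "g \<noteq> 0" using a by auto
    then have d: "degree f + degree g = 2"
      using deg fg degree_mult_eq by metis
    have "degree f \<noteq> 1"
    proof
      assume f1: "degree f = 1"
      then have "degree g = 1" using d by simp
      then obtain g0 g1 where g: "g = [:g0, g1:]"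
        by (metis degree1_coeffs)
      obtain f0 f1 where f: "f = [:f0, f1:]"
        using f1 by (metis degree1_coeffs)
      have cs: "of_int c = f0 * g0" "of_int b = f0 * g1 + f1 * g0" "of_int a = f1 * g1"
        using fg by (auto simp: f g)
      have "(of_rat f1 * t + of_rat f0) * (of_rat g1 * t + of_rat g0)
          = of_rat (of_int a) * t\<^sup>2 + of_rat (of_int b) * t + of_rat (of_int c)"
        unfolding cs by (simp add: of_rat_mult of_rat_add power2_eq_square algebra_simps)
      also have "\<dots> = 0" using root by simp
      finally have "of_rat f1 * t + of_rat f0 = 0 \<or> of_rat g1 * t + of_rat g0 = 0" by simp
      then show False
        using lin cs a by (metis mult_zero_left mult_zero_right of_int_eq_0_iff)
    qed
    with d have "degree f = 0 \<or> degree g = 0" by linarith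
    then show "is_unit f \<or> is_unit g"
      using \<open>f \<noteq> 0\<close> \<open>g \<noteq> 0\<close> is_unit_iff_degree by blast
  qed
  with a root show "\<exists>a b c :: int. a \<noteq> 0 \<and>
    irreducible [:of_int c, of_int b, of_int a :: rat:] \<and>
    of_int a * t\<^sup>2 + of_int b * t + of_int c = 0" by blast
qed (auto simp: quad_root_def)

text \<open>A rational root r would split off the factor X - r. Irreducibility makes the cofactor a
  unit, which leaves degree 1 instead of 2.\<close>

lemma irrational_of_nondegenerate:
  fixes a b c :: int
  assumes a: "a \<noteq> 0" and irr: "irreducible [:of_int c, of_int b, of_int a :: rat:]"
    and root: "of_int a * t\<^sup>2 + of_int b * t + of_int c = 0"
  shows "t \<notin> \<rat>"
proof
  assume "t \<in> \<rat>"
  then obtain r where r: "t = of_rat r" by (elim Rats_cases)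
  let ?p = "[:of_int c, of_int b, of_int a :: rat:]"
  have "of_rat (poly ?p r) = of_int a * t\<^sup>2 + of_int b * t + of_int c"
    by (simp add: r of_rat_add of_rat_mult power2_eq_square algebra_simps)
  then have "poly ?p r = 0" using root by simp
  then obtain q where q: "?p = [:- r, 1:] * q"
    by (metis poly_eq_0_iff_dvd dvd_def)
  have "\<not> is_unit [:- r, 1:]"
    by (simp add: is_unit_iff_degree)
  then have "is_unit q"
    using irr q by (metis irreducibleD)
  moreover have "q \<noteq> 0" using q a by auto
  ultimately have "degree q = 0"
    by (simp add: is_unit_iff_degree)
  have "degree ?p = degree [:- r, 1:] + degree q"
    unfolding q using \<open>q \<noteq> 0\<close> by (intro degree_mult_eq) auto
  also have "\<dots> = 1" using \<open>degree q = 0\<close> by simp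
  finally have "degree ?p = 1" .
  then show False using a by simp
qed

text \<open>The equation and its nondegeneracy are independent conditions on the coordinates, so the
  coefficients can be chosen coordinate by coordinate. Passing to the fractional part is an integer
  shift, which preserves being a quadratic root.\<close>

lemma eventually_repeating_iff:
  fixes x :: "real ^ 'n"
  shows "eventually_repeating x \<longleftrightarrow>
        (\<exists>a b c. nondegenerate_quadratic a b c \<and>
           of_int_vec a * x ^ 2 + of_int_vec b * x + of_int_vec c = 0)"
proof -
  have rhs: "(\<exists>a b c. nondegenerate_quadratic a b c \<and>
           of_int_vec a * x ^ 2 + of_int_vec b * x + of_int_vec c = 0)
    \<longleftrightarrow> (\<forall>i. \<exists>a b c :: int. a \<noteq> 0 \<and>
      irreducible [:of_int c, of_int b, of_int a :: rat:] \<and>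
      of_int a * (x $ i)\<^sup>2 + of_int b * x $ i + of_int c = 0)" (is "?l = (\<forall>i. ?r i)")
  proof
    assume "\<forall>i. ?r i"
    then obtain a b c :: "'n \<Rightarrow> int" where "\<And>i. a i \<noteq> 0 \<and>
      irreducible [:of_int (c i), of_int (b i), of_int (a i) :: rat:] \<and>
      of_int (a i) * (x $ i)\<^sup>2 + of_int (b i) * x $ i + of_int (c i) = 0"
      by metis
    then have "nondegenerate_quadratic (\<chi> i. a i) (\<chi> i. b i) (\<chi> i. c i) \<and>
        of_int_vec (\<chi> i. a i) * x ^ 2 + of_int_vec (\<chi> i. b i) * x + of_int_vec (\<chi> i. c i) = 0"
      by (simp add: nondegenerate_quadratic_def vec_eq_iff of_int_vec_def power2_eq_square)
    then show ?l by blast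
  next
    assume ?l
    then obtain a b c where "nondegenerate_quadratic a b c"
      "of_int_vec a * x ^ 2 + of_int_vec b * x + of_int_vec c = 0" by blast
    then have "a $ i \<noteq> 0 \<and> irreducible [:of_int (c $ i), of_int (b $ i), of_int (a $ i) :: rat:] \<and>
      of_int (a $ i) * (x $ i)\<^sup>2 + of_int (b $ i) * x $ i + of_int (c $ i) = 0" for i
      by (simp add: nondegenerate_quadratic_def vec_eq_iff of_int_vec_def power2_eq_square)
    then show "\<forall>i. ?r i" by blast
  qed
  have frac_root: "quad_root (frac t) \<longleftrightarrow> quad_root t" for t
    using quad_root_add_int[of "frac t" "\<lfloor>t\<rfloor>"] quad_root_add_int[of t "- \<lfloor>t\<rfloor>"]
    by (auto simp: frac_def)
  show ?thesis
  proof
    assume "eventually_repeating x"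
    then obtain N p where irr: "\<And>i. x $ i \<notin> \<rat>" and "0 < p"
      and "\<And>k. N \<le> k \<Longrightarrow> cf_digit x (k + p) = cf_digit x k"
      unfolding eventually_repeating_def infinite_expansion_iff completely_irrational_def by blast
    then have "\<lfloor>1 / (gauss1 ^^ (k + p)) (frac (x $ i))\<rfloor> = \<lfloor>1 / (gauss1 ^^ k) (frac (x $ i))\<rfloor>"
      if "N \<le> k" for k i using that unfolding cf_digit_nth[symmetric] by metis
    then have "quad_root (frac (x $ i))" for i
      using irr \<open>0 < p\<close> by (intro quad_root_of_periodic_digits[of _ p N]) (auto simp: frac_ge_0 frac_lt_1)
    then show ?l
      unfolding rhs using quad_root_iff_nondegenerate irr frac_root by metis
  next
    assume ?l
    then have r: "\<And>i. ?r i" unfolding rhs by blast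
    then have irr: "x $ i \<notin> \<rat>" for i
      using irrational_of_nondegenerate by metis
    then have "quad_root (frac (x $ i))" for i
      using r quad_root_iff_nondegenerate frac_root by metis
    then obtain N p where "0 < p" and
      "\<forall>k\<ge>N. \<forall>i. (gauss1 ^^ (k + p)) (frac (x $ i)) = (gauss1 ^^ k) (frac (x $ i))"
      using eventually_periodic_of_quad_root[of "\<lambda>i. frac (x $ i)"] irr
      by (auto simp: frac_ge_0 frac_lt_1)
    then have "\<forall>k\<ge>N. cf_digit x (k + p) = cf_digit x k"
      by (simp add: vec_eq_iff cf_digit_nth)
    then show "eventually_repeating x"
      unfolding eventually_repeating_def infinite_expansion_iff completely_irrational_def
      using irr \<open>0 < p\<close> by blast
  qed
qed

section \<open>Uniform mixing from a Doeblin condition\<close>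

text \<open>The dynamics as far as mixing needs it: a total measure-preserving map and a lower bound
  for the mass of \<open>A\<close> that T^k sends into \<open>B\<close>. The constant
  \<open>c\<close> is the same for all sets, whereas the starting time \<open>K\<close> depends on
  \<open>A\<close> and \<epsilon>, but not on \<open>B\<close>.\<close>

locale doeblin_system = prob_space M for M :: "'a measure" +
  fixes T :: "'a \<Rightarrow> 'a" and c :: real
  assumes T [measurable]: "T \<in> measurable M M"
    and invariant: "\<And>A. A \<in> sets M \<Longrightarrow> emeasure M (T -` A \<inter> space M) = emeasure M A"
    and c: "0 < c" "c \<le> 1"
    and doeblin: "\<And>A \<epsilon>. A \<in> sets M \<Longrightarrow> 0 < \<epsilon> \<Longrightarrow>
      \<exists>K. \<forall>k\<ge>K. \<forall>B\<in>sets M. c * prob A * prob B - \<epsilon> \<le> prob (A \<inter> (T ^^ k) -` B)"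
begin

section \<open>Iterates of the measure-preserving map\<close>

lemma T_funpow [measurable]: "T ^^ k \<in> measurable M M"
  by (induction k) (auto simp: id_def intro: measurable_comp)

lemma vimage_T_funpow [measurable]: "B \<in> sets M \<Longrightarrow> (T ^^ k) -` B \<inter> space M \<in> sets M"
  by (rule measurable_sets[OF T_funpow])

lemma emeasure_vimage_T_funpow:
  "B \<in> sets M \<Longrightarrow> emeasure M ((T ^^ k) -` B \<inter> space M) = emeasure M B"
proof (induction k)
  case 0
  then show ?case using sets.sets_into_space[of B M] by (simp add: Int_absorb2)
next
  case (Suc k)
  have "(T ^^ Suc k) -` B \<inter> space M = T -` ((T ^^ k) -` B \<inter> space M) \<inter> space M"
    using measurable_space[OF T] by (auto simp: funpow_swap1)
  then show ?case
    using Suc invariant[OF vimage_T_funpow[OF Suc.prems]] by (simp del: funpow.simps)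
qed

lemma prob_vimage_T_funpow:
  "B \<in> sets M \<Longrightarrow> prob ((T ^^ k) -` B \<inter> space M) = prob B"
  by (simp add: measure_def emeasure_vimage_T_funpow)

section \<open>The Doeblin condition for nonnegative functions\<close>

lemma integrable_indicator_events: "B \<in> sets M \<Longrightarrow> integrable M (indicator B :: 'a \<Rightarrow> real)"
  by (intro integrable_real_indicator) (auto simp: less_top[symmetric])

lemma integrable_mult_indicator_T:
  fixes f :: "'a \<Rightarrow> real"
  assumes "integrable M f" and [measurable]: "B \<in> sets M"
  shows "integrable M (\<lambda>x. f x * indicator B ((T ^^ k) x))"
proof (rule Bochner_Integration.integrable_bound[OF assms(1)])
  have [measurable]: "f \<in> borel_measurable M" using assms(1) by simp
  show "(\<lambda>x. f x * indicator B ((T ^^ k) x)) \<in> borel_measurable M" by measurable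
  show "AE x in M. norm (f x * indicator B ((T ^^ k) x)) \<le> norm (f x)"
    by (simp add: indicator_def)
qed

text \<open>Functions are needed because the transfer operator turns indicators into general
  densities. The bound survives sums and scaling; for a monotone limit, \<open>K\<close> is taken
  from one approximating function whose integral is within \<epsilon> / 2 of the limit.\<close>

lemma doeblin_integral:
  fixes f :: "'a \<Rightarrow> real"
  assumes "f \<in> borel_measurable M" "\<And>x. 0 \<le> f x" "integrable M f" "0 < \<epsilon>"
  shows "\<exists>K. \<forall>k\<ge>K. \<forall>B\<in>sets M.
    c * (\<integral>x. f x \<partial>M) * prob B - \<epsilon> \<le> (\<integral>x. f x * indicator B ((T ^^ k) x) \<partial>M)"
  using assms
proof (induction arbitrary: \<epsilon> rule: borel_measurable_induct_real)
  case (set A)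
  then obtain K where K: "\<And>k B. k \<ge> K \<Longrightarrow> B \<in> sets M \<Longrightarrow> c * prob A * prob B - \<epsilon> \<le> prob (A \<inter> (T ^^ k) -` B)"
    using doeblin[OF set(1) set.prems(2)] by auto
  have "(\<integral>x. indicator A x * indicator B ((T ^^ k) x) \<partial>M) = prob (A \<inter> (T ^^ k) -` B)"
    if "B \<in> sets M" for k B
  proof -
    have "(\<integral>x. indicator A x * indicator B ((T ^^ k) x) \<partial>M)
        = (\<integral>x. indicator (A \<inter> (T ^^ k) -` B) x \<partial>M :: real)"
      by (intro Bochner_Integration.integral_cong) (auto split: split_indicator)
    also have "\<dots> = prob (A \<inter> (T ^^ k) -` B \<inter> space M)"
      by simp
    also have "A \<inter> (T ^^ k) -` B \<inter> space M = A \<inter> (T ^^ k) -` B"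
      using sets.sets_into_space[OF set(1)] by auto
    finally show ?thesis .
  qed
  then show ?case
    using K set(1) sets.sets_into_space[OF set(1)] by (intro exI[of _ K]) (simp add: Int_absorb1)
next
  case (mult u a)
  show ?case
  \<comment> \<open>The induction hypothesis is used with the error \<epsilon> / a, so a = 0 is
    treated separately.\<close>
  proof (cases "a = 0")
    case True
    then show ?thesis using mult by simp
  next
    case False
    then have a: "0 < a" using mult by simp
    then have "integrable M u" using mult.prems by simp
    then obtain K where K: "\<And>k B. k \<ge> K \<Longrightarrow> B \<in> sets M \<Longrightarrow>
        c * (\<integral>x. u x \<partial>M) * prob B - \<epsilon> / a \<le> (\<integral>x. u x * indicator B ((T ^^ k) x) \<partial>M)"
      using mult.IH[of "\<epsilon> / a"] mult.prems a by auto
    have "c * (\<integral>x. a * u x \<partial>M) * prob B - \<epsilon> \<le> (\<integral>x. a * u x * indicator B ((T ^^ k) x) \<partial>M)"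
      if "k \<ge> K" "B \<in> sets M" for k B
    proof -
      have "a * (c * (\<integral>x. u x \<partial>M) * prob B - \<epsilon> / a) \<le> a * (\<integral>x. u x * indicator B ((T ^^ k) x) \<partial>M)"
        using K[OF that] a by (intro mult_left_mono) auto
      then show ?thesis
        using a by (simp add: mult.assoc right_diff_distrib mult.left_commute)
    qed
    then show ?thesis by blast
  qed
next
  case (add u v)
  have int: "integrable M u" "integrable M v"
    using add by (auto intro!: Bochner_Integration.integrable_bound[OF add.prems(1)])
  from add.IH(1)[OF int(1), of "\<epsilon> / 2"] add.prems obtain K1 where K1: "\<And>k B. k \<ge> K1 \<Longrightarrow> B \<in> sets M \<Longrightarrow>
      c * (\<integral>x. u x \<partial>M) * prob B - \<epsilon> / 2 \<le> (\<integral>x. u x * indicator B ((T ^^ k) x) \<partial>M)"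
    by auto
  from add.IH(2)[OF int(2), of "\<epsilon> / 2"] add.prems obtain K2 where K2: "\<And>k B. k \<ge> K2 \<Longrightarrow> B \<in> sets M \<Longrightarrow>
      c * (\<integral>x. v x \<partial>M) * prob B - \<epsilon> / 2 \<le> (\<integral>x. v x * indicator B ((T ^^ k) x) \<partial>M)"
    by auto
  have "c * (\<integral>x. v x + u x \<partial>M) * prob B - \<epsilon> \<le> (\<integral>x. (v x + u x) * indicator B ((T ^^ k) x) \<partial>M)"
    if k: "k \<ge> max K1 K2" and B: "B \<in> sets M" for k B
  proof -
    have "(\<integral>x. (v x + u x) * indicator B ((T ^^ k) x) \<partial>M)
        = (\<integral>x. v x * indicator B ((T ^^ k) x) \<partial>M) + (\<integral>x. u x * indicator B ((T ^^ k) x) \<partial>M)"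
      unfolding distrib_right using int B
      by (intro Bochner_Integration.integral_add integrable_mult_indicator_T)
    moreover have "c * (\<integral>x. v x + u x \<partial>M) * prob B
        = c * (\<integral>x. v x \<partial>M) * prob B + c * (\<integral>x. u x \<partial>M) * prob B"
      using int by (simp add: distrib_left distrib_right)
    ultimately show ?thesis
      using K1[of k B] K2[of k B] k B by simp
  qed
  then show ?case by blast
next
  case (seq U)
  have mono: "U i x \<le> f x" if "x \<in> space M" for i x
    using seq.hyps(4)[OF that] seq.hyps(3) by (intro incseq_le) (auto simp: incseq_def le_fun_def)
  have int: "integrable M (U i)" for i
  proof (rule Bochner_Integration.integrable_bound[OF seq.prems(1)])
    show "AE x in M. norm (U i x) \<le> norm (f x)"
      using seq.hyps(2) order_trans[OF mono abs_ge_self] by auto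
  qed (rule seq.hyps(1))
  have "(\<lambda>i. \<integral>x. U i x \<partial>M) \<longlonglongrightarrow> (\<integral>x. f x \<partial>M)"
    using seq.hyps seq.prems mono by (intro integral_dominated_convergence[where w = f]) auto
  then have "\<forall>\<^sub>F i in sequentially. (\<integral>x. f x \<partial>M) - \<epsilon> / 2 < (\<integral>x. U i x \<partial>M)"
    using seq.prems by (intro order_tendstoD) auto
  then obtain i where i: "(\<integral>x. f x \<partial>M) - \<epsilon> / 2 < (\<integral>x. U i x \<partial>M)"
    by (auto simp: eventually_sequentially)
  obtain K where K: "\<And>k B. k \<ge> K \<Longrightarrow> B \<in> sets M \<Longrightarrow>
      c * (\<integral>x. U i x \<partial>M) * prob B - \<epsilon> / 2 \<le> (\<integral>x. U i x * indicator B ((T ^^ k) x) \<partial>M)"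
    using seq.IH[OF int, of "\<epsilon> / 2" i] seq.prems by auto
  have "c * (\<integral>x. f x \<partial>M) * prob B - \<epsilon> \<le> (\<integral>x. f x * indicator B ((T ^^ k) x) \<partial>M)"
    if k: "k \<ge> K" and B: "B \<in> sets M" for k B
  proof -
    have cB: "0 \<le> c * prob B" "c * prob B \<le> 1"
      using c mult_mono[of c 1 "prob B" 1] by auto
    have "c * prob B * ((\<integral>x. f x \<partial>M) - (\<integral>x. U i x \<partial>M)) \<le> c * prob B * (\<epsilon> / 2)"
      using cB i by (intro mult_left_mono) auto
    also have "\<dots> \<le> 1 * (\<epsilon> / 2)"
      using cB seq.prems by (intro mult_right_mono) auto
    finally have "c * (\<integral>x. f x \<partial>M) * prob B - \<epsilon> \<le> c * (\<integral>x. U i x \<partial>M) * prob B - \<epsilon> / 2"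
      by (simp add: algebra_simps)
    also have "\<dots> \<le> (\<integral>x. U i x * indicator B ((T ^^ k) x) \<partial>M)"
      by (rule K[OF that])
    also have "\<dots> \<le> (\<integral>x. f x * indicator B ((T ^^ k) x) \<partial>M)"
      using mono by (intro integral_mono integrable_mult_indicator_T int seq.prems B mult_right_mono) auto
    finally show ?thesis .
  qed
  then show ?case by blast
qed

text \<open>\<open>g\<close> is P^k f, obtained as the Radon-Nikodym derivative of the image under
  T^k of the measure with density \<open>f\<close>. Invariance makes preimages of null sets null,
  which gives absolute continuity.\<close>

lemma transfer_operator_nonneg:
  fixes f :: "'a \<Rightarrow> real"
  assumes f: "integrable M f" "\<And>x. 0 \<le> f x"
  obtains g :: "'a \<Rightarrow> real" where "integrable M g" "\<And>x. 0 \<le> g x"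
    "\<And>B. B \<in> sets M \<Longrightarrow> (\<integral>x. g x * indicator B x \<partial>M) = (\<integral>x. f x * indicator B ((T ^^ k) x) \<partial>M)"
proof -
  have [measurable]: "f \<in> borel_measurable M" using f by simp
  define N where "N = distr (density M f) M (T ^^ k)"
  have sets_N: "sets N = sets M" by (simp add: N_def)
  have N: "emeasure N B = (\<integral>\<^sup>+x. ennreal (f x * indicator B ((T ^^ k) x)) \<partial>M)" if [measurable]: "B \<in> sets M" for B
  proof -
    have "emeasure N B = (\<integral>\<^sup>+x. ennreal (f x) * indicator ((T ^^ k) -` B \<inter> space M) x \<partial>M)"
      unfolding N_def by (simp add: emeasure_distr emeasure_density)
    also have "\<dots> = (\<integral>\<^sup>+x. ennreal (f x * indicator B ((T ^^ k) x)) \<partial>M)"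
      by (intro nn_integral_cong) (auto split: split_indicator)
    finally show ?thesis .
  qed
  have ac: "absolutely_continuous M N"
    unfolding absolutely_continuous_def
  proof
    fix B assume B: "B \<in> null_sets M"
    then have [measurable]: "B \<in> sets M" by auto
    have "(T ^^ k) -` B \<inter> space M \<in> null_sets M"
      using B by (intro null_setsI) (auto simp: emeasure_vimage_T_funpow)
    then have "AE x in M. (T ^^ k) x \<notin> B"
      by (rule AE_I') auto
    then have "(\<integral>\<^sup>+x. ennreal (f x * indicator B ((T ^^ k) x)) \<partial>M) = (\<integral>\<^sup>+x. 0 \<partial>M)"
      by (intro nn_integral_cong_AE) auto
    then show "B \<in> null_sets N"
      by (intro null_setsI) (auto simp: N sets_N)
  qed
  have fin: "finite_measure N"
  proof
    have "emeasure N (space N) = (\<integral>\<^sup>+x. ennreal (f x * indicator (space M) ((T ^^ k) x)) \<partial>M)"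
      using N[of "space M"] by (simp add: N_def)
    also have "\<dots> = (\<integral>\<^sup>+x. ennreal (f x) \<partial>M)"
      using measurable_space[OF T_funpow] by (intro nn_integral_cong) auto
    also have "\<dots> < \<infinity>"
      using f by (simp add: integrable_iff_bounded)
    finally show "emeasure N (space N) \<noteq> \<infinity>" by simp
  qed
  obtain g where g [measurable]: "g \<in> borel_measurable M"
    and gN: "AE x in M. RN_deriv M N x = ennreal (g x)" and g0: "\<And>x. 0 \<le> g x"
    using real_RN_deriv[OF fin ac sets_N] by metis
  have dens: "density M g = N"
  proof -
    have "density M g = density M (RN_deriv M N)"
      by (rule density_cong) (use gN in auto)
    then show ?thesis
      using density_RN_deriv[OF ac sets_N] by simp
  qed
  have *: "(\<integral>\<^sup>+x. ennreal (g x * indicator B x) \<partial>M) = (\<integral>\<^sup>+x. ennreal (f x * indicator B ((T ^^ k) x)) \<partial>M)"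
    if [measurable]: "B \<in> sets M" for B
  proof -
    have "(\<integral>\<^sup>+x. ennreal (g x * indicator B x) \<partial>M) = (\<integral>\<^sup>+x. ennreal (g x) * indicator B x \<partial>M)"
      by (intro nn_integral_cong) (auto split: split_indicator)
    also have "\<dots> = emeasure N B"
      unfolding dens[symmetric] by (simp add: emeasure_density)
    finally show ?thesis by (simp add: N)
  qed
  have "(\<integral>\<^sup>+x. ennreal (g x) \<partial>M) = (\<integral>\<^sup>+x. ennreal (g x * indicator (space M) x) \<partial>M)"
    by (intro nn_integral_cong) auto
  also have "\<dots> = emeasure N (space M)" by (simp add: * N)
  also have "\<dots> < \<infinity>"
    using finite_measure.emeasure_finite[OF fin] by (simp add: less_top)
  finally have int: "integrable M g"
    using g0 by (intro integrableI_bounded) auto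
  show ?thesis
  proof
    fix B assume B [measurable]: "B \<in> sets M"
    have "(\<integral>x. g x * indicator B x \<partial>M) = enn2real (\<integral>\<^sup>+x. ennreal (g x * indicator B x) \<partial>M)"
      using g0 by (intro integral_eq_nn_integral) auto
    also have "\<dots> = (\<integral>x. f x * indicator B ((T ^^ k) x) \<partial>M)"
      unfolding *[OF B] using f by (intro integral_eq_nn_integral[symmetric]) auto
    finally show "(\<integral>x. g x * indicator B x \<partial>M) = (\<integral>x. f x * indicator B ((T ^^ k) x) \<partial>M)" .
  qed (use int g0 in auto)
qed

section \<open>Contraction of the transfer operator in the L^1 norm\<close>

lemma integral_indicator_compl_T:
  fixes f :: "'a \<Rightarrow> real"
  assumes f: "integrable M f" and B: "B \<in> sets M"
  shows "(\<integral>x. f x * indicator (space M - B) ((T ^^ k) x) \<partial>M)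
    = (\<integral>x. f x \<partial>M) - (\<integral>x. f x * indicator B ((T ^^ k) x) \<partial>M)"
proof -
  have "(\<integral>x. f x * indicator (space M - B) ((T ^^ k) x) \<partial>M)
      = (\<integral>x. f x - f x * indicator B ((T ^^ k) x) \<partial>M)"
    using measurable_space[OF T_funpow]
    by (intro Bochner_Integration.integral_cong) (auto split: split_indicator)
  then show ?thesis
    using integrable_mult_indicator_T[OF assms] f by simp
qed

text \<open>The positive and the negative part have the same mass m. Their images g1 and g2 under
  P^k overlap, and the integral of |g1 - g2| is 2 m minus twice the integral of min(g1, g2). The
  Doeblin bound makes this overlap at least c m, up to errors.\<close>

lemma transfer_operator_contraction:
  fixes f :: "'a \<Rightarrow> real"
  assumes f: "integrable M f" "(\<integral>x. f x \<partial>M) = 0"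
  shows "\<exists>k. \<exists>g :: 'a \<Rightarrow> real. integrable M g \<and> (\<integral>x. g x \<partial>M) = 0 \<and>
    (\<integral>x. \<bar>g x\<bar> \<partial>M) \<le> (1 - c / 2) * (\<integral>x. \<bar>f x\<bar> \<partial>M) \<and>
    (\<forall>B\<in>sets M. (\<integral>x. g x * indicator B x \<partial>M) = (\<integral>x. f x * indicator B ((T ^^ k) x) \<partial>M))"
proof -
  define f1 where "f1 x = max 0 (f x)" for x
  define f2 where "f2 x = max 0 (- f x)" for x
  have f12: "f x = f1 x - f2 x" "\<bar>f x\<bar> = f1 x + f2 x" for x
    by (auto simp: f1_def f2_def)
  have nn: "0 \<le> f1 x" "0 \<le> f2 x" for x
    by (auto simp: f1_def f2_def)
  have int: "integrable M f1" "integrable M f2"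
    unfolding f1_def[abs_def] f2_def[abs_def] using f by auto
  define m where "m = (\<integral>x. f1 x \<partial>M)"
  have m2: "(\<integral>x. f2 x \<partial>M) = m"
    using f(2) int by (simp add: f12 m_def)
  have norm_f: "(\<integral>x. \<bar>f x\<bar> \<partial>M) = 2 * m"
    unfolding f12(2) using int m2 by (simp add: m_def)
  show ?thesis
  proof (cases "m = 0")
    case True
    then show ?thesis
      using f norm_f by (intro exI[of _ 0] exI[of _ f]) simp
  next
    case False
    moreover have "0 \<le> m" unfolding m_def using nn by simp
    ultimately have m: "0 < m" by simp
    \<comment> \<open>Two errors of c m / 4 leave an overlap of at least c m / 2, which produces the
      factor 1 - c / 2.\<close>
    define e where "e = c * m / 4"
    have e: "0 < e" using c m by (simp add: e_def)
    obtain K1 where K1: "\<And>k B. k \<ge> K1 \<Longrightarrow> B \<in> sets M \<Longrightarrow>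
        c * m * prob B - e \<le> (\<integral>x. f1 x * indicator B ((T ^^ k) x) \<partial>M)"
      using doeblin_integral[OF borel_measurable_integrable[OF int(1)] nn(1) int(1) e] m_def by auto
    obtain K2 where K2: "\<And>k B. k \<ge> K2 \<Longrightarrow> B \<in> sets M \<Longrightarrow>
        c * m * prob B - e \<le> (\<integral>x. f2 x * indicator B ((T ^^ k) x) \<partial>M)"
      using doeblin_integral[OF borel_measurable_integrable[OF int(2)] nn(2) int(2) e] m2 by auto
    define k where "k = max K1 K2"
    obtain g1 where g1: "integrable M g1" "\<And>x. 0 \<le> g1 x" and
      G1: "\<And>B. B \<in> sets M \<Longrightarrow> (\<integral>x. g1 x * indicator B x \<partial>M) = (\<integral>x. f1 x * indicator B ((T ^^ k) x) \<partial>M)"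
      using transfer_operator_nonneg[OF int(1) nn(1), of k] by metis
    obtain g2 where g2: "integrable M g2" "\<And>x. 0 \<le> g2 x" and
      G2: "\<And>B. B \<in> sets M \<Longrightarrow> (\<integral>x. g2 x * indicator B x \<partial>M) = (\<integral>x. f2 x * indicator B ((T ^^ k) x) \<partial>M)"
      using transfer_operator_nonneg[OF int(2) nn(2), of k] by metis
    define g where "g x = g1 x - g2 x" for x
    have g: "integrable M g"
      unfolding g_def[abs_def] using g1 g2 by simp
    then have [measurable]: "g \<in> borel_measurable M" by simp
    have G: "(\<integral>x. g x * indicator B x \<partial>M)
        = (\<integral>x. f1 x * indicator B ((T ^^ k) x) \<partial>M) - (\<integral>x. f2 x * indicator B ((T ^^ k) x) \<partial>M)"
      if B: "B \<in> sets M" for B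
      unfolding g_def left_diff_distrib G1[OF B, symmetric] G2[OF B, symmetric]
      using g1(1) g2(1) B by (intro Bochner_Integration.integral_diff integrable_real_mult_indicator)
    have G': "(\<integral>x. g x * indicator B x \<partial>M) = (\<integral>x. f x * indicator B ((T ^^ k) x) \<partial>M)"
      if B: "B \<in> sets M" for B
      unfolding G[OF B] f12(1) left_diff_distrib using int B
      by (intro Bochner_Integration.integral_diff[symmetric] integrable_mult_indicator_T)
    have "(\<integral>x. g x \<partial>M) = (\<integral>x. g x * indicator (space M) x \<partial>M)"
      by (intro Bochner_Integration.integral_cong) auto
    also have "\<dots> = (\<integral>x. f x * indicator (space M) ((T ^^ k) x) \<partial>M)"
      by (rule G') simp
    also have "\<dots> = (\<integral>x. f x \<partial>M)"
      using measurable_space[OF T_funpow] by (intro Bochner_Integration.integral_cong) auto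
    finally have g0: "(\<integral>x. g x \<partial>M) = 0" using f by simp
    \<comment> \<open>On \<open>P\<close> the smaller of g1 and g2 is g2, outside it is g1. So the
      bound for f2 is applied to \<open>P\<close> and the one for f1 to its complement, and the
      measures of the two sets add up to 1.\<close>
    define P where "P = {x \<in> space M. 0 \<le> g x}"
    have P: "P \<in> sets M" unfolding P_def by measurable
    have P': "space M - P \<in> sets M" using P by simp
    have "(\<integral>x. \<bar>g x\<bar> \<partial>M) = (\<integral>x. g x * indicator P x - g x * indicator (space M - P) x \<partial>M)"
      by (intro Bochner_Integration.integral_cong) (auto simp: P_def indicator_def)
    also have "\<dots> = (\<integral>x. g x * indicator P x \<partial>M) - (\<integral>x. g x * indicator (space M - P) x \<partial>M)"
      using g P P' by (intro Bochner_Integration.integral_diff integrable_real_mult_indicator)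
    also have "\<dots> = 2 * m - 2 * ((\<integral>x. f1 x * indicator (space M - P) ((T ^^ k) x) \<partial>M)
        + (\<integral>x. f2 x * indicator P ((T ^^ k) x) \<partial>M))"
      unfolding G[OF P] G[OF P'] integral_indicator_compl_T[OF int(1) P] integral_indicator_compl_T[OF int(2) P]
      by (simp add: m2 flip: m_def)
    also have "\<dots> \<le> 2 * m - 2 * ((c * m * prob (space M - P) - e) + (c * m * prob P - e))"
      using K1[OF _ P', of k] K2[OF _ P, of k] by (simp add: k_def)
    also have "\<dots> = (1 - c / 2) * (2 * m)"
      using P by (simp add: prob_compl e_def algebra_simps)
    finally have "(\<integral>x. \<bar>g x\<bar> \<partial>M) \<le> (1 - c / 2) * (\<integral>x. \<bar>f x\<bar> \<partial>M)"
      by (simp add: norm_f)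
    then show ?thesis
      using g g0 G' by blast
  qed
qed

text \<open>Each contraction step has its own exponent, depending on the function at hand, and the
  exponents are added along the iteration.\<close>

lemma transfer_operator_contraction_iterate:
  fixes f :: "'a \<Rightarrow> real"
  assumes f: "integrable M f" "(\<integral>x. f x \<partial>M) = 0"
  shows "\<exists>k. \<exists>g :: 'a \<Rightarrow> real. integrable M g \<and> (\<integral>x. g x \<partial>M) = 0 \<and>
    (\<integral>x. \<bar>g x\<bar> \<partial>M) \<le> (1 - c / 2) ^ j * (\<integral>x. \<bar>f x\<bar> \<partial>M) \<and>
    (\<forall>B\<in>sets M. (\<integral>x. g x * indicator B x \<partial>M) = (\<integral>x. f x * indicator B ((T ^^ k) x) \<partial>M))"
proof (induction j)
  case 0
  show ?case
    using f by (intro exI[of _ 0] exI[of _ f]) simp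
next
  case (Suc j)
  then obtain k g where g: "integrable M g" "(\<integral>x. g x \<partial>M) = 0"
    and norm_g: "(\<integral>x. \<bar>g x\<bar> \<partial>M) \<le> (1 - c / 2) ^ j * (\<integral>x. \<bar>f x\<bar> \<partial>M)"
    and G: "\<And>B. B \<in> sets M \<Longrightarrow> (\<integral>x. g x * indicator B x \<partial>M) = (\<integral>x. f x * indicator B ((T ^^ k) x) \<partial>M)"
    by blast
  obtain l h where h: "integrable M h" "(\<integral>x. h x \<partial>M) = 0"
    and norm_h: "(\<integral>x. \<bar>h x\<bar> \<partial>M) \<le> (1 - c / 2) * (\<integral>x. \<bar>g x\<bar> \<partial>M)"
    and H: "\<And>B. B \<in> sets M \<Longrightarrow> (\<integral>x. h x * indicator B x \<partial>M) = (\<integral>x. g x * indicator B ((T ^^ l) x) \<partial>M)"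
    using transfer_operator_contraction[OF g] by blast
  have "(\<integral>x. h x * indicator B x \<partial>M) = (\<integral>x. f x * indicator B ((T ^^ (l + k)) x) \<partial>M)"
    if B: "B \<in> sets M" for B
  proof -
    have "(\<integral>x. h x * indicator B x \<partial>M) = (\<integral>x. g x * indicator ((T ^^ l) -` B \<inter> space M) x \<partial>M)"
      unfolding H[OF B] by (intro Bochner_Integration.integral_cong) (auto split: split_indicator)
    also have "\<dots> = (\<integral>x. f x * indicator ((T ^^ l) -` B \<inter> space M) ((T ^^ k) x) \<partial>M)"
      by (rule G[OF vimage_T_funpow[OF B]])
    also have "\<dots> = (\<integral>x. f x * indicator B ((T ^^ (l + k)) x) \<partial>M)"
      using measurable_space[OF T_funpow]
      by (intro Bochner_Integration.integral_cong) (auto simp: funpow_add split: split_indicator)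
    finally show ?thesis .
  qed
  moreover have "(\<integral>x. \<bar>h x\<bar> \<partial>M) \<le> (1 - c / 2) ^ Suc j * (\<integral>x. \<bar>f x\<bar> \<partial>M)"
  proof -
    have "(1 - c / 2) * (\<integral>x. \<bar>g x\<bar> \<partial>M) \<le> (1 - c / 2) * ((1 - c / 2) ^ j * (\<integral>x. \<bar>f x\<bar> \<partial>M))"
      using norm_g c by (intro mult_left_mono) auto
    then show ?thesis using norm_h by (simp add: mult.assoc)
  qed
  ultimately show ?case using h by blast
qed

text \<open>The correlation is the integral of f = 1_A - mu(A) over T^-n B. For n >= k it equals the
  integral of g = P^k f over T^-(n-k) B, so the L^1 norm of \<open>g\<close> bounds it uniformly in
  \<open>B\<close> and in such n.\<close>

lemma uniform_mixing:
  assumes A: "A \<in> sets M" and "0 < \<epsilon>"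
  shows "\<exists>K. \<forall>n\<ge>K. \<forall>B\<in>sets M. \<bar>prob (A \<inter> (T ^^ n) -` B) - prob A * prob B\<bar> < \<epsilon>"
proof -
  define f where "f x = indicator A x - prob A" for x
  have f: "integrable M f" "(\<integral>x. f x \<partial>M) = 0"
    unfolding f_def[abs_def]
    using integrable_indicator_events[OF A] sets.sets_into_space[OF A]
    by (simp_all add: prob_space Int_absorb2)
  define S where "S = (\<integral>x. \<bar>f x\<bar> \<partial>M)"
  have "(\<lambda>j. (1 - c / 2) ^ j * S) \<longlonglongrightarrow> 0"
    using c by (intro tendsto_mult_left_zero LIMSEQ_power_zero) auto
  then have "\<forall>\<^sub>F j in sequentially. (1 - c / 2) ^ j * S < \<epsilon>"
    using \<open>0 < \<epsilon>\<close> by (intro order_tendstoD) auto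
  then obtain j where j: "(1 - c / 2) ^ j * S < \<epsilon>"
    by (auto simp: eventually_sequentially)
  obtain k g where g: "integrable M g"
    and norm_g: "(\<integral>x. \<bar>g x\<bar> \<partial>M) \<le> (1 - c / 2) ^ j * S"
    and G: "\<And>B. B \<in> sets M \<Longrightarrow> (\<integral>x. g x * indicator B x \<partial>M) = (\<integral>x. f x * indicator B ((T ^^ k) x) \<partial>M)"
    using transfer_operator_contraction_iterate[OF f, of j] unfolding S_def by blast
  have "\<bar>prob (A \<inter> (T ^^ n) -` B) - prob A * prob B\<bar> < \<epsilon>" if n: "n \<ge> k" and B: "B \<in> sets M" for n B
  proof -
    have AB: "A \<inter> (T ^^ n) -` B = A \<inter> ((T ^^ n) -` B \<inter> space M)"
      using sets.sets_into_space[OF A] by auto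
    have "prob (A \<inter> (T ^^ n) -` B) - prob A * prob B
        = (\<integral>x. indicator (A \<inter> ((T ^^ n) -` B \<inter> space M)) x
            - prob A * indicator ((T ^^ n) -` B \<inter> space M) x \<partial>M)"
    proof -
      have V: "(T ^^ n) -` B \<inter> space M \<in> sets M" using B by (rule vimage_T_funpow)
      have AV: "A \<inter> ((T ^^ n) -` B \<inter> space M) \<in> sets M" using A V by (rule sets.Int)
      have "(\<integral>x. indicator (A \<inter> ((T ^^ n) -` B \<inter> space M)) x
            - prob A * indicator ((T ^^ n) -` B \<inter> space M) x \<partial>M)
          = prob (A \<inter> ((T ^^ n) -` B \<inter> space M)) - prob A * prob ((T ^^ n) -` B \<inter> space M)"
        using integrable_indicator_events[OF V] integrable_indicator_events[OF AV]
          sets.sets_into_space[OF V] sets.sets_into_space[OF AV]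
        by (simp add: Int_absorb2 del: Int_iff)
      then show ?thesis
        unfolding AB using B by (simp add: prob_vimage_T_funpow)
    qed
    also have "\<dots> = (\<integral>x. f x * indicator B ((T ^^ n) x) \<partial>M)"
      by (intro Bochner_Integration.integral_cong) (auto simp: f_def split: split_indicator)
    also have "\<dots> = (\<integral>x. f x * indicator ((T ^^ (n - k)) -` B \<inter> space M) ((T ^^ k) x) \<partial>M)"
    proof (intro Bochner_Integration.integral_cong refl)
      fix x assume "x \<in> space M"
      moreover have "(T ^^ n) x = (T ^^ (n - k)) ((T ^^ k) x)"
        using n by (metis funpow_add comp_apply le_add_diff_inverse2)
      ultimately show "f x * indicator B ((T ^^ n) x)
          = f x * indicator ((T ^^ (n - k)) -` B \<inter> space M) ((T ^^ k) x)"
        using measurable_space[OF T_funpow] by (auto split: split_indicator)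
    qed
    also have "\<dots> = (\<integral>x. g x * indicator ((T ^^ (n - k)) -` B \<inter> space M) x \<partial>M)"
      by (rule G[OF vimage_T_funpow[OF B], symmetric])
    finally have "\<bar>prob (A \<inter> (T ^^ n) -` B) - prob A * prob B\<bar>
        \<le> (\<integral>x. \<bar>g x * indicator ((T ^^ (n - k)) -` B \<inter> space M) x\<bar> \<partial>M)"
      using integral_abs_bound by metis
    also have "\<dots> \<le> (\<integral>x. \<bar>g x\<bar> \<partial>M)"
      using g vimage_T_funpow[OF B]
      by (intro integral_mono integrable_abs integrable_real_mult_indicator) (auto simp: indicator_def)
    also have "\<dots> < \<epsilon>" using norm_g j by simp
    finally show ?thesis .
  qed
  then show ?thesis by blast
qed

end

text \<open>\<open>T\<close> is the total function and \<open>D\<close> the set on which the partial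
  map is defined. Since \<open>D\<close> has full measure, total and partial preimages of a
  measurable set differ only by a null set.\<close>

locale partial_doeblin_system = doeblin_system +
  fixes D :: "'a set"
  assumes D [measurable]: "D \<in> sets M" and AE_D: "AE x in M. x \<in> D"
begin

lemma AE_orbit_in_D: "AE x in M. \<forall>k. (T ^^ k) x \<in> D"
proof -
  have "AE x in M. (T ^^ k) x \<in> D" for k
  proof -
    have "space M - D \<in> null_sets M"
      using AE_D by (subst (asm) AE_iff_null) (auto simp: set_diff_eq)
    then have "(T ^^ k) -` (space M - D) \<inter> space M \<in> null_sets M"
      by (intro null_setsI) (auto simp: emeasure_vimage_T_funpow)
    then show ?thesis
      using measurable_space[OF T_funpow] by (rule_tac AE_I') auto
  qed
  then show ?thesis by (simp add: AE_all_countable)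
qed

section \<open>Preimages under the partial map\<close>

lemma iter_preimage_0: "iter_preimage D T 0 A = A"
  by (simp add: iter_preimage_def)

text \<open>\<open>iter_preimage\<close> does not mention the space. That its points lie there
  follows from \<open>A\<close> for n = 0 and from the condition at time 0 for n > 0.\<close>

lemma iter_preimage_eq:
  assumes "A \<in> sets M"
  shows "iter_preimage D T n A = {x \<in> space M. (\<forall>k<n. (T ^^ k) x \<in> D) \<and> (T ^^ n) x \<in> A}"
proof -
  have "x \<in> space M" if "x \<in> iter_preimage D T n A" for x
    using that sets.sets_into_space[OF assms] sets.sets_into_space[OF D]
    by (cases n) (auto simp: iter_preimage_def)
  then show ?thesis by (auto simp: iter_preimage_def)
qed

lemma iter_preimage_sets [measurable]:
  assumes "A \<in> sets M"
  shows "iter_preimage D T n A \<in> sets M"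
proof -
  have "iter_preimage D T n A
      = (\<Inter>k\<in>{..<n}. (T ^^ k) -` D \<inter> space M) \<inter> ((T ^^ n) -` A \<inter> space M)" if "n \<noteq> 0"
    unfolding iter_preimage_eq[OF assms] using that by auto
  moreover have "(\<Inter>k\<in>{..<n}. (T ^^ k) -` D \<inter> space M) \<in> sets M" if "n \<noteq> 0"
    using that by (intro sets.finite_INT vimage_T_funpow D) auto
  ultimately show ?thesis
    using assms vimage_T_funpow[OF assms, of n]
    by (metis sets.Int iter_preimage_0)
qed

lemma AE_iter_preimage_iff:
  assumes "A \<in> sets M"
  shows "AE x in M. x \<in> iter_preimage D T n A \<longleftrightarrow> x \<in> (T ^^ n) -` A \<inter> space M"
  unfolding iter_preimage_eq[OF assms] using AE_orbit_in_D
proof (rule AE_mp[OF _ AE_I2], intro impI)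
  fix x assume "x \<in> space M" "\<forall>k. (T ^^ k) x \<in> D"
  then show "x \<in> {x \<in> space M. (\<forall>k<n. (T ^^ k) x \<in> D) \<and> (T ^^ n) x \<in> A}
      \<longleftrightarrow> x \<in> (T ^^ n) -` A \<inter> space M"
    by blast
qed

lemma emeasure_iter_preimage:
  assumes "A \<in> sets M"
  shows "emeasure M (iter_preimage D T n A) = emeasure M A"
proof -
  have "emeasure M (iter_preimage D T n A) = emeasure M ((T ^^ n) -` A \<inter> space M)"
    using AE_iter_preimage_iff[OF assms] assms by (intro emeasure_eq_AE) auto
  then show ?thesis using emeasure_vimage_T_funpow[OF assms] by simp
qed

lemma leaves_invariant: "leaves_invariant D T M"
  unfolding leaves_invariant_def
proof (intro conjI ballI)
  show "T ` D \<subseteq> space M"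
    using measurable_space[OF T] sets.sets_into_space[OF D] by blast
qed (rule D iter_preimage_sets emeasure_iter_preimage, assumption?)+

text \<open>All sets after \<open>A 0\<close> are packed into one set B, seen at time n 1. This B
  depends on the later times, so the induction rests on mixing that is uniform in B.\<close>

lemma mixing_total:
  assumes "\<And>i. i \<le> k \<Longrightarrow> A i \<in> sets M" "0 < \<epsilon>"
  shows "\<exists>K. \<forall>n. n 0 = 0 \<and> (\<forall>i<k. n i + K \<le> n (Suc i)) \<longrightarrow>
    \<bar>prob (\<Inter>i\<le>k. (T ^^ n i) -` A i \<inter> space M) - (\<Prod>i\<le>k. prob (A i))\<bar> < \<epsilon>"
  using assms
proof (induction k arbitrary: A \<epsilon>)
  case 0
  then show ?case
    using sets.sets_into_space[of "A 0" M] by (simp add: Int_absorb2)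
next
  case (Suc k)
  obtain K1 where K1: "\<And>n B. n \<ge> K1 \<Longrightarrow> B \<in> sets M \<Longrightarrow>
      \<bar>prob (A 0 \<inter> (T ^^ n) -` B) - prob (A 0) * prob B\<bar> < \<epsilon> / 2"
    using uniform_mixing[of "A 0" "\<epsilon> / 2"] Suc.prems by auto
  obtain K2 where K2: "\<And>n. n 0 = 0 \<Longrightarrow> (\<forall>i<k. n i + K2 \<le> n (Suc i)) \<Longrightarrow>
      \<bar>prob (\<Inter>i\<le>k. (T ^^ n i) -` A (Suc i) \<inter> space M) - (\<Prod>i\<le>k. prob (A (Suc i)))\<bar> < \<epsilon> / 2"
    using Suc.IH[of "\<lambda>i. A (Suc i)" "\<epsilon> / 2"] Suc.prems by auto
  define K where "K = max K1 K2"
  have "\<bar>prob (\<Inter>i\<le>Suc k. (T ^^ n i) -` A i \<inter> space M) - (\<Prod>i\<le>Suc k. prob (A i))\<bar> < \<epsilon>"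
    if n0: "n 0 = 0" and gap: "\<And>i. i < Suc k \<Longrightarrow> n i + K \<le> n (Suc i)" for n
  proof -
    \<comment> \<open>Times are measured from n 1, so that the induction hypothesis sees a sequence
      starting at 0 with the same gaps.\<close>
    define m where "m i = n (Suc i) - n 1" for i
    have n1: "n 1 \<le> n (Suc i)" if "i \<le> k" for i
      using that
    proof (induction i)
      case (Suc i)
      then show ?case using gap[of "Suc i"] by simp
    qed simp
    have m: "m 0 = 0" "\<forall>i<k. m i + K2 \<le> m (Suc i)"
    proof -
      show "\<forall>i<k. m i + K2 \<le> m (Suc i)"
      proof safe
        fix i assume "i < k"
        then show "m i + K2 \<le> m (Suc i)"
          using gap[of "Suc i"] n1[of i] n1[of "Suc i"] by (simp add: m_def K_def)
      qed
    qed (simp add: m_def)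
    define B where "B = (\<Inter>i\<le>k. (T ^^ m i) -` A (Suc i) \<inter> space M)"
    have B: "B \<in> sets M"
      unfolding B_def using Suc.prems by (intro sets.finite_INT vimage_T_funpow) auto
    have fwd: "x \<in> A 0 \<inter> (T ^^ n 1) -` B"
      if "\<And>i. i \<le> Suc k \<Longrightarrow> x \<in> (T ^^ n i) -` A i \<inter> space M" for x
    proof -
      have "(T ^^ m i) ((T ^^ n 1) x) \<in> A (Suc i)" if "i \<le> k" for i
      proof -
        have "(T ^^ m i) ((T ^^ n 1) x) = (T ^^ (m i + n 1)) x"
          by (simp add: funpow_add)
        moreover have "m i + n 1 = n (Suc i)"
          using n1[OF that] by (simp add: m_def)
        ultimately show ?thesis
          using \<open>\<And>i. i \<le> Suc k \<Longrightarrow> x \<in> (T ^^ n i) -` A i \<inter> space M\<close>[of "Suc i"] that by simp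
      qed
      moreover have "x \<in> A 0" "x \<in> space M"
        using that[of 0] n0 by auto
      ultimately show ?thesis
        using measurable_space[OF T_funpow] by (auto simp: B_def)
    qed
    have bwd: "x \<in> (T ^^ n i) -` A i \<inter> space M" if x: "x \<in> A 0 \<inter> (T ^^ n 1) -` B" and "i \<le> Suc k" for x i
    proof (cases i)
      case 0
      then show ?thesis using x n0 sets.sets_into_space[of "A 0" M] Suc.prems(1)[of 0] by auto
    next
      case (Suc j)
      have "(T ^^ m j) ((T ^^ n 1) x) = (T ^^ (m j + n 1)) x"
        by (simp add: funpow_add)
      moreover have "m j + n 1 = n (Suc j)"
        using n1[of j] that(2) Suc by (simp add: m_def)
      moreover have "(T ^^ m j) ((T ^^ n 1) x) \<in> A (Suc j)"
        using x that(2) Suc by (auto simp: B_def)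
      ultimately show ?thesis
        using x sets.sets_into_space[of "A 0" M] Suc.prems(1)[of 0] Suc by auto
    qed
    have eq: "(\<Inter>i\<le>Suc k. (T ^^ n i) -` A i \<inter> space M) = A 0 \<inter> (T ^^ n 1) -` B"
    proof (intro equalityI subsetI)
      fix x assume "x \<in> (\<Inter>i\<le>Suc k. (T ^^ n i) -` A i \<inter> space M)"
      then have "\<forall>i\<in>{..Suc k}. x \<in> (T ^^ n i) -` A i \<inter> space M"
        by (simp only: INT_iff)
      then show "x \<in> A 0 \<inter> (T ^^ n 1) -` B"
        by (intro fwd) (simp only: atMost_iff Ball_def)
    next
      fix x assume "x \<in> A 0 \<inter> (T ^^ n 1) -` B"
      then show "x \<in> (\<Inter>i\<le>Suc k. (T ^^ n i) -` A i \<inter> space M)"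
        by (intro INT_I bwd) (simp_all only: atMost_iff)
    qed
    have "\<bar>prob (A 0 \<inter> (T ^^ n 1) -` B) - prob (A 0) * prob B\<bar> < \<epsilon> / 2"
    proof (rule K1[OF _ B])
      show "K1 \<le> n 1" using gap[of 0] n0 by (simp add: K_def)
    qed
    moreover have "\<bar>prob (A 0) * prob B - prob (A 0) * (\<Prod>i\<le>k. prob (A (Suc i)))\<bar> < \<epsilon> / 2"
    proof -
      have "\<bar>prob (A 0) * prob B - prob (A 0) * (\<Prod>i\<le>k. prob (A (Suc i)))\<bar>
          = prob (A 0) * \<bar>prob B - (\<Prod>i\<le>k. prob (A (Suc i)))\<bar>"
        by (simp add: abs_mult flip: right_diff_distrib)
      also have "\<dots> \<le> 1 * \<bar>prob B - (\<Prod>i\<le>k. prob (A (Suc i)))\<bar>"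
        by (intro mult_right_mono) auto
      also have "\<dots> < \<epsilon> / 2"
        using K2[OF m] by (simp add: B_def)
      finally show ?thesis .
    qed
    moreover have "(\<Prod>i\<le>Suc k. prob (A i)) = prob (A 0) * (\<Prod>i\<le>k. prob (A (Suc i)))"
      by (rule prod.atMost_Suc_shift)
    ultimately show ?thesis
      unfolding eq by linarith
  qed
  then show ?case by (intro exI[of _ K] allI impI) (elim conjE, simp only: )
qed

lemma mixing_of_all_orders: "mixing_of_all_orders D T M"
  unfolding mixing_of_all_orders_def
proof safe
  fix k and A :: "nat \<Rightarrow> 'a set" and \<epsilon> :: real
  assume A: "\<forall>i\<le>k. A i \<in> sets M" and "0 < \<epsilon>"
  then obtain K where K: "\<And>n. n 0 = 0 \<and> (\<forall>i<k. n i + K \<le> n (Suc i)) \<Longrightarrow>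
    \<bar>prob (\<Inter>i\<le>k. (T ^^ n i) -` A i \<inter> space M) - (\<Prod>i\<le>k. prob (A i))\<bar> < \<epsilon>"
    using mixing_total[of k A \<epsilon>] by blast
  have "prob (\<Inter>i\<le>k. iter_preimage D T (n i) (A i)) = prob (\<Inter>i\<le>k. (T ^^ n i) -` A i \<inter> space M)" for n
  proof (rule finite_measure_eq_AE)
    have "AE x in M. \<forall>i\<in>{..k}. x \<in> iter_preimage D T (n i) (A i) \<longleftrightarrow> x \<in> (T ^^ n i) -` A i \<inter> space M"
      using A by (intro AE_finite_allI AE_iter_preimage_iff) auto
    then show "AE x in M. x \<in> (\<Inter>i\<le>k. iter_preimage D T (n i) (A i)) \<longleftrightarrow>
        x \<in> (\<Inter>i\<le>k. (T ^^ n i) -` A i \<inter> space M)"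
      by eventually_elim auto
    show "(\<Inter>i\<le>k. iter_preimage D T (n i) (A i)) \<in> sets M"
      using A by (intro sets.finite_INT) auto
    show "(\<Inter>i\<le>k. (T ^^ n i) -` A i \<inter> space M) \<in> sets M"
      using A by (intro sets.finite_INT vimage_T_funpow) auto
  qed
  with K show "\<exists>K. \<forall>n. n 0 = 0 \<and> (\<forall>i<k. n i + K \<le> n (Suc i)) \<longrightarrow>
    \<bar>prob (\<Inter>i\<le>k. iter_preimage D T (n i) (A i)) - (\<Prod>i\<le>k. prob (A i))\<bar> < \<epsilon>"
    by (intro exI[of _ K]) presburger
qed

section \<open>Ergodicity and exactness\<close>

lemma iter_preimage_fixed:
  assumes "iter_preimage D T 1 A = A"
  shows "iter_preimage D T n A = A"
proof (induction n)
  case (Suc n)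
  have "iter_preimage D T (Suc n) A = iter_preimage D T n (iter_preimage D T 1 A)"
    by (auto simp: iter_preimage_def less_Suc_eq)
  then show ?case using Suc assms by simp
qed (simp add: iter_preimage_def)

text \<open>A set equal to its preimage meets its own later preimages in itself, so mixing gives
  mu(A) = mu(A)^2.\<close>

lemma ergodic: "ergodic D T M"
  unfolding ergodic_def
proof safe
  fix A assume A: "A \<in> sets M" and fixed: "iter_preimage D T 1 A = A"
    and nz: "measure M (space M - A) \<noteq> 0"
  have "\<bar>prob A - prob A * prob A\<bar> < \<epsilon>" if "0 < \<epsilon>" for \<epsilon>
  proof -
    obtain K where K: "\<And>n B. n \<ge> K \<Longrightarrow> B \<in> sets M \<Longrightarrow>
        \<bar>prob (A \<inter> (T ^^ n) -` B) - prob A * prob B\<bar> < \<epsilon>"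
      using uniform_mixing[OF A \<open>0 < \<epsilon>\<close>] by blast
    have "A \<inter> (T ^^ K) -` A = A"
      using iter_preimage_fixed[OF fixed, of K] by (auto simp: iter_preimage_def)
    then show ?thesis using K[of K A] A by simp
  qed
  then have "\<bar>prob A - prob A * prob A\<bar> \<le> 0"
    by (meson less_irrefl not_le)
  then have "prob A * (1 - prob A) = 0" by (simp add: algebra_simps)
  then show "prob A = 0"
    using nz A by (simp add: prob_compl)
qed

text \<open>Almost no point of \<open>A\<close> is at time n in the complement B of the n-th image,
  so mixing forces mu(A) mu(B) to be small. B changes with n, which the uniformity of mixing allows.
  Measurability of images is a separate input, since it is not automatic for a measurable
  map.\<close>

lemma exactI:
  assumes image: "\<And>A. A \<in> sets M \<Longrightarrow> T ` (A \<inter> D) \<in> sets M"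
  shows "exact D T M"
  unfolding exact_def
proof safe
  fix A assume A: "A \<in> sets M" and pos: "0 < prob A"
  have step: "iter_image D T (Suc n) A = T ` (iter_image D T n A \<inter> D)" for n
    by (force simp: iter_image_def less_Suc_eq)
  have im: "iter_image D T n A \<in> sets M" for n
  proof (induction n)
    case 0
    then show ?case using A by (simp add: iter_image_def)
  qed (simp only: step image)
  show "(\<lambda>n. prob (iter_image D T n A)) \<longlonglongrightarrow> 1"
  proof (rule LIMSEQ_I)
    fix r :: real assume r: "0 < r"
    obtain K where K: "\<And>n B. n \<ge> K \<Longrightarrow> B \<in> sets M \<Longrightarrow>
        \<bar>prob (A \<inter> (T ^^ n) -` B) - prob A * prob B\<bar> < prob A * r"
      using uniform_mixing[OF A, of "prob A * r"] pos r by auto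
    have "norm (prob (iter_image D T n A) - 1) < r" if "n \<ge> K" for n
    proof -
      define B where "B = space M - iter_image D T n A"
      have B: "B \<in> sets M" using im by (simp add: B_def)
      have "AE x in M. x \<notin> A \<inter> (T ^^ n) -` B"
        using AE_orbit_in_D by eventually_elim (auto simp: B_def iter_image_def)
      moreover have "A \<inter> (T ^^ n) -` B \<in> sets M"
      proof -
        have "A \<inter> (T ^^ n) -` B = A \<inter> ((T ^^ n) -` B \<inter> space M)"
          using sets.sets_into_space[OF A] by auto
        then show ?thesis using A vimage_T_funpow[OF B] by simp
      qed
      ultimately have "prob (A \<inter> (T ^^ n) -` B) = 0"
        by (simp add: prob_eq_0)
      then have "prob A * prob B < prob A * r"
        using K[OF that B] pos by simp
      then have "prob B < r" using pos by simp
      moreover have "prob B = 1 - prob (iter_image D T n A)"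
        unfolding B_def using im by (simp add: prob_compl)
      ultimately show ?thesis by simp
    qed
    then show "\<exists>no. \<forall>n\<ge>no. norm (prob (iter_image D T n A) - 1) < r" by blast
  qed
qed

end

section \<open>Measures on Euclidean space as coordinate-wise products\<close>

lemma measurable_vec_nth [measurable (raw)]:
  fixes f :: "'a \<Rightarrow> real ^ 'n"
  assumes "f \<in> borel_measurable M"
  shows "(\<lambda>x. f x $ i) \<in> borel_measurable M"
  using measurable_compose[OF assms borel_measurable_nth] .

lemma borel_measurable_vecI:
  fixes f :: "'a \<Rightarrow> real ^ 'n"
  assumes "\<And>i. (\<lambda>x. f x $ i) \<in> borel_measurable M"
  shows "f \<in> borel_measurable M"
  unfolding borel_measurable_euclidean_space[of f]
  using assms by (auto simp: Basis_vec_def inner_axis)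

lemma Basis_vec_eq_range: "(Basis :: (real ^ 'n) set) = range (\<lambda>i. axis i 1)"
  by (auto simp: Basis_vec_def)

text \<open>The product formula over basis vectors is carried to the index type along i -> axis i
  1.\<close>

lemma nn_integral_lborel_vec_prod:
  fixes F :: "'n::finite \<Rightarrow> real \<Rightarrow> ennreal"
  assumes [measurable]: "\<And>i. F i \<in> borel_measurable borel"
  shows "(\<integral>\<^sup>+x. (\<Prod>i\<in>UNIV. F i (x $ i)) \<partial>(lborel :: (real ^ 'n) measure)) = (\<Prod>i\<in>UNIV. \<integral>\<^sup>+t. F i t \<partial>lborel)"
proof -
  have inj: "inj (\<lambda>i::'n. axis i (1::real))"
    by (auto simp: inj_on_def axis_eq_axis)
  have re: "(\<Prod>b\<in>(Basis :: (real ^ 'n) set). G (axis_index b)) = (\<Prod>i\<in>UNIV. G i)" for G :: "'n \<Rightarrow> ennreal"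
    unfolding Basis_vec_eq_range by (subst prod.reindex[OF inj]) (simp add: comp_def)
  have "(\<integral>\<^sup>+x. (\<Prod>i\<in>UNIV. F i (x $ i)) \<partial>(lborel :: (real ^ 'n) measure))
      = (\<integral>\<^sup>+x. (\<Prod>b\<in>Basis. F (axis_index b) (x \<bullet> b)) \<partial>(lborel :: (real ^ 'n) measure))"
  proof (rule nn_integral_cong)
    fix x :: "real ^ 'n"
    have "(\<Prod>b\<in>Basis. F (axis_index b) (x \<bullet> b)) = (\<Prod>b\<in>(Basis :: (real ^ 'n) set). F (axis_index b) (x $ axis_index b))"
      by (intro prod.cong) (auto simp: Basis_vec_eq_range inner_axis)
    also have "\<dots> = (\<Prod>i\<in>UNIV. F i (x $ i))" by (rule re)
    finally show "(\<Prod>i\<in>UNIV. F i (x $ i)) = (\<Prod>b\<in>Basis. F (axis_index b) (x \<bullet> b))" ..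
  qed
  also have "\<dots> = (\<Prod>b\<in>(Basis :: (real ^ 'n) set). \<integral>\<^sup>+t. F (axis_index b) t \<partial>lborel)"
    by (rule nn_integral_lborel_prod) auto
  also have "\<dots> = (\<Prod>i\<in>UNIV. \<integral>\<^sup>+t. F i t \<partial>lborel)" by (rule re)
  finally show ?thesis .
qed

lemma prod_indicator: "finite I \<Longrightarrow> (\<Prod>i\<in>I. indicator (A i) (f i) :: ennreal) = indicator {x. \<forall>i\<in>I. f i \<in> A i} x"
  by (induction I rule: finite_induct) (auto simp: indicator_def)

lemma indicator_atMost_vec: "indicator {..t :: real ^ 'n} x = (\<Prod>i\<in>UNIV. indicator {..t $ i} (x $ i) :: ennreal)"
  by (subst prod_indicator) (auto simp: less_eq_vec_def indicator_def)

text \<open>The sets \<open>{..t}\<close> generate the Borel sets, are closed under intersection,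
  and have indicators that factor over the coordinates. The last property reduces the later
  comparisons of measures to one dimension.\<close>

lemma measure_vec_eqI:
  fixes M N :: "(real ^ 'n) measure"
  assumes sets: "sets M = sets borel" "sets N = sets borel"
    and fin: "emeasure M UNIV \<noteq> \<infinity>"
    and eq: "\<And>t. emeasure M {..t} = emeasure N {..t}"
  shows "M = N"
proof (rule measure_eqI_generator_eq[where \<Omega> = UNIV and E = "range atMost" and A = "\<lambda>k. {.. (\<chi> i. real k)}"])
  show "Int_stable (range (atMost :: real ^ 'n \<Rightarrow> _))"
  proof (rule Int_stableI)
    fix a b :: "(real ^ 'n) set" assume "a \<in> range atMost" "b \<in> range atMost"
    then obtain s t where "a = {..s}" "b = {..t}" by auto
    then have "a \<inter> b = {..inf s t}" by auto
    then show "a \<inter> b \<in> range atMost" by blast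
  qed
  have b: "sets (borel :: (real ^ 'n) measure) = sigma_sets UNIV (range atMost)"
    by (subst borel_eq_atMost) simp
  show "sets M = sigma_sets UNIV (range atMost)" "sets N = sigma_sets UNIV (range atMost)"
    using sets b by simp_all
  show "(\<Union>k. {.. (\<chi> i. real k)}) = (UNIV :: (real ^ 'n) set)"
  proof (intro equalityI subsetI UNIV_I)
    fix x :: "real ^ 'n"
    obtain k :: nat where k: "Max (range (\<lambda>i. x $ i)) \<le> real k" using real_arch_simple by blast
    have "x $ i \<le> Max (range (\<lambda>i. x $ i))" for i by (intro Max_ge) auto
    with k show "x \<in> (\<Union>k. {.. (\<chi> i. real k)})"
      by (auto simp: less_eq_vec_def intro: order_trans)
  qed
  show "emeasure M {.. (\<chi> i. real k)} \<noteq> \<infinity>" for k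
    using fin emeasure_mono[of "{.. (\<chi> i. real k)}" UNIV M] sets
    by (metis infinity_ennreal_def neq_top_trans sets.top sets_eq_imp_space_eq space_borel subset_UNIV)
qed (use eq in auto)

section \<open>Change of variables along one inverse branch\<close>

lemma AE_lborel_real_neq: "AE s :: real in lborel. s \<noteq> c"
  by (rule AE_I'[of "{c}"]) auto

lemma floor_recip_eq_iff:
  fixes s :: real
  assumes "0 < s" "1 \<le> n"
  shows "\<lfloor>1 / s\<rfloor> = n \<longleftrightarrow> 1 / (of_int n + 1) < s \<and> s \<le> 1 / of_int n"
proof -
  have "0 < real_of_int n" using assms by simp
  have "\<lfloor>1 / s\<rfloor> = n \<longleftrightarrow> of_int n \<le> 1 / s \<and> 1 / s < of_int n + 1"
    by (simp add: floor_eq_iff)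
  also have "of_int n \<le> 1 / s \<longleftrightarrow> s \<le> 1 / of_int n"
    using assms \<open>0 < real_of_int n\<close> by (simp add: field_simps)
  also have "1 / s < of_int n + 1 \<longleftrightarrow> 1 / (of_int n + 1) < s"
    using assms \<open>0 < real_of_int n\<close> by (simp add: field_simps)
  finally show ?thesis by blast
qed

text \<open>This is the substitution s = 1/(n + y). Closed and half-open intervals are exchanged
  because endpoints are null.\<close>

lemma nn_integral_gauss1_branch:
  fixes F :: "real \<Rightarrow> ennreal"
  assumes n: "1 \<le> n" and [measurable]: "F \<in> borel_measurable borel"
  shows "(\<integral>\<^sup>+s. indicator {s \<in> {0<..<1}. \<lfloor>1 / s\<rfloor> = n} s * F s \<partial>lborel)
    = (\<integral>\<^sup>+y. indicator {0..<1} y * ennreal (1 / (of_int n + y)\<^sup>2) * F (1 / (of_int n + y)) \<partial>lborel)"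
proof -
  have n': "1 \<le> real_of_int n" using n by simp
  let ?a = "1 / (real_of_int n + 1)" and ?b = "1 / real_of_int n"
  have "(\<integral>\<^sup>+s. indicator {s \<in> {0<..<1}. \<lfloor>1 / s\<rfloor> = n} s * F s \<partial>lborel)
      = (\<integral>\<^sup>+s. indicator {?a..?b} s * F s \<partial>lborel)"
  proof (intro nn_integral_cong_AE)
    have "AE s :: real in lborel. s \<noteq> ?a" "AE s :: real in lborel. s \<noteq> 1"
      by (rule AE_lborel_real_neq)+
    then show "AE s in lborel. indicator {s \<in> {0<..<1}. \<lfloor>1 / s\<rfloor> = n} s * F s = indicator {?a..?b} s * F s"
    proof eventually_elim
      fix s :: real assume s: "s \<noteq> ?a" "s \<noteq> 1"
      have pos: "0 < ?a" using n' by simp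
      have b1: "?b \<le> 1" using n' by simp
      have "s \<in> {s \<in> {0<..<1}. \<lfloor>1 / s\<rfloor> = n} \<longleftrightarrow> s \<in> {?a..?b}"
      proof (cases "0 < s")
        case True
        then show ?thesis
          using floor_recip_eq_iff[OF True n] s b1 by auto
      next
        case False
        then have "s < ?a" using pos by linarith
        then show ?thesis using False by auto
      qed
      then show "indicator {s \<in> {0<..<1}. \<lfloor>1 / s\<rfloor> = n} s * F s = indicator {?a..?b} s * F s"
        by (simp only: indicator_def)
    qed
  qed
  \<comment> \<open>The branch is decreasing. Reflecting s to -s leads to the increasing map y ->
    -1/(n + y), whose derivative 1/(n + y)^2 is positive as the substitution rule requires.\<close>
  also have "\<dots> = (\<integral>\<^sup>+x. F (- x) * indicator {- ?b..- ?a} x \<partial>lborel)"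
    by (subst nn_integral_real_affine[where c = "-1" and t = 0])
       (auto intro!: nn_integral_cong simp: indicator_def)
  also have "\<dots> = (\<integral>\<^sup>+y. F (- (- 1 / (of_int n + y))) * ennreal (1 / (of_int n + y)\<^sup>2) * indicator {0..1} y \<partial>lborel)"
  proof -
    have "((\<lambda>y. - 1 / (of_int n + y)) has_real_derivative 1 / (of_int n + y)\<^sup>2) (at y)"
      if "y \<in> {0..1}" for y :: real
      using that n' by (auto intro!: derivative_eq_intros simp: power2_eq_square)
    moreover have "continuous_on {0..1} (\<lambda>y. 1 / (real_of_int n + y)\<^sup>2)"
      using n' by (intro continuous_intros) auto
    ultimately show ?thesis
      using nn_integral_substitution_aux[of "\<lambda>x. F (- x)" 0 1 "\<lambda>y. - 1 / (of_int n + y)" "\<lambda>y. 1 / (of_int n + y)\<^sup>2"]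
      by simp
  qed
  also have "\<dots> = (\<integral>\<^sup>+y. indicator {0..<1} y * ennreal (1 / (of_int n + y)\<^sup>2) * F (1 / (of_int n + y)) \<partial>lborel)"
  proof (intro nn_integral_cong_AE)
    have "AE y :: real in lborel. y \<noteq> 1" by (rule AE_lborel_real_neq)
    then show "AE y in lborel. F (- (- 1 / (of_int n + y))) * ennreal (1 / (of_int n + y)\<^sup>2) * indicator {0..1} y
      = indicator {0..<1} y * ennreal (1 / (of_int n + y)\<^sup>2) * F (1 / (of_int n + y))"
      by eventually_elim (auto simp: indicator_def mult.commute)
  qed
  finally show ?thesis .
qed

section \<open>The Gauss measure\<close>

text \<open>The cutoff to the unit interval is part of the density, so integrals run over the whole
  line and the product over the coordinates already contains the indicator of
  \<open>unit_box\<close>.\<close>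

definition gauss_density :: "real \<Rightarrow> ennreal" where
  "gauss_density t = indicator {0..<1} t * ennreal (1 / (ln 2 * (1 + t)))"

lemma gauss_density_measurable [measurable]: "gauss_density \<in> borel_measurable borel"
  unfolding gauss_density_def[abs_def] by measurable

lemma nn_integral_gauss_density_Icc:
  assumes "0 \<le> p" "p \<le> q" "q \<le> 1"
  shows "(\<integral>\<^sup>+t. gauss_density t * indicator {p..q} t \<partial>lborel) = ennreal ((ln (1 + q) - ln (1 + p)) / ln 2)"
proof -
  have "(\<integral>\<^sup>+t. gauss_density t * indicator {p..q} t \<partial>lborel)
      = (\<integral>\<^sup>+t. ennreal (1 / (ln 2 * (1 + t))) * indicator {p..q} t \<partial>lborel)"
  proof (intro nn_integral_cong_AE)
    have "AE y :: real in lborel. y \<noteq> 1" by (rule AE_lborel_real_neq)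
    then show "AE t in lborel. gauss_density t * indicator {p..q} t = ennreal (1 / (ln 2 * (1 + t))) * indicator {p..q} t"
      by eventually_elim (use assms in \<open>auto simp: gauss_density_def indicator_def\<close>)
  qed
  also have "\<dots> = ennreal (ln (1 + q) / ln 2 - ln (1 + p) / ln 2)"
  proof (rule nn_integral_FTC_Icc)
    show "((\<lambda>t. ln (1 + t) / ln 2) has_real_derivative 1 / (ln 2 * (1 + x))) (at x)"
      if "x \<in> {p..q}" for x
      using that assms by (auto intro!: derivative_eq_intros)
    show "0 \<le> 1 / (ln 2 * (1 + x))" if "x \<in> {p..q}" for x
      using that assms by simp
  qed (use assms in auto)
  finally show ?thesis by (simp add: diff_divide_distrib)
qed

lemma nn_integral_gauss_density: "(\<integral>\<^sup>+t. gauss_density t \<partial>lborel) = 1"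
proof -
  have "(\<integral>\<^sup>+t. gauss_density t \<partial>lborel) = (\<integral>\<^sup>+t. gauss_density t * indicator {0..1} t \<partial>lborel)"
    by (intro nn_integral_cong) (auto simp: gauss_density_def indicator_def)
  then show ?thesis
    using nn_integral_gauss_density_Icc[of 0 1] by simp
qed

text \<open>With m the first digit, the condition reads m <= 1/s <= m + t. The digit is at least 1
  and is written \<open>Suc n\<close>, so that n ranges over all naturals.\<close>

lemma gauss1_le_iff:
  assumes "0 < s" "s \<le> 1" "0 \<le> t" "t < 1"
  shows "gauss1 s \<le> t \<longleftrightarrow> (\<exists>n::nat. s \<in> {1 / (real (Suc n) + t)..1 / real (Suc n)})"
proof
  assume g: "gauss1 s \<le> t"
  have "1 \<le> \<lfloor>1 / s\<rfloor>" using assms by (simp add: le_floor_iff)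
  then obtain n where n: "\<lfloor>1 / s\<rfloor> = int (Suc n)"
    by (metis Suc_pred' nat_0_le nat_int not_one_le_zero int_nat_eq zero_less_nat_eq less_le_trans zero_less_one order_less_imp_le)
  then have "real (Suc n) \<le> 1 / s" by linarith
  moreover have "1 / s \<le> real (Suc n) + t"
    using g n by (simp add: gauss1_def)
  moreover have "0 < real (Suc n) + t" using assms by simp
  ultimately show "\<exists>n::nat. s \<in> {1 / (real (Suc n) + t)..1 / real (Suc n)}"
    using assms by (intro exI[of _ n]) (simp add: field_simps del: of_nat_Suc)
next
  assume "\<exists>n::nat. s \<in> {1 / (real (Suc n) + t)..1 / real (Suc n)}"
  then obtain n :: nat where n: "1 / (real (Suc n) + t) \<le> s" "s \<le> 1 / real (Suc n)" by auto
  have "0 < real (Suc n) + t" using assms by simp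
  then have le: "real (Suc n) \<le> 1 / s" "1 / s \<le> real (Suc n) + t"
    using n assms by (simp_all add: field_simps del: of_nat_Suc)
  then have "\<lfloor>1 / s\<rfloor> = int (Suc n)"
    using assms by (intro floor_unique) auto
  then show "gauss1 s \<le> t"
    using le by (simp add: gauss1_def)
qed

text \<open>With u n = ln (1 + t / (n + 1)), the n-th term is u n - u (n + 1) up to the factor 1 /
  ln 2, and u tends to 0. This telescoping is what makes the density 1/(1 + t) invariant.\<close>

lemma gauss_density_branch_sums:
  assumes "0 \<le> t"
  shows "(\<lambda>n. (ln (1 + 1 / real (Suc n)) - ln (1 + 1 / (real (Suc n) + t))) / ln 2) sums (ln (1 + t) / ln 2)"
proof -
  define u where "u n = ln (1 + t / real (Suc n))" for n
  have "u \<longlonglongrightarrow> ln (1 + 0)"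
    unfolding u_def[abs_def]
    by (intro tendsto_ln tendsto_add tendsto_const LIMSEQ_Suc[OF lim_const_over_n]) auto
  then have "(\<lambda>n. u n - u (Suc n)) sums (u 0 - 0)"
    by (intro telescope_sums') simp
  moreover have "u n - u (Suc n) = ln (1 + 1 / real (Suc n)) - ln (1 + 1 / (real (Suc n) + t))" for n
  proof -
    have pos: "0 < real (Suc n)" "0 < real (Suc n) + t" using assms by auto
    have "1 + t / real (Suc n) = (real (Suc n) + t) / real (Suc n)"
      "1 + t / real (Suc (Suc n)) = (real (Suc n) + 1 + t) / (real (Suc n) + 1)"
      "1 + 1 / real (Suc n) = (real (Suc n) + 1) / real (Suc n)"
      "1 + 1 / (real (Suc n) + t) = (real (Suc n) + 1 + t) / (real (Suc n) + t)"
      using pos by (simp_all add: field_simps)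
    then show ?thesis
      unfolding u_def using pos by (simp add: ln_div del: of_nat_Suc)
  qed
  ultimately have "(\<lambda>n. ln (1 + 1 / real (Suc n)) - ln (1 + 1 / (real (Suc n) + t))) sums ln (1 + t)"
    by (simp add: u_def)
  then show ?thesis by (rule sums_divide)
qed

text \<open>Only 0 <= t < 1 has content, as \<open>gauss1\<close> takes values in [0, 1). There the
  preimage of [0, t] is, up to a null set, a union of intervals, disjoint because t < 1, and their
  masses are the telescoping terms.\<close>

lemma nn_integral_gauss_density_gauss1_le:
  "(\<integral>\<^sup>+s. gauss_density s * indicator {..t} (gauss1 s) \<partial>lborel) = (\<integral>\<^sup>+s. gauss_density s * indicator {..t} s \<partial>lborel)"
proof -
  consider "t < 0" | "1 \<le> t" | "0 \<le> t" "t < 1" by linarith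
  then show ?thesis
  proof cases
    case 1
    then have "\<not> gauss1 s \<le> t" for s using gauss1_range(1)[of s] by linarith
    then show ?thesis
      using 1 by (intro nn_integral_cong) (auto simp: gauss_density_def indicator_def)
  next
    case 2
    have "gauss1 s \<le> t" for s using gauss1_range(2)[of s] 2 by linarith
    then show ?thesis
      using 2 by (intro nn_integral_cong) (auto simp: gauss_density_def indicator_def)
  next
    case 3
    define I where "I n = {1 / (real (Suc n) + t)..1 / real (Suc n)}" for n
    define \<nu> where "\<nu> = density lborel gauss_density"
    have sub: "0 < s \<and> s \<le> 1" if "s \<in> I n" for s n
    proof -
      have "0 < 1 / (real (Suc n) + t)" "1 / real (Suc n) \<le> 1" using 3 by auto
      moreover have "1 / (real (Suc n) + t) \<le> s" "s \<le> 1 / real (Suc n)"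
        using that unfolding I_def by auto
      ultimately show ?thesis by linarith
    qed
    have disj: "disjoint_family I"
    proof -
      have "I m \<inter> I n = {}" if "m < n" for m n
      proof -
        have "1 / real (Suc n) < 1 / (real (Suc m) + t)"
          using 3 that by (intro divide_strict_left_mono) auto
        then show ?thesis by (auto simp: I_def)
      qed
      then show ?thesis
        unfolding disjoint_family_on_def by (metis Int_commute linorder_neqE_nat)
    qed
    have emI: "emeasure \<nu> (I n) = ennreal ((ln (1 + 1 / real (Suc n)) - ln (1 + 1 / (real (Suc n) + t))) / ln 2)" for n
    proof -
      have "emeasure \<nu> (I n) = (\<integral>\<^sup>+s. gauss_density s * indicator (I n) s \<partial>lborel)"
        unfolding \<nu>_def I_def by (intro emeasure_density) auto
      also have "\<dots> = ennreal ((ln (1 + 1 / real (Suc n)) - ln (1 + 1 / (real (Suc n) + t))) / ln 2)"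
        unfolding I_def using 3
        by (intro nn_integral_gauss_density_Icc) (auto intro!: divide_left_mono simp: divide_le_eq)
      finally show ?thesis .
    qed
    have "(\<integral>\<^sup>+s. gauss_density s * indicator {..t} (gauss1 s) \<partial>lborel)
        = (\<integral>\<^sup>+s. gauss_density s * indicator (\<Union>n. I n) s \<partial>lborel)"
    proof (intro nn_integral_cong_AE)
      have "AE s :: real in lborel. s \<noteq> 0" "AE s :: real in lborel. s \<noteq> 1"
        by (rule AE_lborel_real_neq)+
      then show "AE s in lborel. gauss_density s * indicator {..t} (gauss1 s) = gauss_density s * indicator (\<Union>n. I n) s"
      proof eventually_elim
        fix s :: real assume "s \<noteq> 0" "s \<noteq> 1"
        show "gauss_density s * indicator {..t} (gauss1 s) = gauss_density s * indicator (\<Union>n. I n) s"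
        proof (cases "0 < s \<and> s < 1")
          case True
          then have "gauss1 s \<le> t \<longleftrightarrow> s \<in> (\<Union>n. I n)"
            using gauss1_le_iff[of s t] 3 by (auto simp: I_def)
          then show ?thesis by (simp add: indicator_def)
        next
          case False
          then show ?thesis using \<open>s \<noteq> 0\<close> by (auto simp: gauss_density_def indicator_def)
        qed
      qed
    qed
    also have "\<dots> = emeasure \<nu> (\<Union>n. I n)"
      unfolding \<nu>_def by (intro emeasure_density[symmetric]) (auto simp: I_def)
    also have "\<dots> = (\<Sum>n. emeasure \<nu> (I n))"
    proof (rule suminf_emeasure[symmetric, OF _ disj])
      show "range I \<subseteq> sets \<nu>" by (auto simp: \<nu>_def I_def)
    qed
    also have "\<dots> = ennreal (ln (1 + t) / ln 2)"
      unfolding emI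
    proof (rule suminf_ennreal_eq[OF _ gauss_density_branch_sums])
      fix n
      have "1 / (real (Suc n) + t) \<le> 1 / real (Suc n)" using 3 by (intro divide_left_mono) auto
      moreover have "0 < 1 + 1 / (real (Suc n) + t)" using 3 by (intro add_pos_nonneg) auto
      ultimately show "0 \<le> (ln (1 + 1 / real (Suc n)) - ln (1 + 1 / (real (Suc n) + t))) / ln 2"
        by (intro divide_nonneg_pos) auto
    qed (use 3 in auto)
    also have "\<dots> = (\<integral>\<^sup>+s. gauss_density s * indicator {0..t} s \<partial>lborel)"
      using nn_integral_gauss_density_Icc[of 0 t] 3 by simp
    also have "\<dots> = (\<integral>\<^sup>+s. gauss_density s * indicator {..t} s \<partial>lborel)"
      by (intro nn_integral_cong) (auto simp: gauss_density_def indicator_def)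
    finally show ?thesis .
  qed
qed

section \<open>The Gauss measure in all coordinates and its invariance\<close>

lemma unit_box_borel [measurable]: "(unit_box :: (real ^ 'n) set) \<in> sets borel"
  unfolding unit_box_def by measurable

lemma gauss_dom_borel [measurable]: "(gauss_dom :: (real ^ 'n) set) \<in> sets borel"
proof -
  have "(gauss_dom :: (real ^ 'n) set) = unit_box \<inter> {x. \<forall>i. x $ i \<noteq> 0}"
    by (auto simp: gauss_dom_def noninvertible_def)
  moreover have "{x :: real ^ 'n. \<forall>i. x $ i \<noteq> 0} \<in> sets borel" by measurable
  ultimately show ?thesis using unit_box_borel by (metis sets.Int)
qed

lemma gauss1_measurable [measurable]: "gauss1 \<in> borel_measurable borel"
  unfolding gauss1_def[abs_def] by measurable

lemma gauss_map_measurable [measurable]: "(gauss_map :: real ^ 'n \<Rightarrow> _) \<in> borel_measurable borel"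
  by (rule borel_measurable_vecI) (simp add: gauss_map_nth)

lemma gauss_map_funpow_measurable [measurable]:
  "((gauss_map ^^ k) :: real ^ 'n \<Rightarrow> _) \<in> borel_measurable borel"
  by (induction k) (auto simp: id_def intro: measurable_comp)

lemma gauss_map_in_unit_box: "gauss_map x \<in> unit_box"
  by (simp add: unit_box_def gauss_map_nth gauss1_range)

lemma indicator_unit_box: "indicator unit_box (x :: real ^ 'n) = (\<Prod>i\<in>UNIV. indicator {0..<1} (x $ i) :: ennreal)"
  by (subst prod_indicator) (auto simp: unit_box_def indicator_def)

lemma emeasure_unit_box: "emeasure lborel (unit_box :: (real ^ 'n) set) = 1"
proof -
  have "emeasure lborel (unit_box :: (real ^ 'n) set) = (\<integral>\<^sup>+x. indicator unit_box (x :: real ^ 'n) \<partial>lborel)"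
    by simp
  also have "\<dots> = (\<Prod>i\<in>(UNIV :: 'n set). \<integral>\<^sup>+t. indicator {0..<1 :: real} t \<partial>lborel)"
    unfolding indicator_unit_box by (intro nn_integral_lborel_vec_prod) simp
  finally show ?thesis by simp
qed

lemma space_gauss_measure [simp]: "space (gauss_measure :: (real ^ 'n) measure) = unit_box"
  by (simp add: gauss_measure_def space_restrict_space)

lemma sets_gauss_measure_iff:
  "A \<in> sets (gauss_measure :: (real ^ 'n) measure) \<longleftrightarrow> A \<in> sets borel \<and> A \<subseteq> unit_box"
  by (simp add: gauss_measure_def sets_restrict_space_iff conj_commute)

lemma emeasure_gauss_measure:
  assumes "A \<in> sets (gauss_measure :: (real ^ 'n) measure)"
  shows "emeasure gauss_measure A =
    (\<integral>\<^sup>+x. ennreal (1 / (ln 2) ^ CARD('n) * (1 / (\<Prod>i\<in>UNIV. 1 + x $ i))) * indicator A x \<partial>lborel)"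
proof -
  have A: "A \<in> sets (restrict_space lborel unit_box)" "A \<subseteq> unit_box"
    using assms by (auto simp: gauss_measure_def sets_restrict_space_iff)
  have "emeasure gauss_measure A =
    (\<integral>\<^sup>+x. ennreal (1 / (ln 2) ^ CARD('n) * (1 / (\<Prod>i\<in>UNIV. 1 + x $ i))) * indicator A x
      \<partial>(restrict_space lborel unit_box))"
    unfolding gauss_measure_def using A
    by (intro emeasure_density measurable_restrict_space1) auto
  also have "\<dots> = (\<integral>\<^sup>+x. ennreal (1 / (ln 2) ^ CARD('n) * (1 / (\<Prod>i\<in>UNIV. 1 + x $ i))) * indicator A x
      * indicator unit_box x \<partial>lborel)"
    by (intro nn_integral_restrict_space) simp
  also have "\<dots> = (\<integral>\<^sup>+x. ennreal (1 / (ln 2) ^ CARD('n) * (1 / (\<Prod>i\<in>UNIV. 1 + x $ i))) * indicator A x \<partial>lborel)"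
    using A(2) by (intro nn_integral_cong) (auto simp: indicator_def)
  finally show ?thesis .
qed

lemma gauss_density_vec:
  fixes x :: "real ^ 'n"
  assumes "x \<in> unit_box"
  shows "ennreal (1 / (ln 2) ^ CARD('n) * (1 / (\<Prod>i\<in>UNIV. 1 + x $ i))) = (\<Prod>i\<in>UNIV. gauss_density (x $ i))"
proof -
  have "(\<Prod>i\<in>UNIV. gauss_density (x $ i)) = (\<Prod>i\<in>UNIV. ennreal (1 / (ln 2 * (1 + x $ i))))"
    using assms by (intro prod.cong) (auto simp: gauss_density_def unit_box_def)
  also have "\<dots> = ennreal (\<Prod>i\<in>UNIV. 1 / (ln 2 * (1 + x $ i)))"
    using assms by (intro prod_ennreal) (auto simp: unit_box_def)
  also have "(\<Prod>i\<in>UNIV. 1 / (ln 2 * (1 + x $ i))) = 1 / (ln 2) ^ CARD('n) * (1 / (\<Prod>i\<in>UNIV. 1 + x $ i))"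
    by (simp add: prod_dividef prod.distrib)
  finally show ?thesis by simp
qed

lemma emeasure_gauss_measure_prod:
  assumes "A \<in> sets (gauss_measure :: (real ^ 'n) measure)"
  shows "emeasure gauss_measure A = (\<integral>\<^sup>+x. (\<Prod>i\<in>UNIV. gauss_density (x $ i)) * indicator A x \<partial>lborel)"
  unfolding emeasure_gauss_measure[OF assms]
  using assms gauss_density_vec by (intro nn_integral_cong) (auto simp: sets_gauss_measure_iff indicator_def)

lemma prob_space_gauss_measure: "prob_space (gauss_measure :: (real ^ 'n) measure)"
proof
  have "emeasure gauss_measure (unit_box :: (real ^ 'n) set)
      = (\<integral>\<^sup>+x. (\<Prod>i\<in>UNIV. gauss_density (x $ i)) * indicator unit_box (x :: real ^ 'n) \<partial>lborel)"
    by (intro emeasure_gauss_measure_prod) (simp add: sets_gauss_measure_iff)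
  also have "\<dots> = (\<integral>\<^sup>+x. (\<Prod>i\<in>UNIV. gauss_density ((x :: real ^ 'n) $ i)) \<partial>lborel)"
    unfolding indicator_unit_box prod.distrib[symmetric]
    by (intro nn_integral_cong prod.cong) (auto simp: gauss_density_def indicator_def)
  also have "\<dots> = 1"
    by (subst nn_integral_lborel_vec_prod) (simp_all add: nn_integral_gauss_density)
  finally show "emeasure gauss_measure (space (gauss_measure :: (real ^ 'n) measure)) = 1"
    by simp
qed

text \<open>On \<open>{..t}\<close> both sides factor over the coordinates, and each factor is
  handled by the one-dimensional invariance.\<close>

lemma distr_gauss_density:
  "distr (density lborel (\<lambda>x :: real ^ 'n. \<Prod>i\<in>UNIV. gauss_density (x $ i))) borel gauss_map
    = density lborel (\<lambda>x. \<Prod>i\<in>UNIV. gauss_density (x $ i))" (is "?N = ?M")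
proof (rule measure_vec_eqI[symmetric])
  have "emeasure ?M UNIV = (\<integral>\<^sup>+x. (\<Prod>i\<in>UNIV. gauss_density ((x :: real ^ 'n) $ i)) \<partial>lborel)"
    by (subst emeasure_density) auto
  also have "\<dots> = 1"
    by (subst nn_integral_lborel_vec_prod) (simp_all add: nn_integral_gauss_density)
  finally show "emeasure ?M UNIV \<noteq> \<infinity>" by simp
  fix t :: "real ^ 'n"
  have "emeasure ?N {..t} = emeasure ?M (gauss_map -` {..t})"
    by (subst emeasure_distr) auto
  also have "\<dots> = (\<integral>\<^sup>+x. (\<Prod>i\<in>UNIV. gauss_density (x $ i)) * indicator (gauss_map -` {..t}) (x :: real ^ 'n) \<partial>lborel)"
    using measurable_sets[OF gauss_map_measurable, of "{..t}"] by (intro emeasure_density) auto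
  also have "\<dots> = (\<integral>\<^sup>+x. (\<Prod>i\<in>UNIV. gauss_density (x $ i) * indicator {..t $ i} (gauss1 ((x :: real ^ 'n) $ i))) \<partial>lborel)"
    by (intro nn_integral_cong) (simp add: prod.distrib indicator_vimage indicator_atMost_vec gauss_map_nth)
  also have "\<dots> = (\<Prod>i\<in>UNIV. \<integral>\<^sup>+s. gauss_density s * indicator {..t $ i} (gauss1 s) \<partial>lborel)"
    by (intro nn_integral_lborel_vec_prod) measurable
  also have "\<dots> = (\<Prod>i\<in>UNIV. \<integral>\<^sup>+s. gauss_density s * indicator {..t $ i} s \<partial>lborel)"
    by (simp add: nn_integral_gauss_density_gauss1_le)
  also have "\<dots> = (\<integral>\<^sup>+x. (\<Prod>i\<in>UNIV. gauss_density (x $ i) * indicator {..t $ i} ((x :: real ^ 'n) $ i)) \<partial>lborel)"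
    by (intro nn_integral_lborel_vec_prod[symmetric]) measurable
  also have "\<dots> = (\<integral>\<^sup>+x. (\<Prod>i\<in>UNIV. gauss_density (x $ i)) * indicator {..t} (x :: real ^ 'n) \<partial>lborel)"
    by (simp add: prod.distrib indicator_atMost_vec)
  also have "\<dots> = emeasure ?M {..t}"
    by (intro emeasure_density[symmetric]) auto
  finally show "emeasure ?M {..t} = emeasure ?N {..t}" ..
qed auto

lemma gauss_map_measurable_gauss_measure [measurable]:
  "gauss_map \<in> measurable (gauss_measure :: (real ^ 'n) measure) gauss_measure"
proof (rule measurableI)
  fix A assume "A \<in> sets (gauss_measure :: (real ^ 'n) measure)"
  then have "gauss_map -` A \<inter> space borel \<in> sets borel"
    by (intro measurable_sets[OF gauss_map_measurable]) (simp add: sets_gauss_measure_iff)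
  then show "gauss_map -` A \<inter> space (gauss_measure :: (real ^ 'n) measure) \<in> sets gauss_measure"
    by (auto simp: sets_gauss_measure_iff)
qed (simp add: gauss_map_in_unit_box)

lemma emeasure_gauss_map_vimage:
  assumes A: "A \<in> sets (gauss_measure :: (real ^ 'n) measure)"
  shows "emeasure gauss_measure (gauss_map -` A \<inter> space gauss_measure) = emeasure gauss_measure A"
proof -
  let ?M = "density lborel (\<lambda>x :: real ^ 'n. \<Prod>i\<in>UNIV. gauss_density (x $ i))"
  have M: "emeasure gauss_measure B = emeasure ?M B" if "B \<in> sets (gauss_measure :: (real ^ 'n) measure)" for B
    using that by (subst emeasure_gauss_measure_prod[OF that], subst emeasure_density) (auto simp: sets_gauss_measure_iff)
  have V: "gauss_map -` A \<in> sets borel"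
    using A measurable_sets[OF gauss_map_measurable, of A] by (simp add: sets_gauss_measure_iff)
  have "emeasure gauss_measure (gauss_map -` A \<inter> space gauss_measure) = emeasure ?M (gauss_map -` A \<inter> unit_box)"
    using measurable_sets[OF gauss_map_measurable_gauss_measure A] by (subst M) auto
  also have "\<dots> = emeasure ?M (gauss_map -` A)"
  proof -
    have "(\<Prod>i\<in>UNIV. gauss_density (x $ i)) * indicator unit_box x = (\<Prod>i\<in>UNIV. gauss_density (x $ i))" for x :: "real ^ 'n"
      unfolding indicator_unit_box prod.distrib[symmetric]
      by (intro prod.cong) (auto simp: gauss_density_def indicator_def)
    then have "(\<Prod>i\<in>UNIV. gauss_density (x $ i)) * indicator (gauss_map -` A \<inter> unit_box) x
        = (\<Prod>i\<in>UNIV. gauss_density (x $ i)) * indicator (gauss_map -` A) x" for x :: "real ^ 'n"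
      by (metis indicator_inter_arith mult.assoc mult.commute)
    then show ?thesis
      using V by (subst (1 2) emeasure_density) auto
  qed
  also have "\<dots> = emeasure (distr ?M borel gauss_map) A"
    using A by (subst emeasure_distr) (auto simp: sets_gauss_measure_iff)
  also have "\<dots> = emeasure gauss_measure A"
    unfolding distr_gauss_density by (rule M[OF A, symmetric])
  finally show ?thesis .
qed

section \<open>Cylinders and bounded distortion\<close>

text \<open>The Jacobian, taken over all coordinates, of linear fractional maps with denominator u +
  v x and determinant 1 or -1. The pair 1, 0 gives the constant weight 1, and
  \<open>jacobian_weight u 0 0\<close> is the value of the weight u, v at the origin.\<close>

definition jacobian_weight :: "real ^ 'n \<Rightarrow> real ^ 'n \<Rightarrow> real ^ 'n \<Rightarrow> real" where
  "jacobian_weight u v x = (\<Prod>i\<in>UNIV. 1 / (u $ i + v $ i * x $ i)\<^sup>2)"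

lemma jacobian_weight_nonneg: "0 \<le> jacobian_weight u v x"
  unfolding jacobian_weight_def by (intro prod_nonneg) simp

lemma ennreal_jacobian_weight: "ennreal (jacobian_weight u v x) = (\<Prod>i\<in>UNIV. ennreal (1 / (u $ i + v $ i * x $ i)\<^sup>2))"
  unfolding jacobian_weight_def by (intro prod_ennreal[symmetric]) simp

lemma jacobian_weight_measurable [measurable]: "jacobian_weight u v \<in> borel_measurable borel"
  unfolding jacobian_weight_def[abs_def] by measurable

section \<open>Points with a prescribed first digit\<close>

definition first_digit_set :: "int ^ 'n \<Rightarrow> (real ^ 'n) set" where
  "first_digit_set a = {x \<in> gauss_dom. vfloor (vrecip x) = a}"

lemma first_digit_set_eq: "first_digit_set a = {x. \<forall>i. x $ i \<in> {s \<in> {0<..<1}. \<lfloor>1 / s\<rfloor> = a $ i}}"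
  by (auto simp: first_digit_set_def gauss_dom_def unit_box_def noninvertible_def vfloor_def vrecip_def vec_eq_iff
      less_le)

lemma first_digit_set_ge_1: "x \<in> first_digit_set a \<Longrightarrow> 1 \<le> a $ i"
  using floor_recip_ge_1[of "x $ i"] by (auto simp: first_digit_set_eq simp del: one_le_floor dest: spec[of _ i])

lemma indicator_first_digit_set:
  "indicator (first_digit_set a) x = (\<Prod>i\<in>UNIV. indicator {s \<in> {0<..<1}. \<lfloor>1 / s\<rfloor> = a $ i} (x $ i) :: ennreal)"
  by (subst prod_indicator) (auto simp: first_digit_set_eq indicator_def)

lemma first_digit_set_borel [measurable]: "first_digit_set a \<in> sets borel"
  unfolding first_digit_set_eq by measurable

lemma inverse_branch_measurable [measurable]:
  "(\<lambda>y. vrecip (of_int_vec a + y)) \<in> borel_measurable borel"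
  by (rule borel_measurable_vecI) (simp add: vrecip_def)

text \<open>On \<open>{..t}\<close> the integrals split into coordinates and become the
  one-dimensional substitution. Equality of the two measures then gives the change of variables for
  arbitrary nonnegative integrands.\<close>

lemma distr_inverse_branch:
  fixes a :: "int ^ 'n"
  assumes a: "\<And>i. 1 \<le> a $ i"
  shows "density lborel (indicator (first_digit_set a))
    = distr (density lborel (\<lambda>y. indicator unit_box y * ennreal (jacobian_weight (of_int_vec a) 1 y))) borel
        (\<lambda>y. vrecip (of_int_vec a + y))" (is "?M = distr ?L borel ?g")
proof (rule measure_vec_eqI)
  have "emeasure ?M UNIV = emeasure lborel (first_digit_set a)"
    by (subst emeasure_density) auto
  also have "\<dots> \<le> emeasure lborel (unit_box :: (real ^ 'n) set)"
    by (intro emeasure_mono) (auto simp: first_digit_set_def gauss_dom_def)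
  finally show "emeasure ?M UNIV \<noteq> \<infinity>"
    by (metis emeasure_unit_box ennreal_one_less_top infinity_ennreal_def leD)
  fix t :: "real ^ 'n"
  have "emeasure (distr ?L borel ?g) {..t} = emeasure ?L (?g -` {..t})"
    by (subst emeasure_distr) auto
  also have "\<dots> = (\<integral>\<^sup>+y. indicator unit_box y * ennreal (jacobian_weight (of_int_vec a) 1 y) * indicator (?g -` {..t}) y \<partial>lborel)"
    using measurable_sets[OF inverse_branch_measurable, of "{..t}" a] by (intro emeasure_density) auto
  also have "\<dots> = (\<integral>\<^sup>+y. (\<Prod>i\<in>UNIV. indicator {0..<1} (y $ i) * ennreal (1 / (of_int (a $ i) + y $ i)\<^sup>2)
      * indicator {..t $ i} (1 / (of_int (a $ i) + y $ i))) \<partial>lborel)"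
    by (intro nn_integral_cong)
      (simp add: prod.distrib indicator_vimage indicator_atMost_vec indicator_unit_box ennreal_jacobian_weight
        of_int_vec_def vrecip_def)
  also have "\<dots> = (\<Prod>i\<in>UNIV. \<integral>\<^sup>+y. indicator {0..<1} y * ennreal (1 / (of_int (a $ i) + y)\<^sup>2)
      * indicator {..t $ i} (1 / (of_int (a $ i) + y)) \<partial>lborel)"
    by (intro nn_integral_lborel_vec_prod) measurable
  also have "\<dots> = (\<Prod>i\<in>UNIV. \<integral>\<^sup>+s. indicator {s \<in> {0<..<1}. \<lfloor>1 / s\<rfloor> = a $ i} s * indicator {..t $ i} s \<partial>lborel)"
    using a by (intro prod.cong refl nn_integral_gauss1_branch[symmetric]) auto
  also have "\<dots> = (\<integral>\<^sup>+x. (\<Prod>i\<in>UNIV. indicator {s \<in> {0<..<1}. \<lfloor>1 / s\<rfloor> = a $ i} (x $ i) * indicator {..t $ i} (x $ i)) \<partial>lborel)"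
    by (intro nn_integral_lborel_vec_prod[symmetric]) measurable
  also have "\<dots> = (\<integral>\<^sup>+x. indicator (first_digit_set a) x * indicator {..t} x \<partial>lborel)"
    by (simp add: prod.distrib indicator_atMost_vec indicator_first_digit_set)
  also have "\<dots> = emeasure ?M {..t}"
    by (intro emeasure_density[symmetric]) auto
  finally show "emeasure ?M {..t} = emeasure (distr ?L borel ?g) {..t}" ..
qed auto

lemma nn_integral_first_digit_set:
  fixes a :: "int ^ 'n"
  assumes a: "\<And>i. 1 \<le> a $ i" and [measurable]: "F \<in> borel_measurable borel"
  shows "(\<integral>\<^sup>+x. indicator (first_digit_set a) x * F x \<partial>lborel)
    = (\<integral>\<^sup>+y. indicator unit_box y * ennreal (jacobian_weight (of_int_vec a) 1 y) * F (vrecip (of_int_vec a + y)) \<partial>lborel)"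
proof -
  have "(\<integral>\<^sup>+x. indicator (first_digit_set a) x * F x \<partial>lborel)
      = (\<integral>\<^sup>+x. F x \<partial>density lborel (indicator (first_digit_set a)))"
    by (subst nn_integral_density) auto
  also have "\<dots> = (\<integral>\<^sup>+y. F (vrecip (of_int_vec a + y))
      \<partial>density lborel (\<lambda>y. indicator unit_box y * ennreal (jacobian_weight (of_int_vec a) 1 y)))"
    unfolding distr_inverse_branch[OF a] by (subst nn_integral_distr) auto
  also have "\<dots> = (\<integral>\<^sup>+y. indicator unit_box y * ennreal (jacobian_weight (of_int_vec a) 1 y) * F (vrecip (of_int_vec a + y)) \<partial>lborel)"
    by (subst nn_integral_density) auto
  finally show ?thesis .
qed

text \<open>Points whose first digits exist and are \<open>as\<close>: the recursion asks for
  membership in \<open>gauss_dom\<close> at each step. A list with a digit below 1 in some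
  coordinate gives the empty set.\<close>

fun cylinder :: "(int ^ 'n) list \<Rightarrow> (real ^ 'n) set" where
  "cylinder [] = unit_box"
| "cylinder (a # as) = {x \<in> first_digit_set a. gauss_map x \<in> cylinder as}"

lemma cylinder_borel [measurable]: "cylinder as \<in> sets borel"
proof (induction as)
  case (Cons a as)
  have "cylinder (a # as) = first_digit_set a \<inter> gauss_map -` cylinder as" by auto
  then show ?case
    using Cons measurable_sets[OF gauss_map_measurable Cons] by simp
qed simp

lemma cylinder_subset_unit_box: "cylinder as \<subseteq> unit_box"
  by (cases as) (auto simp: first_digit_set_def gauss_dom_def)

lemma cylinder_digits_ge_1:
  assumes "x \<in> cylinder as" "a \<in> set as"
  shows "1 \<le> a $ i"
  using assms
proof (induction as arbitrary: x)
  case (Cons b as)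
  have "1 \<le> b $ i"
    using Cons.prems(1) first_digit_set_ge_1 by auto
  then show ?case using Cons by auto
qed simp

lemma gauss_map_inverse_branch:
  fixes a :: "int ^ 'n"
  assumes a: "\<And>i. 1 \<le> a $ i" and y: "y \<in> unit_box"
  shows "gauss_map (vrecip (of_int_vec a + y)) = y"
proof -
  have "gauss1 (1 / (of_int (a $ i) + y $ i)) = y $ i" for i
  proof -
    have "0 \<le> y $ i" "y $ i < 1" using y by (auto simp: unit_box_def)
    then have "frac (of_int (a $ i) + y $ i) = y $ i"
      by (simp add: frac_unique_iff)
    then show ?thesis by (simp add: gauss1_eq_frac)
  qed
  then show ?thesis
    by (simp add: vec_eq_iff gauss_map_nth vrecip_def of_int_vec_def)
qed

text \<open>The chain rule: the pair (u, v) becomes (u a + v, u), which is the recursion of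
  continued fraction denominators.\<close>

lemma jacobian_weight_inverse_branch:
  fixes a :: "int ^ 'n"
  assumes a: "\<And>i. 1 \<le> a $ i" and y: "y \<in> unit_box"
  shows "jacobian_weight (of_int_vec a) 1 y * jacobian_weight u v (vrecip (of_int_vec a + y))
    = jacobian_weight (u * of_int_vec a + v) u y"
proof -
  have "1 / (of_int (a $ i) + y $ i)\<^sup>2 * (1 / (u $ i + v $ i * (1 / (of_int (a $ i) + y $ i)))\<^sup>2)
      = 1 / (u $ i * of_int (a $ i) + v $ i + u $ i * y $ i)\<^sup>2" for i
  proof -
    have "1 \<le> real_of_int (a $ i)" using a by simp
    then have "0 < real_of_int (a $ i) + y $ i"
      using y by (intro add_pos_nonneg) (auto simp: unit_box_def)
    moreover have "z * (p + r * (1 / z)) = p * z + r" if "0 < z" for z p r :: real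
      using that by (simp add: distrib_left)
    ultimately have "(of_int (a $ i) + y $ i) * (u $ i + v $ i * (1 / (of_int (a $ i) + y $ i)))
        = u $ i * (of_int (a $ i) + y $ i) + v $ i"
      by blast
    also have "\<dots> = u $ i * of_int (a $ i) + v $ i + u $ i * y $ i"
      by algebra
    finally have "(of_int (a $ i) + y $ i) * (u $ i + v $ i * (1 / (of_int (a $ i) + y $ i)))
        = u $ i * of_int (a $ i) + v $ i + u $ i * y $ i" .
    then show ?thesis
      by (simp add: power_mult_distrib[symmetric])
  qed
  then show ?thesis
    by (simp add: jacobian_weight_def prod.distrib[symmetric] of_int_vec_def vrecip_def)
qed

text \<open>
  In each coordinate the inverse of the \<open>k\<close>-th iterate on a cylinder of rank \<open>k\<close> is a linear
  fractional map with denominator \<open>u' + v' y\<close>. Since \<open>0 \<le> v' \<le> u'\<close>, its Jacobian varies on the box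
  by a factor of at most 4 per coordinate, uniformly in the cylinder.
\<close>

lemma nn_integral_cylinder:
  fixes as :: "(int ^ 'n) list"
  assumes "\<And>a i. a \<in> set as \<Longrightarrow> 1 \<le> a $ i" "\<And>i. 0 < u $ i" "\<And>i. 0 \<le> v $ i" "\<And>i. v $ i \<le> u $ i"
  shows "\<exists>u' v'. (\<forall>i. 0 < u' $ i \<and> 0 \<le> v' $ i \<and> v' $ i \<le> u' $ i) \<and>
    (\<forall>F\<in>borel_measurable borel.
      (\<integral>\<^sup>+x. indicator (cylinder as) x * F ((gauss_map ^^ length as) x) * ennreal (jacobian_weight u v x) \<partial>lborel)
      = (\<integral>\<^sup>+y. indicator unit_box y * F y * ennreal (jacobian_weight u' v' y) \<partial>lborel))"
  using assms
proof (induction as arbitrary: u v)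
  case Nil
  then show ?case by (intro exI[of _ u] exI[of _ v]) simp
next
  case (Cons a as)
  have a: "1 \<le> a $ i" for i using Cons.prems(1) by simp
  have "\<exists>u' v'. (\<forall>i. 0 < u' $ i \<and> 0 \<le> v' $ i \<and> v' $ i \<le> u' $ i) \<and>
    (\<forall>F\<in>borel_measurable borel.
      (\<integral>\<^sup>+x. indicator (cylinder as) x * F ((gauss_map ^^ length as) x) * ennreal (jacobian_weight (u * of_int_vec a + v) u x) \<partial>lborel)
      = (\<integral>\<^sup>+y. indicator unit_box y * F y * ennreal (jacobian_weight u' v' y) \<partial>lborel))"
  \<comment> \<open>Peeling off the first digit moves its Jacobian into the weight, hence the
    induction over general weights. The new pair satisfies 0 <= u <= u a + v because a >= 1.\<close>
  proof (rule Cons.IH)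
    fix i
    have "u $ i * 1 \<le> u $ i * of_int (a $ i)"
      using a[of i] Cons.prems(2)[of i] by (intro mult_left_mono) auto
    then show "0 < (u * of_int_vec a + v) $ i" "u $ i \<le> (u * of_int_vec a + v) $ i"
      unfolding of_int_vec_def vector_add_component vector_mult_component vec_lambda_beta
      using Cons.prems(2)[of i] Cons.prems(3)[of i] by linarith+
    show "0 \<le> u $ i" using Cons.prems(2)[of i] by simp
  qed (use Cons.prems in auto)
  then obtain u' v' where uv': "\<forall>i. 0 < u' $ i \<and> 0 \<le> v' $ i \<and> v' $ i \<le> u' $ i"
    and IH: "\<And>F. F \<in> borel_measurable borel \<Longrightarrow>
      (\<integral>\<^sup>+x. indicator (cylinder as) x * F ((gauss_map ^^ length as) x) * ennreal (jacobian_weight (u * of_int_vec a + v) u x) \<partial>lborel)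
      = (\<integral>\<^sup>+y. indicator unit_box y * F y * ennreal (jacobian_weight u' v' y) \<partial>lborel)"
    by blast
  have "(\<integral>\<^sup>+x. indicator (cylinder (a # as)) x * F ((gauss_map ^^ length (a # as)) x) * ennreal (jacobian_weight u v x) \<partial>lborel)
      = (\<integral>\<^sup>+y. indicator unit_box y * F y * ennreal (jacobian_weight u' v' y) \<partial>lborel)"
    if [measurable]: "F \<in> borel_measurable borel" for F
  proof -
    let ?H = "\<lambda>x. indicator (cylinder as) (gauss_map x) * F ((gauss_map ^^ length as) (gauss_map x)) * ennreal (jacobian_weight u v x)"
    let ?g = "\<lambda>y. vrecip (of_int_vec a + y)"
    have "(\<integral>\<^sup>+x. indicator (cylinder (a # as)) x * F ((gauss_map ^^ length (a # as)) x) * ennreal (jacobian_weight u v x) \<partial>lborel)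
        = (\<integral>\<^sup>+x. indicator (first_digit_set a) x * ?H x \<partial>lborel)"
      by (intro nn_integral_cong) (auto simp: indicator_def funpow_swap1)
    also have "\<dots> = (\<integral>\<^sup>+y. indicator unit_box y * ennreal (jacobian_weight (of_int_vec a) 1 y) * ?H (?g y) \<partial>lborel)"
      by (intro nn_integral_first_digit_set a) measurable
    also have "\<dots> = (\<integral>\<^sup>+x. indicator (cylinder as) x * F ((gauss_map ^^ length as) x) * ennreal (jacobian_weight (u * of_int_vec a + v) u x) \<partial>lborel)"
    proof (intro nn_integral_cong)
      fix y :: "real ^ 'n"
      show "indicator unit_box y * ennreal (jacobian_weight (of_int_vec a) 1 y) * ?H (?g y)
        = indicator (cylinder as) y * F ((gauss_map ^^ length as) y) * ennreal (jacobian_weight (u * of_int_vec a + v) u y)"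
      proof (cases "y \<in> unit_box")
        case True
        have "ennreal (jacobian_weight (u * of_int_vec a + v) u y)
            = ennreal (jacobian_weight (of_int_vec a) 1 y) * ennreal (jacobian_weight u v (?g y))"
          unfolding jacobian_weight_inverse_branch[OF a True, symmetric]
          by (intro ennreal_mult jacobian_weight_nonneg)
        then show ?thesis
          using True by (simp add: gauss_map_inverse_branch[OF a True] mult_ac)
      next
        case False
        then show ?thesis using cylinder_subset_unit_box by (auto simp: indicator_def)
      qed
    qed
    also have "\<dots> = (\<integral>\<^sup>+y. indicator unit_box y * F y * ennreal (jacobian_weight u' v' y) \<partial>lborel)"
      by (rule IH) measurable
    finally show ?thesis .
  qed
  with uv' show ?case by blast
qed

text \<open>The denominator u + v y lies between u and 2 u; squaring gives the factor 4 per
  coordinate.\<close>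

lemma jacobian_weight_bounds:
  fixes u v y :: "real ^ 'n"
  assumes uv: "\<And>i. 0 < u $ i \<and> 0 \<le> v $ i \<and> v $ i \<le> u $ i" and y: "y \<in> unit_box"
  shows "jacobian_weight u v y \<le> jacobian_weight u 0 0" "jacobian_weight u 0 0 \<le> 4 ^ CARD('n) * jacobian_weight u v y"
proof -
  have y': "0 \<le> y $ i" "y $ i \<le> 1" for i using y by (auto simp: unit_box_def less_imp_le)
  have le: "u $ i \<le> u $ i + v $ i * y $ i" for i
    using uv[of i] y'[of i] by simp
  have ge: "u $ i + v $ i * y $ i \<le> 2 * u $ i" for i
    using uv[of i] y'[of i] mult_mono[of "v $ i" "u $ i" "y $ i" 1] by simp
  show "jacobian_weight u v y \<le> jacobian_weight u 0 0"
    unfolding jacobian_weight_def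
  proof (intro prod_mono conjI)
    fix i
    show "1 / (u $ i + v $ i * y $ i)\<^sup>2 \<le> 1 / (u $ i + (0 :: real ^ 'n) $ i * (0 :: real ^ 'n) $ i)\<^sup>2"
      using le[of i] uv[of i] by (intro divide_left_mono) (auto intro!: power_mono mult_pos_pos zero_less_power)
  qed simp
  have "jacobian_weight u 0 0 \<le> (\<Prod>i\<in>UNIV. 4 * (1 / (u $ i + v $ i * y $ i)\<^sup>2))"
    unfolding jacobian_weight_def
  proof (intro prod_mono conjI)
    fix i
    have "(u $ i + v $ i * y $ i)\<^sup>2 \<le> (2 * u $ i)\<^sup>2"
      using ge[of i] le[of i] uv[of i] by (intro power_mono) auto
    moreover have "0 < u $ i + v $ i * y $ i" using le[of i] uv[of i] by linarith
    ultimately have "4 / (2 * u $ i)\<^sup>2 \<le> 4 / (u $ i + v $ i * y $ i)\<^sup>2"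
      using uv[of i] by (intro divide_left_mono) (auto intro!: mult_pos_pos zero_less_power)
    then show "1 / (u $ i + (0 :: real ^ 'n) $ i * (0 :: real ^ 'n) $ i)\<^sup>2 \<le> 4 * (1 / (u $ i + v $ i * y $ i)\<^sup>2)"
      by (simp add: power_mult_distrib)
  qed simp
  then show "jacobian_weight u 0 0 \<le> 4 ^ CARD('n) * jacobian_weight u v y"
    by (simp only: prod.distrib prod_constant jacobian_weight_def)
qed

text \<open>The iterate pushes Lebesgue measure on the cylinder to a density on the box between q /
  4^d and q. So the cylinder has measure at most q, while the part of it that lands in
  \<open>B\<close> has measure at least q |B| / 4^d.\<close>

lemma cylinder_distortion:
  fixes as :: "(int ^ 'n) list"
  assumes B: "B \<in> sets borel" "B \<subseteq> unit_box"
  shows "emeasure lborel (cylinder as) * emeasure lborel B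
    \<le> 4 ^ CARD('n) * emeasure lborel (cylinder as \<inter> (gauss_map ^^ length as) -` B)"
proof (cases "cylinder as = {}")
  case True
  then show ?thesis by simp
next
  case False
  then have as: "\<And>a i. a \<in> set as \<Longrightarrow> 1 \<le> a $ i"
    using cylinder_digits_ge_1 by blast
  obtain u v :: "real ^ 'n" where uv: "\<forall>i. 0 < u $ i \<and> 0 \<le> v $ i \<and> v $ i \<le> u $ i"
    and int: "\<And>F. F \<in> borel_measurable borel \<Longrightarrow>
      (\<integral>\<^sup>+x. indicator (cylinder as) x * F ((gauss_map ^^ length as) x) * ennreal (jacobian_weight 1 0 x) \<partial>lborel)
      = (\<integral>\<^sup>+y. indicator unit_box y * F y * ennreal (jacobian_weight u v y) \<partial>lborel)"
    using nn_integral_cylinder[of as 1 0, OF as] by auto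
  \<comment> \<open>The initial weight 1, 0 stands for Lebesgue measure itself.\<close>
  have w1: "jacobian_weight 1 0 x = 1" for x :: "real ^ 'n"
    by (simp add: jacobian_weight_def)
  have eq: "emeasure lborel (cylinder as \<inter> (gauss_map ^^ length as) -` C)
      = (\<integral>\<^sup>+y. indicator unit_box y * indicator C y * ennreal (jacobian_weight u v y) \<partial>lborel)"
    if C[measurable]: "C \<in> sets borel" for C
  proof -
    have "(gauss_map ^^ length as) -` C \<in> sets borel"
      using measurable_sets[OF gauss_map_funpow_measurable C] by simp
    then have "emeasure lborel (cylinder as \<inter> (gauss_map ^^ length as) -` C)
        = (\<integral>\<^sup>+x. indicator (cylinder as \<inter> (gauss_map ^^ length as) -` C) x \<partial>lborel)"
      by (intro nn_integral_indicator[symmetric]) simp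
    also have "\<dots> = (\<integral>\<^sup>+x. indicator (cylinder as) x * indicator C ((gauss_map ^^ length as) x) * ennreal (jacobian_weight 1 0 x) \<partial>lborel)"
      by (intro nn_integral_cong) (auto simp: w1 indicator_def)
    also have "\<dots> = (\<integral>\<^sup>+y. indicator unit_box y * indicator C y * ennreal (jacobian_weight u v y) \<partial>lborel)"
      by (rule int) measurable
    finally show ?thesis .
  qed
  define q where "q = ennreal (jacobian_weight u 0 0)"
  have up: "ennreal (jacobian_weight u v y) \<le> q" if "y \<in> unit_box" for y
    unfolding q_def using jacobian_weight_bounds(1)[OF _ that, of u v] uv by (intro ennreal_leI) blast
  have lo: "q \<le> 4 ^ CARD('n) * ennreal (jacobian_weight u v y)" if "y \<in> unit_box" for y
  proof -
    have "q \<le> ennreal (4 ^ CARD('n) * jacobian_weight u v y)"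
      unfolding q_def using jacobian_weight_bounds(2)[OF _ that, of u v] uv by (intro ennreal_leI) blast
    also have "\<dots> = 4 ^ CARD('n) * ennreal (jacobian_weight u v y)"
      by (simp add: ennreal_mult jacobian_weight_nonneg ennreal_power[symmetric])
    finally show ?thesis .
  qed
  have "emeasure lborel (cylinder as) = (\<integral>\<^sup>+y. indicator unit_box y * indicator UNIV y * ennreal (jacobian_weight u v y) \<partial>lborel)"
    using eq[of UNIV] by simp
  also have "\<dots> \<le> (\<integral>\<^sup>+y. q * indicator unit_box (y :: real ^ 'n) \<partial>lborel)"
    using up by (intro nn_integral_mono) (auto simp: indicator_def)
  also have "\<dots> = q"
    by (subst nn_integral_cmult_indicator) (auto simp: emeasure_unit_box)
  finally have "emeasure lborel (cylinder as) * emeasure lborel B \<le> q * emeasure lborel B"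
    by (intro mult_right_mono) auto
  also have "\<dots> = (\<integral>\<^sup>+y. q * indicator B y \<partial>lborel)"
    using B by (subst nn_integral_cmult_indicator) auto
  also have "\<dots> \<le> (\<integral>\<^sup>+y. 4 ^ CARD('n) * (indicator unit_box y * indicator B y * ennreal (jacobian_weight u v y)) \<partial>lborel)"
    using lo B(2) by (intro nn_integral_mono) (auto simp: indicator_def)
  also have "\<dots> = 4 ^ CARD('n) * (\<integral>\<^sup>+y. indicator unit_box y * indicator B y * ennreal (jacobian_weight u v y) \<partial>lborel)"
  proof -
    note [measurable] = B(1)
    show ?thesis by (intro nn_integral_cmult) measurable
  qed
  also have "\<dots> = 4 ^ CARD('n) * emeasure lborel (cylinder as \<inter> (gauss_map ^^ length as) -` B)"
    using eq[OF B(1)] by simp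
  finally show ?thesis .
qed

section \<open>Size, covering and disjointness of cylinders\<close>

lemma cylinder_nth:
  assumes "x \<in> cylinder as"
  shows "x $ i = cf_branch (map (\<lambda>a. a $ i) as) ((gauss_map ^^ length as) x $ i)"
  using assms
proof (induction as arbitrary: x)
  case (Cons a as)
  have x: "x \<in> first_digit_set a" "gauss_map x \<in> cylinder as" using Cons.prems by auto
  have "x $ i = 1 / (of_int (a $ i) + gauss1 (x $ i))"
  proof -
    have "x $ i \<noteq> 0" "\<lfloor>1 / x $ i\<rfloor> = a $ i"
      using x(1) by (auto simp: first_digit_set_eq dest: spec[of _ i])
    then show ?thesis using recip_floor_add_gauss1[of "x $ i"] by metis
  qed
  moreover have "gauss1 (x $ i) = cf_branch (map (\<lambda>a. a $ i) as) ((gauss_map ^^ length as) (gauss_map x) $ i)"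
    using Cons.IH[OF x(2)] by (simp add: gauss_map_nth)
  ultimately show ?case by (simp add: funpow_swap1)
qed simp

lemma gauss_map_funpow_in_unit_box: "x \<in> unit_box \<Longrightarrow> (gauss_map ^^ k) x \<in> unit_box"
  by (cases k) (auto simp: gauss_map_in_unit_box)

text \<open>In each coordinate the two points are the same branch at two tails. The norm is at most
  the sum of the absolute values of the coordinates, whence the factor
  \<open>CARD('n)\<close>.\<close>

lemma cylinder_dist:
  fixes x y :: "real ^ 'n"
  assumes "x \<in> cylinder as" "y \<in> cylinder as"
  shows "dist x y \<le> CARD('n) * (1 / 4) ^ (length as div 2)"
proof -
  have "\<bar>x $ i - y $ i\<bar> \<le> (1 / 4) ^ (length as div 2)" for i
  proof -
    have "(gauss_map ^^ length as) x \<in> unit_box" "(gauss_map ^^ length as) y \<in> unit_box"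
      using assms cylinder_subset_unit_box gauss_map_funpow_in_unit_box by blast+
    then have "0 \<le> (gauss_map ^^ length as) x $ i" "(gauss_map ^^ length as) x $ i \<le> 1"
      "0 \<le> (gauss_map ^^ length as) y $ i" "(gauss_map ^^ length as) y $ i \<le> 1"
      by (auto simp: unit_box_def less_imp_le)
    moreover have "\<forall>a\<in>set (map (\<lambda>a. a $ i) as). 1 \<le> a"
      using cylinder_digits_ge_1[OF assms(1)] by auto
    ultimately have "\<bar>cf_branch (map (\<lambda>a. a $ i) as) ((gauss_map ^^ length as) x $ i)
        - cf_branch (map (\<lambda>a. a $ i) as) ((gauss_map ^^ length as) y $ i)\<bar>
      \<le> (1 / 4) ^ (length (map (\<lambda>a. a $ i) as) div 2)"
      by (intro cf_branch_contraction_le)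
    then show ?thesis
      using cylinder_nth[OF assms(1), of i] cylinder_nth[OF assms(2), of i] by simp
  qed
  then have "(\<Sum>i\<in>UNIV. \<bar>(x - y) $ i\<bar>) \<le> (\<Sum>i\<in>(UNIV :: 'n set). (1 / 4) ^ (length as div 2))"
    by (intro sum_mono) simp
  then show ?thesis
    using norm_le_l1_cart[of "x - y"] by (simp add: dist_norm)
qed

text \<open>Irrationality survives the map, so digits of every order exist. Consequently the
  cylinders of each rank cover the box up to a null set.\<close>

lemma in_cylinder_of_irrational:
  assumes "x \<in> unit_box" "completely_irrational x"
  shows "\<exists>as. length as = k \<and> x \<in> cylinder as"
  using assms
proof (induction k arbitrary: x)
  case (Suc k)
  have irr: "completely_irrational (gauss_map x)"
    using Suc.prems(2) by (simp add: completely_irrational_def gauss_map_nth)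
  then obtain as where as: "length as = k" "gauss_map x \<in> cylinder as"
    using Suc.IH gauss_map_in_unit_box by blast
  have "x \<in> gauss_dom"
    using Suc.prems by (auto simp: gauss_dom_def noninvertible_def completely_irrational_def)
      (metis Rats_0)
  then have "x \<in> cylinder (vfloor (vrecip x) # as)"
    using as by (simp add: first_digit_set_def)
  then show ?case using as(1) by (intro exI[of _ "vfloor (vrecip x) # as"]) simp
qed simp

lemma cylinder_disjoint:
  assumes "length as = length bs" "x \<in> cylinder as" "x \<in> cylinder bs"
  shows "as = bs"
  using assms
proof (induction as bs arbitrary: x rule: list_induct2)
  case (Cons a as b bs)
  then show ?case by (auto simp: first_digit_set_def)
qed simp

section \<open>Passing from Lebesgue measure to the Gauss measure\<close>

lemma cylinder_sets_gauss_measure [measurable]: "cylinder as \<in> sets gauss_measure"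
  using cylinder_subset_unit_box by (simp add: sets_gauss_measure_iff)

lemma AE_gauss_measure_irrational:
  "AE x in (gauss_measure :: (real ^ 'n) measure). completely_irrational x"
proof -
  obtain N :: "(real ^ 'n) set" where N: "N \<in> null_sets lborel" "{x. \<not> completely_irrational x} \<subseteq> N"
    using AE_completely_irrational[where 'n = 'n] unfolding eventually_ae_filter by auto
  have sets: "N \<inter> unit_box \<in> sets (gauss_measure :: (real ^ 'n) measure)"
    using N by (auto simp: sets_gauss_measure_iff)
  have "AE x in lborel. x \<notin> N" using N(1) by (rule AE_not_in)
  then have "emeasure gauss_measure (N \<inter> unit_box) = integral\<^sup>N lborel (\<lambda>x :: real ^ 'n. 0)"
    unfolding emeasure_gauss_measure[OF sets]
    by (intro nn_integral_cong_AE) (elim AE_mp, auto simp: indicator_def)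
  then have "N \<inter> unit_box \<in> null_sets gauss_measure"
    using sets by (intro null_setsI) auto
  then show ?thesis
    by (rule AE_I') (use N in auto)
qed

lemma AE_gauss_dom: "AE x in (gauss_measure :: (real ^ 'n) measure). x \<in> gauss_dom"
  using AE_gauss_measure_irrational
proof (rule AE_mp[OF _ AE_I2], intro impI)
  fix x :: "real ^ 'n" assume "x \<in> space gauss_measure" "completely_irrational x"
  then show "x \<in> gauss_dom"
    by (auto simp: gauss_dom_def noninvertible_def completely_irrational_def) (metis Rats_0)
qed

text \<open>On the box the product of the factors 1 + x_i lies between 1 and 2^d.\<close>

lemma gauss_measure_lborel_bounds:
  assumes A: "A \<in> sets (gauss_measure :: (real ^ 'n) measure)"
  shows "emeasure gauss_measure A \<le> ennreal ((1 / ln 2) ^ CARD('n)) * emeasure lborel A"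
    "ennreal ((1 / (2 * ln 2)) ^ CARD('n)) * emeasure lborel A \<le> emeasure gauss_measure A"
proof -
  have A': "A \<in> sets borel" "A \<subseteq> unit_box" using A by (auto simp: sets_gauss_measure_iff)
  let ?h = "\<lambda>x :: real ^ 'n. 1 / (ln 2) ^ CARD('n) * (1 / (\<Prod>i\<in>UNIV. 1 + x $ i))"
  have h: "?h x \<le> (1 / ln 2) ^ CARD('n)" "(1 / (2 * ln 2)) ^ CARD('n) \<le> ?h x" if "x \<in> A" for x
  proof -
    have x: "0 \<le> x $ i" "x $ i < 1" for i using that A'(2) by (auto simp: unit_box_def)
    have "1 \<le> (\<Prod>i\<in>UNIV. 1 + x $ i)" using x by (intro prod_ge_1) auto
    moreover have "(\<Prod>i\<in>UNIV. 1 + x $ i) \<le> (\<Prod>i\<in>(UNIV :: 'n set). 2)"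
      using x by (intro prod_mono) (auto intro: less_imp_le)
    ultimately have P: "1 \<le> (\<Prod>i\<in>UNIV. 1 + x $ i)" "(\<Prod>i\<in>UNIV. 1 + x $ i) \<le> 2 ^ CARD('n)"
      by auto
    have "1 / (\<Prod>i\<in>UNIV. 1 + x $ i) \<le> 1" using P by simp
    then have "?h x \<le> 1 / (ln 2) ^ CARD('n) * 1" by (intro mult_left_mono) auto
    then show "?h x \<le> (1 / ln 2) ^ CARD('n)" by (simp add: power_one_over)
    have "1 / 2 ^ CARD('n) \<le> 1 / (\<Prod>i\<in>UNIV. 1 + x $ i)"
      using P by (intro divide_left_mono) auto
    then have "1 / (ln 2) ^ CARD('n) * (1 / 2 ^ CARD('n)) \<le> ?h x" by (intro mult_left_mono) auto
    then show "(1 / (2 * ln 2)) ^ CARD('n) \<le> ?h x"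
      by (simp add: power_divide power_mult_distrib mult.commute)
  qed
  have "emeasure gauss_measure A \<le> (\<integral>\<^sup>+x. ennreal ((1 / ln 2) ^ CARD('n)) * indicator A x \<partial>lborel)"
    unfolding emeasure_gauss_measure[OF A] using h(1)
    by (intro nn_integral_mono) (auto simp: indicator_def intro!: ennreal_leI)
  then show "emeasure gauss_measure A \<le> ennreal ((1 / ln 2) ^ CARD('n)) * emeasure lborel A"
    using A'(1) by (simp add: nn_integral_cmult_indicator)
  have "(\<integral>\<^sup>+x. ennreal ((1 / (2 * ln 2)) ^ CARD('n)) * indicator A x \<partial>lborel) \<le> emeasure gauss_measure A"
    unfolding emeasure_gauss_measure[OF A] using h(2)
    by (intro nn_integral_mono) (auto simp: indicator_def intro!: ennreal_leI)
  then show "ennreal ((1 / (2 * ln 2)) ^ CARD('n)) * emeasure lborel A \<le> emeasure gauss_measure A"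
    using A'(1) by (simp add: nn_integral_cmult_indicator)
qed

lemma cylinder_vimage_sets:
  assumes "B \<in> sets (gauss_measure :: (real ^ 'n) measure)"
  shows "cylinder as \<inter> (gauss_map ^^ k) -` B \<in> sets gauss_measure"
proof -
  have "(gauss_map ^^ k) -` B \<in> sets borel"
    using assms measurable_sets[OF gauss_map_funpow_measurable, of B] by (simp add: sets_gauss_measure_iff)
  then show ?thesis
    using cylinder_subset_unit_box by (auto simp: sets_gauss_measure_iff)
qed

lemma gauss_measure_cylinder_mixing:
  fixes as :: "(int ^ 'n) list"
  assumes B: "B \<in> sets (gauss_measure :: (real ^ 'n) measure)"
  shows "ennreal ((ln 2 / 8) ^ CARD('n)) * emeasure gauss_measure B * emeasure gauss_measure (cylinder as)
    \<le> emeasure gauss_measure (cylinder as \<inter> (gauss_map ^^ length as) -` B)"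
proof -
  define c \<alpha> \<beta> :: real where "c = (ln 2 / 8) ^ CARD('n)" and "\<alpha> = (1 / ln 2) ^ CARD('n)"
    and "\<beta> = (1 / (2 * ln 2)) ^ CARD('n)"
  have nn: "0 \<le> c" "0 \<le> \<alpha>" "0 \<le> \<beta>" by (auto simp: c_def \<alpha>_def \<beta>_def)
  \<comment> \<open>Two factors \<alpha> replace the Gauss measures of \<open>B\<close> and of the
    cylinder by Lebesgue measure, 4^d is the distortion, and \<beta> leads back to the Gauss
    measure. The value ln 2 / 8 is chosen to solve this equation.\<close>
  have const: "c * \<alpha> * \<alpha> * 4 ^ CARD('n) = \<beta>"
  proof -
    have "ln 2 / 8 * (1 / ln 2) * (1 / ln 2) * 4 = 1 / (2 * ln (2 :: real))"
      by (simp add: field_simps)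
    then show ?thesis
      unfolding c_def \<alpha>_def \<beta>_def power_mult_distrib[symmetric] by (rule arg_cong)
  qed
  let ?E = "cylinder as \<inter> (gauss_map ^^ length as) -` B"
  have B': "B \<in> sets borel" "B \<subseteq> unit_box" using B by (auto simp: sets_gauss_measure_iff)
  have "ennreal c * emeasure gauss_measure B * emeasure gauss_measure (cylinder as)
      \<le> ennreal c * (ennreal \<alpha> * emeasure lborel B) * (ennreal \<alpha> * emeasure lborel (cylinder as))"
    unfolding \<alpha>_def
    by (intro mult_mono gauss_measure_lborel_bounds B cylinder_sets_gauss_measure order_refl) auto
  also have "\<dots> = ennreal c * ennreal \<alpha> * ennreal \<alpha> * (emeasure lborel (cylinder as) * emeasure lborel B)"
    by (simp add: mult_ac)
  also have "\<dots> \<le> ennreal c * ennreal \<alpha> * ennreal \<alpha> * (4 ^ CARD('n) * emeasure lborel ?E)"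
    by (intro mult_left_mono cylinder_distortion B') auto
  also have "\<dots> = ennreal \<beta> * emeasure lborel ?E"
  proof -
    have "ennreal c * ennreal \<alpha> * ennreal \<alpha> * 4 ^ CARD('n) = ennreal (c * \<alpha> * \<alpha> * 4 ^ CARD('n))"
      using nn by (simp add: ennreal_mult ennreal_power[symmetric])
    then show ?thesis by (simp add: const mult.assoc[symmetric])
  qed
  also have "\<dots> \<le> emeasure gauss_measure ?E"
    unfolding \<beta>_def by (intro gauss_measure_lborel_bounds cylinder_vimage_sets B)
  finally show ?thesis by (simp add: c_def)
qed

text \<open>Cylinders of equal rank are disjoint, so their bounds add up. \<open>S\<close> may be
  infinite because digits are unbounded, but it is countable.\<close>

lemma gauss_measure_cylinder_union_mixing:
  fixes S :: "(int ^ 'n) list set"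
  assumes B: "B \<in> sets (gauss_measure :: (real ^ 'n) measure)" and S: "\<And>as. as \<in> S \<Longrightarrow> length as = k"
  shows "(ln 2 / 8) ^ CARD('n) * measure gauss_measure (\<Union>as\<in>S. cylinder as) * measure gauss_measure B
    \<le> measure gauss_measure ((\<Union>as\<in>S. cylinder as) \<inter> (gauss_map ^^ k) -` B)"
proof -
  interpret prob_space "gauss_measure :: (real ^ 'n) measure" by (rule prob_space_gauss_measure)
  let ?c = "(ln 2 / 8) ^ CARD('n) :: real"
  have c: "0 \<le> ?c" by simp
  have disj: "disjoint_family_on cylinder S"
    unfolding disjoint_family_on_def using cylinder_disjoint S by blast
  have disj': "disjoint_family_on (\<lambda>as. cylinder as \<inter> (gauss_map ^^ k) -` B) S"
    using disj unfolding disjoint_family_on_def by blast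
  have "ennreal ?c * emeasure gauss_measure B * emeasure gauss_measure (\<Union>as\<in>S. cylinder as)
      = ennreal ?c * emeasure gauss_measure B * (\<integral>\<^sup>+as. emeasure gauss_measure (cylinder as) \<partial>count_space S)"
    by (subst emeasure_UN_countable[OF _ _ disj]) auto
  also have "\<dots> = (\<integral>\<^sup>+as. ennreal ?c * emeasure gauss_measure B * emeasure gauss_measure (cylinder as) \<partial>count_space S)"
    by (rule nn_integral_cmult[symmetric]) simp
  also have "\<dots> \<le> (\<integral>\<^sup>+as. emeasure gauss_measure (cylinder as \<inter> (gauss_map ^^ k) -` B) \<partial>count_space S)"
    using gauss_measure_cylinder_mixing[OF B] S by (intro nn_integral_mono) auto
  also have "\<dots> = emeasure gauss_measure (\<Union>as\<in>S. cylinder as \<inter> (gauss_map ^^ k) -` B)"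
    by (subst emeasure_UN_countable[OF _ _ disj']) (auto intro: cylinder_vimage_sets[OF B])
  also have "(\<Union>as\<in>S. cylinder as \<inter> (gauss_map ^^ k) -` B) = (\<Union>as\<in>S. cylinder as) \<inter> (gauss_map ^^ k) -` B"
    by blast
  finally have "ennreal (?c * prob (\<Union>as\<in>S. cylinder as) * prob B)
      \<le> ennreal (prob ((\<Union>as\<in>S. cylinder as) \<inter> (gauss_map ^^ k) -` B))"
    by (simp add: emeasure_eq_measure ennreal_mult[symmetric] c mult_ac)
  then show ?thesis by (subst (asm) ennreal_le_iff) auto
qed

lemma gauss_measure_approx:
  fixes A :: "(real ^ 'n) set"
  assumes A: "A \<in> sets gauss_measure" and "0 < \<epsilon>"
  obtains F U where "compact F" "open U" "F \<subseteq> A" "A \<subseteq> U"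
    "measure gauss_measure (A - F) < \<epsilon>" "measure gauss_measure (U \<inter> unit_box - A) < \<epsilon>"
proof -
  interpret prob_space "gauss_measure :: (real ^ 'n) measure" by (rule prob_space_gauss_measure)
  have A': "A \<in> sets borel" "A \<subseteq> unit_box" using A by (auto simp: sets_gauss_measure_iff)
  \<comment> \<open>The factor absorbs the upper bound (1 / ln 2)^d of the density: Lebesgue measure
    below \<eta> means Gauss measure below \<epsilon>.\<close>
  define \<eta> where "\<eta> = \<epsilon> * (ln 2) ^ CARD('n)"
  have \<eta>: "0 < \<eta>" using \<open>0 < \<epsilon>\<close> by (simp add: \<eta>_def)
  have small: "prob E < \<epsilon>" if E: "E \<in> sets gauss_measure" "emeasure lborel E < ennreal \<eta>" for E :: "(real ^ 'n) set"
  proof -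
    have "ennreal (prob E) \<le> ennreal ((1 / ln 2) ^ CARD('n)) * emeasure lborel E"
      using gauss_measure_lborel_bounds(1)[OF E(1)] by (simp add: emeasure_eq_measure)
    also have "\<dots> < ennreal ((1 / ln 2) ^ CARD('n)) * ennreal \<eta>"
      using E(2) by (intro ennreal_mult_strict_left_mono) auto
    also have "\<dots> = ennreal \<epsilon>"
      using \<eta> by (simp add: \<eta>_def ennreal_mult[symmetric] power_divide)
    finally show ?thesis by (subst (asm) ennreal_less_iff) auto
  qed
  have leb: "A \<in> sets lebesgue" using A'(1) by simp
  obtain F where F: "closed F" "F \<subseteq> A" "emeasure lebesgue (A - F) < ennreal \<eta>"
    using sets_lebesgue_inner_closed[OF leb \<eta>] by metis
  obtain U where U: "open U" "A \<subseteq> U" "emeasure lebesgue (U - A) < ennreal \<eta>"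
    using sets_lebesgue_outer_open[OF leb \<eta>] by metis
  have "bounded (unit_box :: (real ^ 'n) set)"
  proof (rule bounded_subset[OF bounded_cbox])
    show "unit_box \<subseteq> cbox (0 :: real ^ 'n) 1"
      by (auto simp: unit_box_def mem_box_cart less_imp_le)
  qed
  then have "compact F"
    using F A'(2) by (meson bounded_subset compact_eq_bounded_closed)
  moreover have "prob (A - F) < \<epsilon>"
  proof (rule small)
    show "A - F \<in> sets gauss_measure"
      using A' F(1) by (auto simp: sets_gauss_measure_iff)
    show "emeasure lborel (A - F) < ennreal \<eta>"
      using F A'(1) by simp
  qed
  moreover have "prob (U \<inter> unit_box - A) < \<epsilon>"
  proof (rule small)
    have UA: "U - A \<in> sets borel" using U(1) A'(1) by auto
    show "U \<inter> unit_box - A \<in> sets gauss_measure"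
      using A' U(1) by (auto simp: sets_gauss_measure_iff)
    have "emeasure lborel (U \<inter> unit_box - A) \<le> emeasure lborel (U - A)"
      using UA by (intro emeasure_mono) auto
    also have "\<dots> < ennreal \<eta>" using U(3) UA by simp
    finally show "emeasure lborel (U \<inter> unit_box - A) < ennreal \<eta>" .
  qed
  ultimately show ?thesis using that F(2) U(1,2) by blast
qed

text \<open>\<open>F\<close> is compact inside \<open>A\<close> and \<open>U\<close> is open around
  \<open>A\<close>, both close to it in measure. Cylinders of high rank that meet \<open>F\<close>
  stay inside \<open>U\<close>, so their union \<open>V\<close> differs little from
  \<open>A\<close>, and for \<open>V\<close> the lower bound holds without error.\<close>

lemma gauss_measure_doeblin:
  fixes A :: "(real ^ 'n) set"
  assumes A: "A \<in> sets gauss_measure" and "0 < \<epsilon>"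
  shows "\<exists>K. \<forall>k\<ge>K. \<forall>B\<in>sets gauss_measure. (ln 2 / 8) ^ CARD('n) * measure gauss_measure A * measure gauss_measure B - \<epsilon>
    \<le> measure gauss_measure (A \<inter> (gauss_map ^^ k) -` B)"
proof -
  interpret prob_space "gauss_measure :: (real ^ 'n) measure" by (rule prob_space_gauss_measure)
  define c :: real where "c = (ln 2 / 8) ^ CARD('n)"
  have c: "0 \<le> c" "c \<le> 1"
    unfolding c_def using ln_2_less_1 by (auto intro!: power_le_one)
  have "0 < \<epsilon> / 2" using \<open>0 < \<epsilon>\<close> by simp
  then obtain F U where F: "compact F" "F \<subseteq> A" "prob (A - F) < \<epsilon> / 2"
    and U: "open U" "A \<subseteq> U" "prob (U \<inter> unit_box - A) < \<epsilon> / 2"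
    using gauss_measure_approx[OF A] by metis
  have A': "A \<in> sets borel" "A \<subseteq> unit_box" using A by (auto simp: sets_gauss_measure_iff)
  have cl: "closed (- U)" "F \<inter> - U = {}" using F U by auto
  obtain \<delta> where \<delta>: "0 < \<delta>" "\<And>x y. x \<in> F \<Longrightarrow> y \<notin> U \<Longrightarrow> \<delta> \<le> dist x y"
    using separate_compact_closed[OF F(1) cl] by auto
  have "(\<lambda>m. real CARD('n) * (1 / 4) ^ m) \<longlonglongrightarrow> 0"
    by (intro tendsto_mult_right_zero LIMSEQ_power_zero) simp
  then have "\<forall>\<^sub>F m in sequentially. real CARD('n) * (1 / 4) ^ m < \<delta>"
    using \<delta>(1) by (intro order_tendstoD)
  \<comment> \<open>The distance \<delta> between \<open>F\<close> and the complement of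
    \<open>U\<close> exceeds the diameter of every cylinder of rank at least 2 m; the rank enters
    halved because the contraction takes two digits.\<close>
  then obtain m where m: "\<And>j. m \<le> j \<Longrightarrow> real CARD('n) * (1 / 4) ^ j < \<delta>"
    by (auto simp: eventually_sequentially)
  have "c * prob A * prob B - \<epsilon> \<le> prob (A \<inter> (gauss_map ^^ k) -` B)"
    if k: "2 * m \<le> k" and B: "B \<in> sets gauss_measure" for k B
  proof -
    define S where "S = {as :: (int ^ 'n) list. length as = k \<and> cylinder as \<inter> F \<noteq> {}}"
    define V where "V = (\<Union>as\<in>S. cylinder as)"
    have V: "V \<in> sets gauss_measure"
      unfolding V_def by (intro sets.countable_UN') auto
    have TB: "(gauss_map ^^ k) -` B \<in> sets borel"
      using B measurable_sets[OF gauss_map_funpow_measurable, of B k] by (simp add: sets_gauss_measure_iff)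
    have VB: "E \<inter> (gauss_map ^^ k) -` B \<in> sets gauss_measure" if "E \<in> sets gauss_measure" for E
      using TB that by (auto simp: sets_gauss_measure_iff)
    have "V \<subseteq> U"
    proof
      fix y assume "y \<in> V"
      then obtain as x where as: "length as = k" "y \<in> cylinder as" "x \<in> cylinder as" "x \<in> F"
        by (auto simp: V_def S_def)
      have "dist x y \<le> real CARD('n) * (1 / 4) ^ (length as div 2)"
        by (rule cylinder_dist[OF as(3,2)])
      also have "\<dots> < \<delta>" using k as(1) by (intro m) auto
      finally show "y \<in> U" using \<delta>(2)[OF as(4)] by force
    qed
    then have VA: "prob (V - A) \<le> prob (U \<inter> unit_box - A)"
      using V A U(1) by (intro finite_measure_mono) (auto simp: sets_gauss_measure_iff)
    \<comment> \<open>A point of \<open>F\<close> that lies in no cylinder of rank k has a rational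
      coordinate, so \<open>V\<close> covers \<open>F\<close> up to a null set.\<close>
    have "prob F \<le> prob V"
    proof (rule finite_measure_mono_AE)
      show "AE x in gauss_measure. x \<in> F \<longrightarrow> x \<in> V"
        using AE_gauss_measure_irrational
      proof (rule AE_mp[OF _ AE_I2], intro impI)
        fix x :: "real ^ 'n" assume "x \<in> space gauss_measure" "completely_irrational x" "x \<in> F"
        then show "x \<in> V"
          using in_cylinder_of_irrational[of x k] by (auto simp: V_def S_def)
      qed
    qed (rule V)
    moreover have "prob (A - F) = prob A - prob F"
      using A F A' by (intro finite_measure_Diff) (auto simp: sets_gauss_measure_iff compact_imp_closed)
    ultimately have AV: "prob A - \<epsilon> / 2 \<le> prob V" using F(3) by simp
    have "prob (V \<inter> (gauss_map ^^ k) -` B) \<le> prob ((A \<inter> (gauss_map ^^ k) -` B) \<union> (V - A))"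
      using V A VB[OF A] by (intro finite_measure_mono) auto
    also have "\<dots> \<le> prob (A \<inter> (gauss_map ^^ k) -` B) + prob (V - A)"
      using V A VB[OF A] by (intro measure_Un_le) auto
    finally have "prob (V \<inter> (gauss_map ^^ k) -` B) \<le> prob (A \<inter> (gauss_map ^^ k) -` B) + \<epsilon> / 2"
      using VA U(3) by simp
    moreover have "c * prob V * prob B \<le> prob (V \<inter> (gauss_map ^^ k) -` B)"
      unfolding V_def c_def by (rule gauss_measure_cylinder_union_mixing[OF B]) (simp add: S_def)
    moreover have "c * prob A * prob B - \<epsilon> / 2 \<le> c * prob V * prob B"
    proof -
      have cB: "0 \<le> c * prob B" "c * prob B \<le> 1"
        using c mult_mono[of c 1 "prob B" 1] by auto
      have "c * prob B * (prob A - \<epsilon> / 2) \<le> c * prob B * prob V"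
        using AV cB by (intro mult_left_mono)
      moreover have "c * prob B * (\<epsilon> / 2) \<le> 1 * (\<epsilon> / 2)"
        using cB \<open>0 < \<epsilon>\<close> by (intro mult_right_mono) auto
      ultimately show ?thesis by (simp add: algebra_simps)
    qed
    ultimately show ?thesis by simp
  qed
  then show ?thesis unfolding c_def by blast
qed

text \<open>The image is a countable union, over all digits, of preimages of \<open>A\<close> under
  inverse branches restricted to the box, and is therefore Borel. Exactness needs this for its
  images.\<close>

lemma gauss_map_image_sets:
  assumes A: "A \<in> sets (gauss_measure :: (real ^ 'n) measure)"
  shows "gauss_map ` (A \<inter> gauss_dom) \<in> sets gauss_measure"
proof -
  let ?g = "\<lambda>a y. vrecip (of_int_vec a + y) :: real ^ 'n"
  define I where "I = {a :: int ^ 'n. \<forall>i. 1 \<le> a $ i}"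
  have "gauss_map ` (A \<inter> gauss_dom) = (\<Union>a\<in>I. {y \<in> unit_box. ?g a y \<in> A \<inter> gauss_dom})"
  proof (intro equalityI subsetI)
    fix y assume "y \<in> gauss_map ` (A \<inter> gauss_dom)"
    then obtain x where x: "x \<in> A" "x \<in> gauss_dom" and y: "y = gauss_map x" by auto
    have "x \<in> first_digit_set (vfloor (vrecip x))" using x by (simp add: first_digit_set_def)
    then have "vfloor (vrecip x) \<in> I"
      using first_digit_set_ge_1 by (auto simp: I_def)
    moreover have "?g (vfloor (vrecip x)) y = x"
      unfolding y gauss_map_def by (simp add: vrecip_vrecip)
    ultimately show "y \<in> (\<Union>a\<in>I. {y \<in> unit_box. ?g a y \<in> A \<inter> gauss_dom})"
      using x gauss_map_in_unit_box[of x] y by (intro UN_I) auto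
  next
    fix y assume "y \<in> (\<Union>a\<in>I. {y \<in> unit_box. ?g a y \<in> A \<inter> gauss_dom})"
    then obtain a where "a \<in> I" "y \<in> unit_box" "?g a y \<in> A \<inter> gauss_dom" by blast
    then show "y \<in> gauss_map ` (A \<inter> gauss_dom)"
      using gauss_map_inverse_branch[of a y] by (intro image_eqI[of _ _ "?g a y"]) (auto simp: I_def)
  qed
  moreover have "{y \<in> unit_box. ?g a y \<in> A \<inter> gauss_dom} \<in> sets borel" for a
  proof -
    have "A \<inter> gauss_dom \<in> sets borel" using A by (auto simp: sets_gauss_measure_iff)
    then have "?g a -` (A \<inter> gauss_dom) \<in> sets borel"
      using measurable_sets[OF inverse_branch_measurable] by (metis Int_UNIV_right space_borel)
    then have "unit_box \<inter> ?g a -` (A \<inter> gauss_dom) \<in> sets borel" by auto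
    also have "unit_box \<inter> ?g a -` (A \<inter> gauss_dom) = {y \<in> unit_box. ?g a y \<in> A \<inter> gauss_dom}" by auto
    finally show ?thesis .
  qed
  ultimately have "gauss_map ` (A \<inter> gauss_dom) \<in> sets borel"
    by (simp add: sets.countable_UN')
  then show ?thesis
    using gauss_map_in_unit_box by (auto simp: sets_gauss_measure_iff)
qed

lemma partial_doeblin_system_gauss:
  "partial_doeblin_system (gauss_measure :: (real ^ 'n) measure) gauss_map ((ln 2 / 8) ^ CARD('n)) gauss_dom"
proof -
  interpret prob_space "gauss_measure :: (real ^ 'n) measure" by (rule prob_space_gauss_measure)
  show ?thesis
  proof
    show "(ln 2 / 8) ^ CARD('n) \<le> (1 :: real)"
      using ln_2_less_1 by (intro power_le_one) auto
    show "(gauss_dom :: (real ^ 'n) set) \<in> sets gauss_measure"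
      unfolding sets_gauss_measure_iff by (auto simp: gauss_dom_borel) (simp add: gauss_dom_def)
  qed (auto simp: emeasure_gauss_map_vimage[simplified] AE_gauss_dom intro!: gauss_measure_doeblin)
qed

theorem theorem2:
  shows
    \<comment> \<open>(a)\<close>
    "(\<forall>x :: real ^ 'n. finite_expansion x \<longleftrightarrow>
        (\<forall>i. x $ i \<in> \<rat>) \<and>
        (\<forall>i j. num_digits (vec (x $ i) :: real ^ 1) = num_digits (vec (x $ j) :: real ^ 1)))
     \<and> \<comment> \<open>(b)\<close>
     (\<forall>x :: real ^ 'n. infinite_expansion x \<longleftrightarrow> completely_irrational x) \<and>
     (AE x :: real ^ 'n in lborel. infinite_expansion x)
     \<and> \<comment> \<open>(c)\<close>
     (\<forall>x :: real ^ 'n. eventually_repeating x \<longleftrightarrow>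
        (\<exists>a b c. nondegenerate_quadratic a b c \<and>
           of_int_vec a * x ^ 2 + of_int_vec b * x + of_int_vec c = 0))
     \<and> \<comment> \<open>(d)\<close>
     (\<forall>x :: real ^ 'n. x \<in> unit_box \<and> completely_irrational x \<longrightarrow>
        (\<lambda>n. cf_convergent x n) \<longlonglongrightarrow> x)
     \<and> \<comment> \<open>(e)\<close>
     prob_space (gauss_measure :: (real ^ 'n) measure) \<and>
     leaves_invariant gauss_dom gauss_map (gauss_measure :: (real ^ 'n) measure)
     \<and> \<comment> \<open>(f)\<close>
     exact gauss_dom gauss_map (gauss_measure :: (real ^ 'n) measure) \<and>
     mixing_of_all_orders gauss_dom gauss_map (gauss_measure :: (real ^ 'n) measure) \<and>
     ergodic gauss_dom gauss_map (gauss_measure :: (real ^ 'n) measure)"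
proof -
  \<comment> \<open>Invariance, mixing and ergodicity come directly from the abstract setting;
    exactness takes the measurability of images as an additional input.\<close>
  interpret partial_doeblin_system "gauss_measure :: (real ^ 'n) measure" gauss_map
    "(ln 2 / 8) ^ CARD('n)" gauss_dom
    by (rule partial_doeblin_system_gauss)
  have "AE x :: real ^ 'n in lborel. infinite_expansion x"
    unfolding infinite_expansion_iff by (rule AE_completely_irrational)
  moreover have "exact gauss_dom gauss_map (gauss_measure :: (real ^ 'n) measure)"
    by (rule exactI) (rule gauss_map_image_sets)
  ultimately show ?thesis
    using finite_expansion_iff infinite_expansion_iff eventually_repeating_iff cf_convergent_tendsto
      prob_space_gauss_measure leaves_invariant mixing_of_all_orders ergodic by blast
qed

end
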